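(* Assume the standing setup below and suppose the moment assumption (M) holds with numbers $w>4$ and $q\ge1$ such that $$\sum_{l=1}^\infty l\Big(\big(\phi(l)\big)^{1-\frac4w}+\big(\beta_q(l)\big)^{\kappa}\Big)<\infty .$$ Then, $P$-almost surely, $$\lim_{N\to\infty}\frac1N S_N=\bar F:=\int F(x_1,\dots,x_\ell)\,d\mu(x_1)\cdots d\mu(x_\ell).$$
   Context: Standing setup. Let $(\Omega,\mathcal F,P)$ be a probability space, $\wp\ge1$, and $\{\xi_n\}_{n\ge0}$ a sequence of $\mathbb R^\wp$-valued random vectors on it. Let $\{\mathcal F_{k,l}:-\infty\le k\le l\le\infty\}$ be sub-$\sigma$-algebras of $\mathcal F$ with $\mathcal F_{k,l}\subset\mathcal F_{k',l'}$ whenever $k'\le k$ and $l\le l'$. For sub-$\sigma$-algebras $\mathcal G,\mathcal H$ put $\phi(\mathcal G,\mathcal H)=\sup\{|P(\Gamma\cap\Delta)/P(\Gamma)-P(\Delta)|:\Gamma\in\mathcal G,\Delta\in\mathcal H,P(\Gamma)>0\}$ and $\phi(n)=\sup_{k\in\mathbb Z}\phi(\mathcal F_{-\infty,k},\mathcal F_{k+n,\infty})$. For $q\ge1$, $r\ge0$ put $\beta_q(r)=\sup_{k\ge0}\|\xi_k-\mathbb E[\xi_k\mid\mathcal F_{k-r,k+r}]\|_{L^q}$. Stationarity: every $\xi_n$ has the same distribution $\mu$, and the joint distribution of $(\xi_n,\xi_m)$ depends only on $m-n$. The function $F:(\mathbb R^\wp)^\ell\to\mathbb R$ satisfies, for some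 constants $K>0$, $\iota\ge0$, $\kappa\in(0,1]$ and all $x=(x_1,\dots,x_\ell)$, $z=(z_1,\dots,z_\ell)$: $|F(x)-F(z)|\le K[1+\sum_{i=1}^\ell(|x_i|^\iota+|z_i|^\iota)]\sum_{i=1}^\ell|x_i-z_i|^\kappa$ and $|F(x)|\le K[1+\sum_{i=1}^\ell|x_i|^\iota]$. Moment assumption (M): there are $w>4$, $q\ge1$, $v>0$ with $\frac1w>\frac{\iota}{v}+\frac{\kappa}{q}$ and $\|\xi_0\|_{L^v},\|\xi_0\|_{L^w},\|\xi_0\|_{L^q}<\infty$. Polynomials: $q_1,\dots,q_\ell$ are polynomials in two variables $(n,N)$ with nonnegative integer coefficients, none of which depends only on $N$; the degree of a bivariate polynomial $p(x,y)$ is the degree of $p(x,x)$; $\deg q_i\le\deg q_{i+1}$; for $i\ne j$ the difference $q_i-q_j$ is not constant; each linear $q_i$ has the form $q_i(n,N)=a_in+b_iN$ with integers $a_i,b_i$. Set $F_{n,N}=F(\xi_{q_1(n,N)},\dots,\xi_{q_\ell(n,N)})$ and $S_N=\sum_{n=1}^N F_{n,N}$. *)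

theory Defs
  imports "HOL-Probability.Probability" "HOL-Library.Extended"
begin

definition npow :: "real \<Rightarrow> real \<Rightarrow> real" where
  "npow t a = (if a = 0 then 1 else t powr a)"

definition Lp_norm :: "'a measure \<Rightarrow> real \<Rightarrow> ('a \<Rightarrow> 'v::real_normed_vector) \<Rightarrow> ennreal" where
  "Lp_norm M p X =
     (let I = (\<integral>\<^sup>+ \<omega>. ennreal (norm (X \<omega>) powr p) \<partial>M)
      in if I = \<infinity> then \<infinity> else ennreal (enn2real I powr (1 / p)))"

definition vcond_exp :: "'a measure \<Rightarrow> 'a measure \<Rightarrow> ('a \<Rightarrow> 'v::euclidean_space) \<Rightarrow> 'a \<Rightarrow> 'v" where
  "vcond_exp M G X = (\<lambda>\<omega>. \<Sum>b\<in>Basis. real_cond_exp M G (\<lambda>\<omega>'. X \<omega>' \<bullet> b) \<omega> *\<^sub>R b)"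

definition phi_coef :: "'a measure \<Rightarrow> 'a measure \<Rightarrow> 'a measure \<Rightarrow> real" where
  "phi_coef M G H = Sup {\<bar>measure M (\<Gamma> \<inter> \<Delta>) / measure M \<Gamma> - measure M \<Delta>\<bar> | \<Gamma> \<Delta>.
       \<Gamma> \<in> sets G \<and> \<Delta> \<in> sets H \<and> measure M \<Gamma> > 0}"

definition phi_mix :: "'a measure \<Rightarrow> (int extended \<Rightarrow> int extended \<Rightarrow> 'a measure) \<Rightarrow> nat \<Rightarrow> real" where
  "phi_mix M Fam n = (SUP k\<in>(UNIV::int set). phi_coef M (Fam Minf (Fin k)) (Fam (Fin (k + int n)) Pinf))"

definition beta_approx :: "'a measure \<Rightarrow> (int extended \<Rightarrow> int extended \<Rightarrow> 'a measure)
    \<Rightarrow> (nat \<Rightarrow> 'a \<Rightarrow> 'v::euclidean_space) \<Rightarrow> real \<Rightarrow> nat \<Rightarrow> ennreal" where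
  "beta_approx M Fam \<xi> q r = (SUP k\<in>(UNIV::nat set).
     Lp_norm M q (\<lambda>\<omega>. \<xi> k \<omega> - vcond_exp M (Fam (Fin (int k - int r)) (Fin (int k + int r))) (\<xi> k) \<omega>))"

(* Bivariate polynomials with nonnegative integer coefficients:
   c a b is the coefficient of n^a N^b; finitely many are nonzero. *)
definition bipoly_supp :: "(nat \<Rightarrow> nat \<Rightarrow> nat) \<Rightarrow> (nat \<times> nat) set" where
  "bipoly_supp c = {(a, b). c a b \<noteq> 0}"

definition bipoly_eval :: "(nat \<Rightarrow> nat \<Rightarrow> nat) \<Rightarrow> nat \<Rightarrow> nat \<Rightarrow> nat" where
  "bipoly_eval c n N = (\<Sum>(a, b)\<in>bipoly_supp c. c a b * n ^ a * N ^ b)"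

(* degree of p(x,y) = degree of p(x,x); no cancellation since coefficients are nonnegative *)
definition bipoly_deg :: "(nat \<Rightarrow> nat \<Rightarrow> nat) \<Rightarrow> nat" where
  "bipoly_deg c = Max ((\<lambda>(a, b). a + b) ` bipoly_supp c)"

end

theory Submission
  imports Defs "HOL-Computational_Algebra.Polynomial"
begin

text \<open>
  Integrating out one coordinate after the other writes \<open>F\<close> minus its mean as a finite sum of functions \<open>G\<close>
  of the same growth and Hoelder type, each of which integrates to zero in one coordinate \<open>i0\<close>. For such a
  \<open>G\<close> the fourth moment of the sum is a sum over quadruples of indices \<open>n\<close>. If the time in coordinate \<open>i0\<close>
  of one of the four factors is at distance at least \<open>6 L\<close> from all the other times that occur, then
  replacing the variables by their conditional expectations on windows of radius about \<open>L\<close>, truncating, and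
  using \<open>\<phi>\<close>-mixing on both sides of the isolated time shows that the quadruple contributes \<open>O(1 / L^2)\<close>,
  because the decoupled expectation vanishes. The polynomials are strictly increasing in \<open>n\<close> and their
  differences are not constant, so only \<open>O(N^2 L^2)\<close> quadruples have no isolated time. Using two scales
  \<open>L\<close> the fourth moment is \<open>O(N powr (11/4))\<close>, so the fourth moments of the averages are summable in \<open>N\<close>.
\<close>

section \<open>Decoupling under phi-mixing\<close>

text \<open>The summands of \<open>S_N\<close> depend on \<open>N\<close> as well as on
  \<open>n\<close>, so successive sums need share no terms and convergence along a subsequence
  cannot be interpolated. Moments have to be summable over all \<open>N\<close>. The second moment
  of an average is of order \<open>1/N\<close> already in the independent case, which is not
  summable; hence the fourth. The exponents of the series come from truncation. A product of four
  factors has a moment of order \<open>w / 4\<close>, so cutting it at height \<open>R\<close> costs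
  \<open>R powr (1 - w / 4)\<close>, while mixing costs \<open>R\<close> times the coefficient
  \<phi>. Balancing the two leaves \<phi> to the power \<open>1 - 4 / w\<close>. The Hoelder
  exponent turns an approximation error \<beta> into \<beta> to the power \<kappa>. The weight
  \<open>l\<close> in the series then provides, at some index between \<open>L\<close> and
  \<open>2 * L\<close>, a bound of order \<open>1 / L^2\<close>, which offsets the factor
  \<open>L^2\<close> in the count of quadruples without an isolated time.\<close>

definition phi_dep :: "'a measure \<Rightarrow> 'a measure \<Rightarrow> 'a measure \<Rightarrow> real \<Rightarrow> bool" where
  "phi_dep M G H t \<longleftrightarrow> (\<forall>\<Gamma>\<in>sets G. \<forall>\<Delta>\<in>sets H.
      \<bar>measure M (\<Gamma> \<inter> \<Delta>) - measure M \<Gamma> * measure M \<Delta>\<bar> \<le> t * measure M \<Gamma>)"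

text \<open>Makes the sets under the real-valued suprema of \<open>phi_coef\<close> and
  \<open>phi_mix\<close> bounded above, so that these suprema really dominate their members.
  Arbitrary sets are allowed because a non-event has measure 0 and division by 0 gives 0.\<close>

lemma (in prob_space) phi_coef_quotient_le:
  shows "\<bar>prob (\<Gamma> \<inter> \<Delta>) / prob \<Gamma> - prob \<Delta>\<bar> \<le> 1"
proof -
  have "prob (\<Gamma> \<inter> \<Delta>) \<le> prob \<Gamma>" if "\<Gamma> \<in> events"
    using that by (intro finite_measure_mono) auto
  moreover have "prob \<Gamma> = 0" if "\<Gamma> \<notin> events"
    using that by (simp add: measure_notin_sets)
  ultimately have "prob (\<Gamma> \<inter> \<Delta>) / prob \<Gamma> \<le> 1"
    by (cases "\<Gamma> \<in> events") (auto simp: divide_le_eq_1 zero_less_measure_iff)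
  moreover have "prob (\<Gamma> \<inter> \<Delta>) / prob \<Gamma> \<ge> 0" by simp
  moreover have "0 \<le> prob \<Delta>" "prob \<Delta> \<le> 1" by auto
  ultimately show ?thesis by linarith
qed

text \<open>The inequality defining the mixing coefficient, multiplied by the probability of the
  conditioning event. In this division-free form null events need no exception.\<close>

lemma (in prob_space) phi_dep_phi_mix:
  assumes sub: "\<And>k l. k \<le> l \<Longrightarrow> subalgebra M (Fam k l)"
  shows "phi_dep M (Fam Minf (Fin k)) (Fam (Fin (k + int n)) Pinf) (phi_mix M Fam n)"
  unfolding phi_dep_def
proof (intro ballI)
  let ?G = "\<lambda>k. Fam Minf (Fin k)" and ?H = "\<lambda>k. Fam (Fin (k + int n)) Pinf"
  let ?S = "\<lambda>k. {\<bar>prob (\<Gamma> \<inter> \<Delta>) / prob \<Gamma> - prob \<Delta>\<bar> | \<Gamma> \<Delta>.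
       \<Gamma> \<in> sets (?G k) \<and> \<Delta> \<in> sets (?H k) \<and> prob \<Gamma> > 0}"
  have bdd: "bdd_above (?S k)" for k
    by (intro bdd_aboveI[of _ 1]) (auto intro: phi_coef_quotient_le)
  have ne: "?S k \<noteq> {}" for k
  proof -
    have "space M \<in> sets (?G k)" "{} \<in> sets (?H k)"
      using sub[of Minf "Fin k"] sets.top[of "?G k"] by (auto simp: subalgebra_def)
    moreover have "prob (space M) > 0" by (simp add: prob_space)
    ultimately show ?thesis by blast
  qed
  have coef_le: "phi_coef M (?G k) (?H k) \<le> 1" for k
    unfolding phi_coef_def by (intro cSup_least ne) (auto intro: phi_coef_quotient_le)
  have le: "phi_coef M (?G k) (?H k) \<le> phi_mix M Fam n"
    unfolding phi_mix_def by (intro cSUP_upper bdd_aboveI2[of _ _ 1] coef_le) auto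
  fix \<Gamma> \<Delta> assume G: "\<Gamma> \<in> sets (?G k)" and H: "\<Delta> \<in> sets (?H k)"
  have ev: "\<Gamma> \<in> events" "\<Delta> \<in> events"
    using G H sub[of Minf "Fin k"] sub[of "Fin (k + int n)" Pinf] by (auto simp: subalgebra_def)
  show "\<bar>prob (\<Gamma> \<inter> \<Delta>) - prob \<Gamma> * prob \<Delta>\<bar> \<le> phi_mix M Fam n * prob \<Gamma>"
  proof (cases "prob \<Gamma> > 0")
    case True
    have "\<bar>prob (\<Gamma> \<inter> \<Delta>) / prob \<Gamma> - prob \<Delta>\<bar> \<le> phi_coef M (?G k) (?H k)"
      unfolding phi_coef_def using G H True by (intro cSup_upper bdd) auto
    with le have "\<bar>prob (\<Gamma> \<inter> \<Delta>) / prob \<Gamma> - prob \<Delta>\<bar> \<le> phi_mix M Fam n" by linarith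
    then have "\<bar>prob (\<Gamma> \<inter> \<Delta>) / prob \<Gamma> - prob \<Delta>\<bar> * prob \<Gamma> \<le> phi_mix M Fam n * prob \<Gamma>"
      by (intro mult_right_mono) auto
    also have "\<bar>prob (\<Gamma> \<inter> \<Delta>) / prob \<Gamma> - prob \<Delta>\<bar> * prob \<Gamma>
        = \<bar>(prob (\<Gamma> \<inter> \<Delta>) / prob \<Gamma> - prob \<Delta>) * prob \<Gamma>\<bar>"
      by (simp add: abs_mult)
    also have "(prob (\<Gamma> \<inter> \<Delta>) / prob \<Gamma> - prob \<Delta>) * prob \<Gamma> = prob (\<Gamma> \<inter> \<Delta>) - prob \<Gamma> * prob \<Delta>"
      using True by (simp add: field_simps)
    finally show ?thesis .
  next
    case False
    then have z: "prob \<Gamma> = 0" by (simp add: zero_less_measure_iff)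
    have "prob (\<Gamma> \<inter> \<Delta>) \<le> prob \<Gamma>" using ev by (intro finite_measure_mono) auto
    with z have "prob (\<Gamma> \<inter> \<Delta>) = 0" by (simp add: measure_le_0_iff)
    with z show ?thesis by simp
  qed
qed

lemma (in prob_space) subalgebra_sigma_finite:
  "subalgebra M H \<Longrightarrow> sigma_finite_subalgebra M H"
  by (rule finite_measure_subalgebra_is_sigma_finite)
     (auto simp: finite_measure_subalgebra_def finite_measure_subalgebra_axioms_def finite_measure_axioms)

text \<open>With \<open>h\<close> the conditional probability of \<open>A\<close> given
  \<open>H\<close>, the difference is the integral of \<open>g * (h - prob A)\<close>, hence at most
  \<open>R\<close> times the L1 distance of \<open>h\<close> from its mean. The factor 2 comes from
  the two signs of \<open>h - prob A\<close>. Keeping the factor \<open>prob A\<close> allows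
  summation over a partition without loss.\<close>

lemma (in prob_space) phi_dep_integral:
  fixes g :: "'a \<Rightarrow> real"
  assumes dep: "phi_dep M G H t" and sG: "subalgebra M G" and sH: "subalgebra M H"
    and A: "A \<in> sets G" and g: "g \<in> borel_measurable H" and R: "\<And>\<omega>. \<bar>g \<omega>\<bar> \<le> R"
  shows "\<bar>(\<integral>\<omega>. indicator A \<omega> * g \<omega> \<partial>M) - prob A * expectation g\<bar> \<le> 2 * R * t * prob A"
proof -
  interpret sigma_finite_subalgebra M H by (rule subalgebra_sigma_finite[OF sH])
  have AM[measurable]: "A \<in> sets M" using A sG by (auto simp: subalgebra_def)
  have gM[measurable]: "g \<in> borel_measurable M" using g sH measurable_from_subalg by blast
  define h where "h = real_cond_exp M H (indicator A)"
  have hH[measurable]: "h \<in> borel_measurable H" "h \<in> borel_measurable M" unfolding h_def by auto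
  have iA: "integrable M (indicator A :: 'a \<Rightarrow> real)"
    by (rule integrable_const_bound[of _ 1]) (auto simp: indicator_def)
  have ih: "integrable M h" unfolding h_def by (rule real_cond_exp_int[OF iA])
  have R0: "R \<ge> 0" using R[of undefined] by linarith
  have ig: "integrable M g" by (rule integrable_const_bound[of _ R]) (auto simp: R)
  have igA: "integrable M (\<lambda>\<omega>. g \<omega> * indicator A \<omega>)"
    by (rule integrable_const_bound[of _ R]) (auto simp: indicator_def R R0)
  note cg = real_cond_exp_intg[OF igA g, simplified, folded h_def]
  \<comment> \<open>The L1 distance of \<open>h\<close> from its mean is attained on the two sets where \<open>h - prob A\<close> has constant sign,
    and these are \<open>H\<close>-measurable.\<close>
  define D where "D = {\<omega> \<in> space H. h \<omega> \<ge> prob A}"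
  have DH: "D \<in> sets H" unfolding D_def by measurable
  have sp: "space H = space M" using sH by (auto simp: subalgebra_def)
  have DM[measurable]: "D \<in> sets M" using DH sH by (auto simp: subalgebra_def)
  have CH: "space M - D \<in> sets H" using DH sp by (metis sets.compl_sets)
  have bound: "\<bar>(\<integral>\<omega>. indicator E \<omega> * (h \<omega> - prob A) \<partial>M)\<bar> \<le> t * prob A" if E: "E \<in> sets H" for E
  proof -
    have EM[measurable]: "E \<in> sets M" using E sH by (auto simp: subalgebra_def)
    have i1: "integrable M (\<lambda>\<omega>. indicator E \<omega> * indicator A \<omega> :: real)"
      by (rule integrable_const_bound[of _ 1]) (auto simp: indicator_def)
    have mE: "indicator E \<in> borel_measurable H" using E by measurable
    note * = real_cond_exp_intg[OF i1 mE, simplified, folded h_def]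
    have "(\<integral>\<omega>. indicator E \<omega> * (h \<omega> - prob A) \<partial>M)
        = (\<integral>\<omega>. indicator E \<omega> * h \<omega> \<partial>M) - (\<integral>\<omega>. indicator E \<omega> * prob A \<partial>M)"
      unfolding right_diff_distrib
      by (intro Bochner_Integration.integral_diff integrable_mult_left *(1)
          integrable_const_bound[of _ 1]) (auto simp: indicator_def)
    also have "(\<integral>\<omega>. indicator E \<omega> * h \<omega> \<partial>M) = (\<integral>\<omega>. indicator (A \<inter> E) \<omega> \<partial>M)"
      using *(2) by (simp add: indicator_inter_arith mult.commute)
    also have "\<dots> = prob (A \<inter> E)" by simp
    finally show ?thesis using dep A E unfolding phi_dep_def by (auto simp: mult.commute)
  qed
  have iabs: "integrable M (\<lambda>\<omega>. \<bar>h \<omega> - prob A\<bar>)" using ih by auto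
  have "(\<integral>\<omega>. \<bar>h \<omega> - prob A\<bar> \<partial>M) =
     (\<integral>\<omega>. indicator D \<omega> * (h \<omega> - prob A) - indicator (space M - D) \<omega> * (h \<omega> - prob A) \<partial>M)"
    by (rule Bochner_Integration.integral_cong) (auto simp: D_def sp indicator_def)
  also have "\<dots> = (\<integral>\<omega>. indicator D \<omega> * (h \<omega> - prob A) \<partial>M)
       - (\<integral>\<omega>. indicator (space M - D) \<omega> * (h \<omega> - prob A) \<partial>M)"
    using ih integrable_mult_indicator[of D M "\<lambda>\<omega>. h \<omega> - prob A"]
      integrable_mult_indicator[of "space M - D" M "\<lambda>\<omega>. h \<omega> - prob A"]
    by (intro Bochner_Integration.integral_diff) auto
  also have "\<dots> \<le> 2 * (t * prob A)" using bound[OF DH] bound[OF CH] by linarith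
  finally have abs: "(\<integral>\<omega>. \<bar>h \<omega> - prob A\<bar> \<partial>M) \<le> 2 * (t * prob A)" .
  have "(\<integral>\<omega>. indicator A \<omega> * g \<omega> \<partial>M) - prob A * expectation g
      = (\<integral>\<omega>. g \<omega> * h \<omega> \<partial>M) - (\<integral>\<omega>. g \<omega> * prob A \<partial>M)"
    using cg(2) by (simp add: mult.commute)
  also have "\<dots> = (\<integral>\<omega>. g \<omega> * (h \<omega> - prob A) \<partial>M)"
    using cg(1) ig by (simp add: algebra_simps)
  also have "\<bar>\<dots>\<bar> \<le> (\<integral>\<omega>. \<bar>g \<omega> * (h \<omega> - prob A)\<bar> \<partial>M)" by (rule integral_abs_bound)
  also have "\<dots> \<le> (\<integral>\<omega>. R * \<bar>h \<omega> - prob A\<bar> \<partial>M)"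
    by (rule integral_mono') (use iabs R R0 in \<open>auto simp: abs_mult intro!: mult_right_mono\<close>)
  also have "\<dots> \<le> R * (2 * (t * prob A))" using abs R0 by (simp add: mult_left_mono)
  finally show ?thesis by (simp add: mult_ac)
qed

lemma (in prob_space) phi_dep_nonneg: 
  assumes "phi_dep M G H t" "subalgebra M G" "subalgebra M H" shows "0 \<le> t"
proof -
  have "space M \<in> sets G" "space M \<in> sets H" 
    using assms sets.top[of G] sets.top[of H] by (auto simp: subalgebra_def)
  then have "\<bar>prob (space M \<inter> space M) - prob (space M) * prob (space M)\<bar> \<le> t * prob (space M)"
    using assms unfolding phi_dep_def by blast
  then show ?thesis by (simp add: prob_space)
qed

text \<open>If \<open>U\<close> takes finitely many values, its level sets partition the space and
  \<open>phi_dep_integral\<close> applies on each; the probabilities add up to at most 1. Continuity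
  in \<open>u\<close> and dominated convergence carry the bound from simple functions to
  \<open>U\<close>.\<close>

lemma (in prob_space) phi_dep_decouple:
  fixes U :: "'a \<Rightarrow> 'b::{metric_space, second_countable_topology}" and f :: "'b \<Rightarrow> 'a \<Rightarrow> real"
  assumes dep: "phi_dep M G H t" and sG: "subalgebra M G" and sH: "subalgebra M H"
    and U: "U \<in> borel_measurable G"
    and cont: "\<And>\<omega>. continuous_on UNIV (\<lambda>u. f u \<omega>)"
    and meas: "\<And>u. f u \<in> borel_measurable H" and R: "\<And>u \<omega>. \<bar>f u \<omega>\<bar> \<le> R"
  shows "\<bar>(\<integral>\<omega>. f (U \<omega>) \<omega> \<partial>M) - (\<integral>\<omega>. (\<integral>\<omega>'. f (U \<omega>) \<omega>' \<partial>M) \<partial>M)\<bar> \<le> 2 * R * t"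
proof -
  have R0: "R \<ge> 0" using R[of undefined undefined] by linarith
  have t0: "t \<ge> 0" by (rule phi_dep_nonneg[OF dep sG sH])
  have spG: "space G = space M" and GM: "sets G \<subseteq> sets M" using sG by (auto simp: subalgebra_def)
  have fM[measurable]: "f u \<in> borel_measurable M" for u using meas sH measurable_from_subalg by blast
  obtain V where V: "\<And>i. simple_function G (V i)" and lim: "\<And>\<omega>. \<omega> \<in> space M \<Longrightarrow> (\<lambda>i. V i \<omega>) \<longlonglongrightarrow> U \<omega>"
    using borel_measurable_implies_sequence_metric[OF U] spG by metis
  have flim: "(\<lambda>i. f (V i \<omega>) \<omega>') \<longlonglongrightarrow> f (U \<omega>) \<omega>'" if "\<omega> \<in> space M" for \<omega> \<omega>'
    by (rule continuous_on_tendsto_compose[OF cont lim[OF that]]) auto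
  define S where "S i = V i ` space M" for i
  have fin: "finite (S i)" for i using V[of i] spG unfolding simple_function_def S_def by auto
  define B where "B i u = V i -` {u} \<inter> space M" for i u
  have BG: "B i u \<in> sets G" for i u
    using V[of i] spG unfolding B_def by (metis simple_functionD(2))
  have BM[measurable]: "B i u \<in> sets M" for i u using BG GM by auto
  have split: "g (V i \<omega>) = (\<Sum>u\<in>S i. indicator (B i u) \<omega> * g u)" if "\<omega> \<in> space M" for i \<omega> and g :: "'b \<Rightarrow> real"
  proof -
    have "(\<Sum>u\<in>S i. indicator (B i u) \<omega> * g u) = (\<Sum>u\<in>S i. if u = V i \<omega> then g u else 0)"
      using that by (intro sum.cong) (auto simp: B_def indicator_def)
    also have "\<dots> = g (V i \<omega>)" using that fin[of i] by (simp add: S_def)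
    finally show ?thesis by simp
  qed
  have int_f: "integrable M (f u)" for u
    by (rule integrable_const_bound[of _ R]) (auto simp: R)
  have int_Bf: "integrable M (\<lambda>\<omega>. indicator (B i u) \<omega> * f u \<omega>)" for i u
    by (rule integrable_const_bound[of _ R]) (auto simp: indicator_def R R0)
  define I where "I u = (\<integral>\<omega>'. f u \<omega>' \<partial>M)" for u
  have IR: "\<bar>I u\<bar> \<le> R" for u
  proof -
    have "\<bar>I u\<bar> \<le> (\<integral>\<omega>'. \<bar>f u \<omega>'\<bar> \<partial>M)" unfolding I_def by (rule integral_abs_bound)
    also have "\<dots> \<le> (\<integral>\<omega>'. R \<partial>M)" by (rule integral_mono') (auto simp: R R0)
    finally show ?thesis by (simp add: prob_space)
  qed
  have m1: "(\<lambda>\<omega>. f (V i \<omega>) \<omega>) \<in> borel_measurable M" for i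
    by (subst measurable_cong[OF split[of _ "\<lambda>u. f u _"]]) auto
  have m2: "(\<lambda>\<omega>. I (V i \<omega>)) \<in> borel_measurable M" for i
    by (subst measurable_cong[OF split]) auto
  have Ilim: "(\<lambda>i. I (V i \<omega>)) \<longlonglongrightarrow> I (U \<omega>)" if "\<omega> \<in> space M" for \<omega>
    unfolding I_def
    by (rule integral_dominated_convergence[where w="\<lambda>_. R"])
       (use flim[OF that] R in auto)
  have m3: "(\<lambda>\<omega>. f (U \<omega>) \<omega>) \<in> borel_measurable M"
    by (rule borel_measurable_LIMSEQ_real[OF _ m1]) (rule flim)
  have m4: "(\<lambda>\<omega>. I (U \<omega>)) \<in> borel_measurable M"
    by (rule borel_measurable_LIMSEQ_real[OF _ m2]) (rule Ilim)
  have L1: "(\<lambda>i. \<integral>\<omega>. f (V i \<omega>) \<omega> \<partial>M) \<longlonglongrightarrow> (\<integral>\<omega>. f (U \<omega>) \<omega> \<partial>M)"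
    by (rule integral_dominated_convergence[where w="\<lambda>_. R"]) (use flim R m1 m3 in auto)
  have L2: "(\<lambda>i. \<integral>\<omega>. I (V i \<omega>) \<partial>M) \<longlonglongrightarrow> (\<integral>\<omega>. I (U \<omega>) \<partial>M)"
    by (rule integral_dominated_convergence[where w="\<lambda>_. R"]) (use Ilim IR m2 m4 in auto)
  have bd: "\<bar>(\<integral>\<omega>. f (V i \<omega>) \<omega> \<partial>M) - (\<integral>\<omega>. I (V i \<omega>) \<partial>M)\<bar> \<le> 2 * R * t" for i
  proof -
    have "(\<integral>\<omega>. f (V i \<omega>) \<omega> \<partial>M) = (\<integral>\<omega>. (\<Sum>u\<in>S i. indicator (B i u) \<omega> * f u \<omega>) \<partial>M)"
      by (rule Bochner_Integration.integral_cong[OF refl]) (rule split)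
    also have "\<dots> = (\<Sum>u\<in>S i. \<integral>\<omega>. indicator (B i u) \<omega> * f u \<omega> \<partial>M)"
      by (rule Bochner_Integration.integral_sum) (rule int_Bf)
    finally have e1: "(\<integral>\<omega>. f (V i \<omega>) \<omega> \<partial>M) = (\<Sum>u\<in>S i. \<integral>\<omega>. indicator (B i u) \<omega> * f u \<omega> \<partial>M)" .
    have "(\<integral>\<omega>. I (V i \<omega>) \<partial>M) = (\<integral>\<omega>. (\<Sum>u\<in>S i. indicator (B i u) \<omega> * I u) \<partial>M)"
      by (rule Bochner_Integration.integral_cong[OF refl]) (rule split)
    also have "\<dots> = (\<Sum>u\<in>S i. \<integral>\<omega>. indicator (B i u) \<omega> * I u \<partial>M)"
      by (intro Bochner_Integration.integral_sum integrable_mult_left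
          integrable_const_bound[of _ 1]) (auto simp: indicator_def)
    also have "\<dots> = (\<Sum>u\<in>S i. prob (B i u) * expectation (f u))"
      by (simp add: I_def)
    finally have e2: "(\<integral>\<omega>. I (V i \<omega>) \<partial>M) = (\<Sum>u\<in>S i. prob (B i u) * expectation (f u))" .
    have "\<bar>(\<integral>\<omega>. f (V i \<omega>) \<omega> \<partial>M) - (\<integral>\<omega>. I (V i \<omega>) \<partial>M)\<bar>
        \<le> (\<Sum>u\<in>S i. \<bar>(\<integral>\<omega>. indicator (B i u) \<omega> * f u \<omega> \<partial>M) - prob (B i u) * expectation (f u)\<bar>)"
      unfolding e1 e2 sum_subtractf[symmetric] by (rule sum_abs)
    also have "\<dots> \<le> (\<Sum>u\<in>S i. 2 * R * t * prob (B i u))"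
      by (intro sum_mono phi_dep_integral[OF dep sG sH BG meas R])
    also have "\<dots> = 2 * R * t * (\<Sum>u\<in>S i. prob (B i u))" by (simp add: sum_distrib_left)
    also have "(\<Sum>u\<in>S i. prob (B i u)) = prob (\<Union>u\<in>S i. B i u)"
      by (rule finite_measure_finite_Union[symmetric])
         (auto simp: fin disjoint_family_on_def B_def BM[unfolded B_def])
    also have "2 * R * t * \<dots> \<le> 2 * R * t * 1"
      using R0 t0 by (intro mult_left_mono) auto
    finally show ?thesis by simp
  qed
  have "\<bar>(\<integral>\<omega>. f (U \<omega>) \<omega> \<partial>M) - (\<integral>\<omega>. I (U \<omega>) \<partial>M)\<bar> \<le> 2 * R * t"
    by (rule tendsto_upperbound[OF tendsto_rabs[OF tendsto_diff[OF L1 L2]]]) (use bd in auto)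
  then show ?thesis unfolding I_def .
qed

text \<open>The instance of \<open>phi_dep_decouple\<close> in which \<open>U\<close> gathers all
  coordinates below \<open>P\<close> as one point of the metric space of sequences.\<close>

lemma (in prob_space) phi_dep_cut:
  fixes Y :: "nat \<Rightarrow> 'a \<Rightarrow> 'v::euclidean_space"
  assumes dep: "phi_dep M G H t" and sG: "subalgebra M G" and sH: "subalgebra M H"
    and low: "\<And>k. k < P \<Longrightarrow> Y k \<in> borel_measurable G"
    and high: "\<And>k. P \<le> k \<Longrightarrow> Y k \<in> borel_measurable H"
    and cont: "continuous_on UNIV \<Psi>" and R: "\<And>x. \<bar>\<Psi> x\<bar> \<le> R"
  shows "\<bar>(\<integral>\<omega>. \<Psi> (\<lambda>k. Y k \<omega>) \<partial>M)
    - (\<integral>\<omega>. (\<integral>\<omega>'. \<Psi> (\<lambda>k. if k < P then Y k \<omega> else Y k \<omega>') \<partial>M) \<partial>M)\<bar> \<le> 2 * R * t"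
proof -
  \<comment> \<open>The value 0 from \<open>P\<close> on is a filler which \<open>f\<close> never
    reads; it makes the whole sequence \<open>G\<close>-measurable.\<close>
  define U where "U \<omega> = (\<lambda>k. if k < P then Y k \<omega> else 0)" for \<omega>
  define f where "f u \<omega> = \<Psi> (\<lambda>k. if k < P then u k else Y k \<omega>)" for u \<omega>
  have U: "U \<in> borel_measurable G"
    unfolding U_def
  proof (rule measurable_coordinatewise_then_product)
    show "(\<lambda>\<omega>. if k < P then Y k \<omega> else 0) \<in> borel_measurable G" for k
      by (cases "k < P") (auto simp: low)
  qed
  have contf: "continuous_on UNIV (\<lambda>u. f u \<omega>)" for \<omega>
    unfolding f_def
  proof (rule continuous_on_compose2[OF cont continuous_on_coordinatewise_then_product])
    show "continuous_on UNIV (\<lambda>u. if k < P then u k else Y k \<omega>)" for k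
      by (cases "k < P") auto
  qed auto
  have \<Psi>: "\<Psi> \<in> borel_measurable borel" by (rule borel_measurable_continuous_onI[OF cont])
  have "(\<lambda>\<omega>. (\<lambda>k. if k < P then u k else Y k \<omega>)) \<in> borel_measurable H" for u
  proof (rule measurable_coordinatewise_then_product)
    show "(\<lambda>\<omega>. if k < P then u k else Y k \<omega>) \<in> borel_measurable H" for k
      by (cases "k < P") (auto simp: high)
  qed
  then have measf: "f u \<in> borel_measurable H" for u
    unfolding f_def using \<Psi> measurable_compose by blast
  have "\<bar>f u \<omega>\<bar> \<le> R" for u \<omega> unfolding f_def by (rule R)
  from phi_dep_decouple[OF dep sG sH U contf measf this]
  show ?thesis by (simp add: f_def U_def if_distrib cong: if_cong)
qed

text \<open>The three components of \<open>\<omega>\<close> feed the coordinates below, at and above \<open>P\<close>, so that the coordinate at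
  \<open>P\<close> becomes independent of all others.\<close>

lemma (in prob_space) phi_dep_isolated:
  fixes Y :: "nat \<Rightarrow> 'a \<Rightarrow> 'v::euclidean_space"
  assumes dep1: "phi_dep M G1 H1 t" and sG1: "subalgebra M G1" and sH1: "subalgebra M H1"
    and dep2: "phi_dep M G2 H2 t" and sG2: "subalgebra M G2" and sH2: "subalgebra M H2"
    and low1: "\<And>k. k < P \<Longrightarrow> Y k \<in> borel_measurable G1"
    and high1: "\<And>k. P \<le> k \<Longrightarrow> Y k \<in> borel_measurable H1"
    and low2: "\<And>k. k \<le> P \<Longrightarrow> Y k \<in> borel_measurable G2"
    and high2: "\<And>k. P < k \<Longrightarrow> Y k \<in> borel_measurable H2"
    and cont: "continuous_on UNIV \<Psi>" and R: "\<And>x. \<bar>\<Psi> x\<bar> \<le> R"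
  shows "\<bar>(\<integral>\<omega>. \<Psi> (\<lambda>k. Y k \<omega>) \<partial>M)
    - (\<integral>\<omega>. \<Psi> (\<lambda>k. Y k (if k < P then fst \<omega> else if k = P then fst (snd \<omega>) else snd (snd \<omega>)))
        \<partial>(M \<Otimes>\<^sub>M (M \<Otimes>\<^sub>M M)))\<bar> \<le> 4 * R * t"
proof -
  have R0: "R \<ge> 0" using R[of undefined] by linarith
  interpret MM: pair_prob_space M M by unfold_locales
  interpret MMM: pair_prob_space M "M \<Otimes>\<^sub>M M" by unfold_locales
  have YM[measurable]: "Y k \<in> borel_measurable M" for k
    using measurable_from_subalg[OF sG1 low1[of k]] measurable_from_subalg[OF sH1 high1[of k]]
    by (cases "k < P") auto
  have [measurable]: "\<Psi> \<in> borel_measurable borel" by (rule borel_measurable_continuous_onI[OF cont])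
  let ?Z = "\<lambda>\<omega>. \<Psi> (\<lambda>k. Y k (if k < P then fst \<omega> else if k = P then fst (snd \<omega>) else snd (snd \<omega>)))"
  have mZ[measurable]: "?Z \<in> borel_measurable (M \<Otimes>\<^sub>M (M \<Otimes>\<^sub>M M))"
    by (rule measurable_compose[OF measurable_coordinatewise_then_product]) measurable
  have iZ: "integrable (M \<Otimes>\<^sub>M (M \<Otimes>\<^sub>M M)) ?Z"
    by (rule MMM.integrable_const_bound[of _ R]) (auto simp: R mZ)
  have mA[measurable]: "(\<lambda>(x, y). \<Psi> (\<lambda>k. if k < P then Y k x else Y k y)) \<in> borel_measurable (M \<Otimes>\<^sub>M M)"
    unfolding case_prod_beta
    by (rule measurable_compose[OF measurable_coordinatewise_then_product]) measurable
  define A where "A x = (\<integral>y. \<Psi> (\<lambda>k. if k < P then Y k x else Y k y) \<partial>M)" for x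
  define B where "B x = (\<integral>y. ?Z (x, y) \<partial>(M \<Otimes>\<^sub>M M))" for x
  have AB: "\<bar>A x - B x\<bar> \<le> 2 * R * t" if x: "x \<in> space M" for x
  proof -
    \<comment> \<open>With the past frozen at \<open>x\<close>, a second cut separates coordinate
      \<open>P\<close> from the later ones. It is made at \<open>Suc P\<close>, so that
      \<open>P\<close> now lies on the low side. Each of the two cuts costs
      \<open>2 * R * t\<close>.\<close>
    define \<Phi> where "\<Phi> u = \<Psi> (\<lambda>k. if k < P then Y k x else u k)" for u
    have c\<Phi>: "continuous_on UNIV \<Phi>"
      unfolding \<Phi>_def
    proof (rule continuous_on_compose2[OF cont continuous_on_coordinatewise_then_product])
      show "continuous_on UNIV (\<lambda>u. if k < P then Y k x else u k)" for k
        by (cases "k < P") auto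
    qed auto
    have "\<bar>(\<integral>\<omega>. \<Phi> (\<lambda>k. Y k \<omega>) \<partial>M)
      - (\<integral>\<omega>. (\<integral>\<omega>'. \<Phi> (\<lambda>k. if k < Suc P then Y k \<omega> else Y k \<omega>') \<partial>M) \<partial>M)\<bar> \<le> 2 * R * t"
      by (rule phi_dep_cut[OF dep2 sG2 sH2 _ _ c\<Phi>]) (auto simp: low2 high2 \<Phi>_def R)
    moreover have "(\<integral>\<omega>. (\<integral>\<omega>'. \<Phi> (\<lambda>k. if k < Suc P then Y k \<omega> else Y k \<omega>') \<partial>M) \<partial>M)
       = (\<integral>\<omega>. (\<integral>\<omega>'. ?Z (x, (\<omega>, \<omega>')) \<partial>M) \<partial>M)"
      unfolding \<Phi>_def
      by (intro Bochner_Integration.integral_cong refl arg_cong[of _ _ \<Psi>] ext) auto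
    moreover have "\<dots> = B x"
      unfolding B_def
    proof (rule MM.integral_fst')
      show "integrable (M \<Otimes>\<^sub>M M) (\<lambda>y. ?Z (x, y))"
        using x by (intro MM.integrable_const_bound[of _ R]) (auto simp: R)
    qed
    ultimately show ?thesis by (simp add: A_def \<Phi>_def)
  qed
  have mA': "A \<in> borel_measurable M" unfolding A_def by measurable
  have mB': "B \<in> borel_measurable M" unfolding B_def by measurable
  have AR: "\<bar>A x\<bar> \<le> R" for x
  proof -
    have "\<bar>A x\<bar> \<le> (\<integral>y. \<bar>\<Psi> (\<lambda>k. if k < P then Y k x else Y k y)\<bar> \<partial>M)"
      unfolding A_def by (rule integral_abs_bound)
    also have "\<dots> \<le> (\<integral>y. R \<partial>M)" by (rule integral_mono') (auto simp: R R0)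
    finally show ?thesis by (simp add: prob_space)
  qed
  have BR: "\<bar>B x\<bar> \<le> R" for x
  proof -
    have "\<bar>B x\<bar> \<le> (\<integral>y. \<bar>?Z (x, y)\<bar> \<partial>(M \<Otimes>\<^sub>M M))"
      unfolding B_def by (rule integral_abs_bound)
    also have "\<dots> \<le> (\<integral>y. R \<partial>(M \<Otimes>\<^sub>M M))" by (rule integral_mono') (auto simp: R R0)
    finally show ?thesis by (simp add: MM.prob_space)
  qed
  have iA: "integrable M A" by (rule integrable_const_bound[of _ R]) (auto simp: AR mA')
  have iB: "integrable M B" by (rule integrable_const_bound[of _ R]) (auto simp: BR mB')
  have "\<bar>(\<integral>x. A x \<partial>M) - (\<integral>x. B x \<partial>M)\<bar> = \<bar>\<integral>x. A x - B x \<partial>M\<bar>" using iA iB by simp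
  also have "\<dots> \<le> (\<integral>x. \<bar>A x - B x\<bar> \<partial>M)" by (rule integral_abs_bound)
  also have "\<dots> \<le> (\<integral>x. 2 * R * t \<partial>M)" using iA iB by (intro integral_mono AB) auto
  finally have "\<bar>(\<integral>x. A x \<partial>M) - (\<integral>x. B x \<partial>M)\<bar> \<le> 2 * R * t" by (simp add: prob_space)
  moreover have "(\<integral>x. B x \<partial>M) = integral\<^sup>L (M \<Otimes>\<^sub>M (M \<Otimes>\<^sub>M M)) ?Z"
    unfolding B_def by (rule MMM.integral_fst'[OF iZ])
  moreover have "\<bar>(\<integral>\<omega>. \<Psi> (\<lambda>k. Y k \<omega>) \<partial>M) - (\<integral>x. A x \<partial>M)\<bar> \<le> 2 * R * t"
    unfolding A_def by (rule phi_dep_cut[OF dep1 sG1 sH1 low1 high1 cont R])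
  ultimately show ?thesis by linarith
qed

section \<open>Functions of polynomial growth\<close>

lemma npow_nonneg [simp]: "0 \<le> npow t a"
  by (simp add: npow_def)

lemma continuous_on_npow:
  assumes "0 \<le> a" "continuous_on S f" "\<And>x. x \<in> S \<Longrightarrow> 0 \<le> f x"
  shows "continuous_on S (\<lambda>x. npow (f x) a)"
proof (cases "a = 0")
  case False
  then show ?thesis unfolding npow_def using assms
    by (auto intro!: continuous_on_powr')
qed (simp add: npow_def)

text \<open>Expresses every growth term through one number \<open>Y\<close> that dominates the
  \<open>v\<close>-th powers. The exponent 0 is where \<open>1 \<le> Y\<close> enters directly,
  since \<open>npow t 0 = 1\<close>.\<close>

lemma npow_le_powr:
  assumes "0 \<le> t" "1 \<le> Y" "0 < v" "t powr v \<le> Y" "0 \<le> a"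
  shows "npow t a \<le> Y powr (a / v)"
proof (cases "a = 0")
  case False
  have "npow t a = (t powr v) powr (a / v)" using False assms by (simp add: npow_def powr_powr)
  also have "\<dots> \<le> Y powr (a / v)" using assms by (intro powr_mono2) auto
  finally show ?thesis .
qed (use assms in \<open>simp add: npow_def\<close>)

text \<open>Ranging over all sequences instead of functions extensional on \<open>{..<ell}\<close>
  lets points be updated freely and gives access to the product topology; the Hoelder bound itself
  makes \<open>G\<close> blind to coordinates from \<open>ell\<close> on
  (\<open>holder_class_cong\<close>). The constant is explicit because it changes when a coordinate
  is integrated out.\<close>

definition holder_class :: "nat \<Rightarrow> real \<Rightarrow> real \<Rightarrow> real \<Rightarrow> ((nat \<Rightarrow> 'v::real_normed_vector) \<Rightarrow> real) \<Rightarrow> bool"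
  where "holder_class ell \<iota> \<kappa> K G \<longleftrightarrow>
    (\<forall>x z. \<bar>G x - G z\<bar> \<le> K * (1 + (\<Sum>i<ell. npow (norm (x i)) \<iota> + npow (norm (z i)) \<iota>))
                          * (\<Sum>i<ell. norm (x i - z i) powr \<kappa>)) \<and>
    (\<forall>x. \<bar>G x\<bar> \<le> K * (1 + (\<Sum>i<ell. npow (norm (x i)) \<iota>)))"

lemma holder_classD:
  assumes "holder_class ell \<iota> \<kappa> K G"
  shows "\<bar>G x - G z\<bar> \<le> K * (1 + (\<Sum>i<ell. npow (norm (x i)) \<iota> + npow (norm (z i)) \<iota>))
                          * (\<Sum>i<ell. norm (x i - z i) powr \<kappa>)"
    and "\<bar>G x\<bar> \<le> K * (1 + (\<Sum>i<ell. npow (norm (x i)) \<iota>))"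
  using assms unfolding holder_class_def by auto

text \<open>The right-hand side of the Hoelder bound involves finitely many coordinates, is
  continuous in \<open>x\<close> and vanishes at \<open>z\<close>.\<close>

lemma holder_class_continuous:
  fixes G :: "(nat \<Rightarrow> 'v::euclidean_space) \<Rightarrow> real"
  assumes G: "holder_class ell \<iota> \<kappa> K G" and "0 \<le> \<iota>" "0 < \<kappa>"
  shows "continuous_on UNIV G"
  unfolding continuous_on_def
proof
  fix z :: "nat \<Rightarrow> 'v"
  define h where "h x = K * (1 + (\<Sum>i<ell. npow (norm (x i)) \<iota> + npow (norm (z i)) \<iota>))
                          * (\<Sum>i<ell. norm (x i - z i) powr \<kappa>)" for x :: "nat \<Rightarrow> 'v"
  have "continuous_on UNIV h"
    unfolding h_def using assms
    by (intro continuous_intros continuous_on_npow continuous_on_powr' ballI) auto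
  then have "(h \<longlongrightarrow> h z) (at z within UNIV)" by (simp add: continuous_on_def)
  then have h0: "(h \<longlongrightarrow> 0) (at z within UNIV)" using assms by (simp add: h_def)
  have "((\<lambda>x. G x - G z) \<longlongrightarrow> 0) (at z within UNIV)"
    by (rule Lim_null_comparison[OF _ h0]) (use holder_classD(1)[OF G] in \<open>auto simp: h_def\<close>)
  then show "(G \<longlongrightarrow> G z) (at z within UNIV)" by (simp add: LIM_zero_iff)
qed

text \<open>Truncation applied to the value of a product, not to its arguments. It is continuous, as
  decoupling requires, and 1-Lipschitz, so it does not enlarge approximation errors.\<close>

definition clamp_abs :: "real \<Rightarrow> real \<Rightarrow> real" where
  "clamp_abs R x = max (- R) (min R x)"

lemma clamp_abs_le: "0 \<le> R \<Longrightarrow> \<bar>clamp_abs R x\<bar> \<le> R"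
  by (auto simp: clamp_abs_def)

lemma clamp_abs_lipschitz: "\<bar>clamp_abs R x - clamp_abs R y\<bar> \<le> \<bar>x - y\<bar>"
  by (auto simp: clamp_abs_def)

lemma continuous_on_clamp_abs [continuous_intros]:
  "continuous_on S f \<Longrightarrow> continuous_on S (\<lambda>x. clamp_abs R (f x))"
  unfolding clamp_abs_def by (intro continuous_intros)

text \<open>A Markov-type estimate: the clamp acts only where the modulus exceeds \<open>R\<close>,
  and there the nonpositive power \<open>1 - p\<close> of the modulus is at most
  \<open>R powr (1 - p)\<close>.\<close>

lemma clamp_abs_error:
  assumes "0 < R" "1 \<le> p"
  shows "\<bar>x - clamp_abs R x\<bar> \<le> R powr (1 - p) * \<bar>x\<bar> powr p"
proof (cases "\<bar>x\<bar> \<le> R")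
  case True
  then have "clamp_abs R x = x" by (auto simp: clamp_abs_def)
  then show ?thesis by simp
next
  case False
  then have x: "\<bar>x\<bar> > R" "\<bar>x\<bar> > 0" using assms by auto
  have "\<bar>x - clamp_abs R x\<bar> \<le> \<bar>x\<bar>" using False assms by (auto simp: clamp_abs_def)
  also have "\<dots> = \<bar>x\<bar> powr (1 - p) * \<bar>x\<bar> powr p" using x by (simp add: powr_add[symmetric])
  also have "\<dots> \<le> R powr (1 - p) * \<bar>x\<bar> powr p"
    using x assms by (intro mult_right_mono powr_mono2') auto
  finally show ?thesis .
qed

lemma integral_sum2:
  fixes f :: "'i \<Rightarrow> 'j \<Rightarrow> 'b \<Rightarrow> real"
  assumes "\<And>i j. i \<in> I \<Longrightarrow> j \<in> J \<Longrightarrow> integrable N (f i j)"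
  shows "(\<integral>x. (\<Sum>i\<in>I. \<Sum>j\<in>J. f i j x) \<partial>N) = (\<Sum>i\<in>I. \<Sum>j\<in>J. \<integral>x. f i j x \<partial>N)"
proof -
  have "(\<integral>x. (\<Sum>i\<in>I. \<Sum>j\<in>J. f i j x) \<partial>N) = (\<Sum>i\<in>I. \<integral>x. (\<Sum>j\<in>J. f i j x) \<partial>N)"
    by (intro Bochner_Integration.integral_sum Bochner_Integration.integrable_sum assms)
  also have "\<dots> = (\<Sum>i\<in>I. \<Sum>j\<in>J. \<integral>x. f i j x \<partial>N)"
    by (intro sum.cong refl Bochner_Integration.integral_sum assms)
  finally show ?thesis .
qed

context
  fixes ell :: nat and \<iota> \<kappa> K q v w :: real and G :: "(nat \<Rightarrow> 'v::euclidean_space) \<Rightarrow> real"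
  assumes G: "holder_class ell \<iota> \<kappa> K G" and K: "0 < K" and \<iota>: "0 \<le> \<iota>" and \<kappa>: "0 < \<kappa>"
    and q: "1 \<le> q" and v: "0 < v" and w: "4 < w" and exps: "\<iota> / v + \<kappa> / q < 1 / w"
begin

text \<open>The factor \<open>1 + 2 * ell\<close> is chosen to agree with that of
  \<open>holder_class_diff_powr\<close>, so that one constant normalises both values and
  differences.\<close>

lemma holder_class_growth_powr:
  assumes Y: "1 \<le> Y" and x: "\<And>i. i < ell \<Longrightarrow> norm (x i) powr v \<le> Y"
  shows "\<bar>G x\<bar> \<le> K * (1 + 2 * ell) * Y powr (\<iota> / v)"
proof -
  have Y1: "1 \<le> Y powr (\<iota> / v)" using Y \<iota> v by (intro ge_one_powr_ge_zero) auto
  have "\<bar>G x\<bar> \<le> K * (1 + (\<Sum>i<ell. npow (norm (x i)) \<iota>))" by (rule holder_classD(2)[OF G])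
  also have "\<dots> \<le> K * (Y powr (\<iota> / v) + (\<Sum>i<ell. Y powr (\<iota> / v)))"
    using K Y1 x Y v \<iota> by (intro mult_left_mono add_mono sum_mono npow_le_powr) auto
  also have "\<dots> \<le> K * (1 + 2 * ell) * Y powr (\<iota> / v)" using K by (simp add: algebra_simps)
  finally show ?thesis .
qed

text \<open>Here \<open>b\<close> is the size of the approximation error. Dominating the rescaled
  error by \<open>Y\<close> isolates the small factor \<open>b powr \<kappa>\<close> and leaves a
  power of \<open>Y\<close> that can be integrated.\<close>

lemma holder_class_diff_powr:
  assumes Y: "1 \<le> Y" and b: "0 < b"
    and x: "\<And>i. i < ell \<Longrightarrow> norm (x i) powr v \<le> Y" and z: "\<And>i. i < ell \<Longrightarrow> norm (z i) powr v \<le> Y"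
    and xz: "\<And>i. i < ell \<Longrightarrow> (norm (x i - z i) / b) powr q \<le> Y"
  shows "\<bar>G x - G z\<bar> \<le> K * (1 + 2 * ell) * Y powr (\<iota> / v) * (ell * b powr \<kappa> * Y powr (\<kappa> / q))"
proof -
  have Y1: "1 \<le> Y powr (\<iota> / v)" using Y \<iota> v by (intro ge_one_powr_ge_zero) auto
  have d: "norm (x i - z i) powr \<kappa> \<le> b powr \<kappa> * Y powr (\<kappa> / q)" if i: "i < ell" for i
  proof -
    have "npow (norm (x i - z i) / b) \<kappa> \<le> Y powr (\<kappa> / q)"
      using xz[OF i] q \<kappa> Y b by (intro npow_le_powr) auto
    then have "(norm (x i - z i) / b) powr \<kappa> \<le> Y powr (\<kappa> / q)" using \<kappa> by (simp add: npow_def)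
    then show ?thesis using b by (simp add: powr_divide field_simps)
  qed
  have "\<bar>G x - G z\<bar> \<le> K * (1 + (\<Sum>i<ell. npow (norm (x i)) \<iota> + npow (norm (z i)) \<iota>))
                          * (\<Sum>i<ell. norm (x i - z i) powr \<kappa>)"
    by (rule holder_classD(1)[OF G])
  also have "\<dots> \<le> K * (Y powr (\<iota> / v) + (\<Sum>i<ell. Y powr (\<iota> / v) + Y powr (\<iota> / v)))
      * (\<Sum>i<ell. b powr \<kappa> * Y powr (\<kappa> / q))"
    using K Y1 x z Y v \<iota> d
    by (intro mult_mono mult_left_mono add_mono sum_mono npow_le_powr)
       (auto intro!: mult_nonneg_nonneg add_nonneg_nonneg sum_nonneg)
  also have "\<dots> = K * (1 + 2 * ell) * Y powr (\<iota> / v) * (ell * b powr \<kappa> * Y powr (\<kappa> / q))"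
    by (simp add: algebra_simps)
  finally show ?thesis .
qed

text \<open>As \<open>1 / w < 1 / 4\<close>, the assumption \<open>exps\<close> gives
  \<open>4 * (\<iota> / v) + \<kappa> / q < 1\<close>, which handles a product of four growth
  factors with one error factor, and \<open>w * (\<iota> / v) < 1\<close>, which handles the power
  \<open>w / 4\<close> of such a product.\<close>

lemma powr_fourth: "1 \<le> Y \<Longrightarrow> (Y powr (\<iota> / v)) ^ 4 * Y powr (\<kappa> / q) \<le> Y"
  and powr_w: "1 \<le> Y \<Longrightarrow> (Y powr (\<iota> / v)) powr w \<le> Y"
  and powr_fourth': "1 \<le> Y \<Longrightarrow> (Y powr (\<iota> / v)) ^ 4 \<le> Y"
proof -
  assume Y: "1 \<le> Y"
  have kq: "0 \<le> \<kappa> / q" using \<kappa> q by simp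
  have 1: "1 / w < 1 / 4" using w by simp
  have iv: "\<iota> / v < 1 / 4" "\<iota> / v < 1 / w" using exps kq 1 by linarith+
  have e: "(Y powr (\<iota> / v)) ^ 4 = Y powr (4 * (\<iota> / v))"
    using Y by (subst powr_realpow[symmetric]) (auto simp: powr_powr mult.commute)
  have "(Y powr (\<iota> / v)) ^ 4 * Y powr (\<kappa> / q) = Y powr (4 * (\<iota> / v) + \<kappa> / q)"
    unfolding e by (simp add: powr_add)
  also have "\<dots> \<le> Y powr 1" using Y exps kq 1 by (intro powr_mono) linarith+
  finally show "(Y powr (\<iota> / v)) ^ 4 * Y powr (\<kappa> / q) \<le> Y" using Y by simp
  have "Y powr (4 * (\<iota> / v)) \<le> Y powr 1" using Y iv by (intro powr_mono) linarith+
  then show "(Y powr (\<iota> / v)) ^ 4 \<le> Y" using Y e by simp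
  have "(\<iota> / v) * w \<le> 1" using iv(2) w by (simp add: less_divide_eq)
  then have "Y powr ((\<iota> / v) * w) \<le> Y powr 1" using Y by (intro powr_mono)
  then show "(Y powr (\<iota> / v)) powr w \<le> Y" using Y by (simp add: powr_powr)
qed

lemma holder_class_prod4_bound:
  assumes Y: "1 \<le> Y" and A: "\<And>j i. j < 4 \<Longrightarrow> i < ell \<Longrightarrow> norm (A j i) powr v \<le> Y"
  shows "\<bar>\<Prod>j<4::nat. G (A j)\<bar> \<le> (K * (1 + 2 * ell) * Y powr (\<iota> / v)) ^ 4"
proof -
  have "\<bar>\<Prod>j<4::nat. G (A j)\<bar> = (\<Prod>j<4::nat. \<bar>G (A j)\<bar>)" by (simp add: abs_prod)
  also have "\<dots> \<le> (\<Prod>j<4::nat. K * (1 + 2 * ell) * Y powr (\<iota> / v))"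
    by (intro prod_mono conjI holder_class_growth_powr Y A) auto
  finally show ?thesis by simp
qed

text \<open>Here \<open>Y\<close> dominates the \<open>v\<close>-th powers of all arguments and the scaled \<open>q\<close>-th powers of the errors; since
  \<open>4 * (\<iota> / v) + \<kappa> / q \<le> 1\<close>, all bounds are linear in \<open>Y\<close>, which replaces every use of Hoelder's inequality.\<close>

lemma holder_class_prod4_clamp:
  assumes Y: "1 \<le> Y" and b: "0 < b" and R: "0 < R"
    and A: "\<And>j i. j < 4 \<Longrightarrow> i < ell \<Longrightarrow> norm (A j i) powr v \<le> Y"
    and B: "\<And>j i. j < 4 \<Longrightarrow> i < ell \<Longrightarrow> norm (B j i) powr v \<le> Y"
    and AB: "\<And>j i. j < 4 \<Longrightarrow> i < ell \<Longrightarrow> (norm (A j i - B j i) / b) powr q \<le> Y"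
  shows "\<bar>(\<Prod>j<4::nat. G (A j)) - clamp_abs R (\<Prod>j<4. G (B j))\<bar>
     \<le> (4 * ell * (K * (1 + 2 * ell)) ^ 4 + (K * (1 + 2 * ell)) powr w) * (b powr \<kappa> + R powr (1 - w / 4)) * Y"
proof -
  define c where "c = K * (1 + 2 * ell)"
  have c: "c > 0" unfolding c_def using K by (simp add: add_pos_nonneg)
  define s where "s = Y powr (\<iota> / v)"
  have s: "s > 0" "s \<ge> 1" unfolding s_def using Y \<iota> v by (auto intro: ge_one_powr_ge_zero)
  have cs: "c * s > 0" using c s by simp
  let ?A = "\<Prod>j<4::nat. G (A j)" and ?B = "\<Prod>j<4::nat. G (B j)"
  have GA: "\<bar>G (A j)\<bar> \<le> c * s" and GB: "\<bar>G (B j)\<bar> \<le> c * s" if "j < 4" for j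
    using holder_class_growth_powr[OF Y, of "A j"] holder_class_growth_powr[OF Y, of "B j"] A B that
    unfolding c_def s_def by auto
  have D: "\<bar>G (A j) - G (B j)\<bar> \<le> c * s * (ell * b powr \<kappa> * Y powr (\<kappa> / q))" if "j < 4" for j
    unfolding c_def s_def using that by (intro holder_class_diff_powr Y b A B AB) auto
  \<comment> \<open>After division by \<open>c * s\<close> all factors have modulus at most 1, and
    then a difference of products is at most the sum of the differences of the factors.\<close>
  have le1: "norm (G (A j) / (c * s)) \<le> 1" "norm (G (B j) / (c * s)) \<le> 1" if "j \<in> {..<4}" for j
    using GA[of j] GB[of j] cs that by (auto simp: divide_le_eq_1)
  have "\<bar>(\<Prod>j<4::nat. G (A j) / (c * s)) - (\<Prod>j<4. G (B j) / (c * s))\<bar>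
      \<le> (\<Sum>j<4. \<bar>G (A j) / (c * s) - G (B j) / (c * s)\<bar>)"
    using norm_prod_diff[of "{..<4::nat}", OF le1] by (simp only: real_norm_def)
  also have "\<dots> \<le> (\<Sum>j<4::nat. ell * b powr \<kappa> * Y powr (\<kappa> / q))"
  proof (rule sum_mono)
    fix j :: nat assume "j \<in> {..<4}"
    then have "\<bar>G (A j) - G (B j)\<bar> / (c * s) \<le> ell * b powr \<kappa> * Y powr (\<kappa> / q)"
      using D[of j] cs by (simp add: divide_le_eq mult.commute)
    then show "\<bar>G (A j) / (c * s) - G (B j) / (c * s)\<bar> \<le> ell * b powr \<kappa> * Y powr (\<kappa> / q)"
      using cs by (simp add: diff_divide_distrib[symmetric])
  qed
  finally have "\<bar>?A - ?B\<bar> / (c * s) ^ 4 \<le> 4 * (ell * b powr \<kappa> * Y powr (\<kappa> / q))"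
    using cs by (simp add: prod_dividef diff_divide_distrib[symmetric])
  then have "\<bar>?A - ?B\<bar> \<le> (c * s) ^ 4 * (4 * (ell * b powr \<kappa> * Y powr (\<kappa> / q)))"
    using pos_divide_le_eq[OF zero_less_power[OF cs]] by (metis mult.commute)
  also have "\<dots> = 4 * ell * c ^ 4 * b powr \<kappa> * (s ^ 4 * Y powr (\<kappa> / q))"
    by (simp add: power_mult_distrib)
  also have "\<dots> \<le> 4 * ell * c ^ 4 * b powr \<kappa> * Y"
    using powr_fourth[OF Y] c by (intro mult_left_mono) (auto simp: s_def)
  finally have 1: "\<bar>?A - ?B\<bar> \<le> 4 * ell * c ^ 4 * b powr \<kappa> * Y" .
  \<comment> \<open>The exponent \<open>w / 4\<close> turns the fourth power of \<open>c * s\<close>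
    into its \<open>w\<close>-th power, the largest one that \<open>powr_w\<close> controls linearly
    in \<open>Y\<close>.\<close>
  have "\<bar>?A - clamp_abs R ?A\<bar> \<le> R powr (1 - w / 4) * \<bar>?A\<bar> powr (w / 4)"
    using w by (intro clamp_abs_error R) auto
  also have "\<dots> \<le> R powr (1 - w / 4) * ((c * s) ^ 4) powr (w / 4)"
    using holder_class_prod4_bound[OF Y A] w
    by (intro mult_left_mono powr_mono2) (auto simp: c_def s_def)
  also have "((c * s) ^ 4) powr (w / 4) = (c * s) powr w"
  proof -
    have "(c * s) ^ 4 = (c * s) powr 4" using cs by (simp only: powr_numeral)
    then show ?thesis by (simp only: powr_powr) simp
  qed
  also have "\<dots> = c powr w * s powr w" using c s by (simp add: powr_mult)
  also have "R powr (1 - w / 4) * \<dots> \<le> R powr (1 - w / 4) * (c powr w * Y)"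
    using powr_w[OF Y] by (intro mult_left_mono) (auto simp: s_def)
  finally have 2: "\<bar>?A - clamp_abs R ?A\<bar> \<le> c powr w * R powr (1 - w / 4) * Y"
    by (simp add: mult_ac)
  have "\<bar>?A - clamp_abs R ?B\<bar> \<le> \<bar>?A - clamp_abs R ?A\<bar> + \<bar>?A - ?B\<bar>"
    using clamp_abs_lipschitz[of R ?A ?B] by linarith
  also have "\<dots> \<le> (c powr w * R powr (1 - w / 4) + 4 * ell * c ^ 4 * b powr \<kappa>) * Y"
    using 1 2 by (simp add: algebra_simps)
  also have "\<dots> \<le> (4 * ell * c ^ 4 + c powr w) * (b powr \<kappa> + R powr (1 - w / 4)) * Y"
    using Y c by (intro mult_right_mono) (auto simp: algebra_simps)
  finally show ?thesis unfolding c_def .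
qed

text \<open>The pointwise bound is integrated with \<open>Y\<close> equal to 1 plus the sum of all
  \<open>v\<close>-th powers. The space \<open>N\<close> is arbitrary because the lemma serves both
  the original space and the threefold product carrying the decoupled variables.\<close>

lemma holder_class_prod4_integral_bound:
  fixes A :: "nat \<Rightarrow> nat \<Rightarrow> 'b \<Rightarrow> 'v" and m :: real
  assumes N: "prob_space N" and mA: "\<And>j i. A j i \<in> borel_measurable N"
    and iA: "\<And>j i. j < 4 \<Longrightarrow> i < ell \<Longrightarrow> integrable N (\<lambda>\<omega>. norm (A j i \<omega>) powr v)"
    and bA: "\<And>j i. j < 4 \<Longrightarrow> i < ell \<Longrightarrow> (\<integral>\<omega>. norm (A j i \<omega>) powr v \<partial>N) \<le> m"
  shows "integrable N (\<lambda>\<omega>. \<Prod>j<4::nat. G (\<lambda>i. A j i \<omega>))"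
    and "\<bar>\<integral>\<omega>. (\<Prod>j<4::nat. G (\<lambda>i. A j i \<omega>)) \<partial>N\<bar> \<le> (K * (1 + 2 * ell)) ^ 4 * (1 + 4 * ell * m)"
proof -
  interpret N: prob_space N by fact
  have [measurable]: "G \<in> borel_measurable borel"
    by (rule borel_measurable_continuous_onI[OF holder_class_continuous[OF G \<iota> \<kappa>]])
  have [measurable]: "(\<lambda>\<omega>. G (\<lambda>i. A j i \<omega>)) \<in> borel_measurable N" for j
    by (rule measurable_compose[OF measurable_coordinatewise_then_product[OF mA]]) measurable
  define Y where "Y \<omega> = 1 + (\<Sum>j<4::nat. \<Sum>i<ell. norm (A j i \<omega>) powr v)" for \<omega>
  have iY: "integrable N Y" unfolding Y_def by (intro Bochner_Integration.integrable_add
      Bochner_Integration.integrable_sum iA) auto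
  have "(\<integral>\<omega>. Y \<omega> \<partial>N) = 1 + (\<Sum>j<4::nat. \<Sum>i<ell. \<integral>\<omega>. norm (A j i \<omega>) powr v \<partial>N)"
    unfolding Y_def using iA
    by (subst Bochner_Integration.integral_add)
       (auto simp: N.prob_space intro!: integral_sum2 Bochner_Integration.integrable_sum)
  also have "\<dots> \<le> 1 + (\<Sum>j<4::nat. \<Sum>i<ell. m)"
    by (intro add_mono sum_mono bA) auto
  finally have EY: "(\<integral>\<omega>. Y \<omega> \<partial>N) \<le> 1 + 4 * ell * m" by simp
  have Y1: "1 \<le> Y \<omega>" for \<omega> unfolding Y_def by (auto intro!: sum_nonneg)
  have Ypt: "norm (A j i \<omega>) powr v \<le> Y \<omega>" if "j < 4" "i < ell" for j i \<omega>
  proof -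
    have "norm (A j i \<omega>) powr v \<le> (\<Sum>i<ell. norm (A j i \<omega>) powr v)"
      using that by (intro member_le_sum) auto
    also have "\<dots> \<le> (\<Sum>j<4::nat. \<Sum>i<ell. norm (A j i \<omega>) powr v)"
      using that by (intro member_le_sum[of j "{..<4}" "\<lambda>j. \<Sum>i<ell. norm (A j i \<omega>) powr v"]) (auto intro: sum_nonneg)
    finally show ?thesis by (simp add: Y_def)
  qed
  have pt: "\<bar>\<Prod>j<4::nat. G (\<lambda>i. A j i \<omega>)\<bar> \<le> (K * (1 + 2 * ell)) ^ 4 * Y \<omega>" for \<omega>
  proof -
    have "\<bar>\<Prod>j<4::nat. G (\<lambda>i. A j i \<omega>)\<bar> \<le> (K * (1 + 2 * ell) * Y \<omega> powr (\<iota> / v)) ^ 4"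
      by (rule holder_class_prod4_bound[OF Y1 Ypt])
    also have "\<dots> \<le> (K * (1 + 2 * ell)) ^ 4 * Y \<omega>"
      unfolding power_mult_distrib[of "K * _"] using powr_fourth'[OF Y1] K by (intro mult_left_mono) auto
    finally show ?thesis .
  qed
  show int: "integrable N (\<lambda>\<omega>. \<Prod>j<4::nat. G (\<lambda>i. A j i \<omega>))"
    by (rule Bochner_Integration.integrable_bound[of N "\<lambda>\<omega>. (K * (1 + 2 * ell)) ^ 4 * Y \<omega>"])
      (use iY pt in \<open>auto intro: order_trans[OF _ abs_ge_self]\<close>)
  have "\<bar>\<integral>\<omega>. (\<Prod>j<4::nat. G (\<lambda>i. A j i \<omega>)) \<partial>N\<bar> \<le> (\<integral>\<omega>. \<bar>\<Prod>j<4::nat. G (\<lambda>i. A j i \<omega>)\<bar> \<partial>N)"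
    by (rule integral_abs_bound)
  also have "\<dots> \<le> (\<integral>\<omega>. (K * (1 + 2 * ell)) ^ 4 * Y \<omega> \<partial>N)"
    using int iY by (intro integral_mono pt) auto
  also have "\<dots> \<le> (K * (1 + 2 * ell)) ^ 4 * (1 + 4 * ell * m)"
    using EY by (simp add: mult_left_mono)
  finally show "\<bar>\<integral>\<omega>. (\<Prod>j<4::nat. G (\<lambda>i. A j i \<omega>)) \<partial>N\<bar> \<le> (K * (1 + 2 * ell)) ^ 4 * (1 + 4 * ell * m)" .
qed

text \<open>Here \<open>Y\<close> collects, for every pair of indices, the \<open>v\<close>-th
  powers of both families and the rescaled \<open>q\<close>-th power of their difference, whose
  integrals add up to at most \<open>2 * m + 1\<close>. It is applied to the process and its window
  approximations, before and after decoupling.\<close>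

lemma holder_class_prod4_integral_clamp:
  fixes A B :: "nat \<Rightarrow> nat \<Rightarrow> 'b \<Rightarrow> 'v" and m :: real
  assumes N: "prob_space N" and b: "0 < b" and R: "0 < R"
    and mA: "\<And>j i. A j i \<in> borel_measurable N" and mB: "\<And>j i. B j i \<in> borel_measurable N"
    and iA: "\<And>j i. j < 4 \<Longrightarrow> i < ell \<Longrightarrow> integrable N (\<lambda>\<omega>. norm (A j i \<omega>) powr v)"
    and bA: "\<And>j i. j < 4 \<Longrightarrow> i < ell \<Longrightarrow> (\<integral>\<omega>. norm (A j i \<omega>) powr v \<partial>N) \<le> m"
    and iB: "\<And>j i. j < 4 \<Longrightarrow> i < ell \<Longrightarrow> integrable N (\<lambda>\<omega>. norm (B j i \<omega>) powr v)"
    and bB: "\<And>j i. j < 4 \<Longrightarrow> i < ell \<Longrightarrow> (\<integral>\<omega>. norm (B j i \<omega>) powr v \<partial>N) \<le> m"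
    and iAB: "\<And>j i. j < 4 \<Longrightarrow> i < ell \<Longrightarrow> integrable N (\<lambda>\<omega>. (norm (A j i \<omega> - B j i \<omega>) / b) powr q)"
    and bAB: "\<And>j i. j < 4 \<Longrightarrow> i < ell \<Longrightarrow> (\<integral>\<omega>. (norm (A j i \<omega> - B j i \<omega>) / b) powr q \<partial>N) \<le> 1"
  shows "\<bar>(\<integral>\<omega>. (\<Prod>j<4::nat. G (\<lambda>i. A j i \<omega>)) \<partial>N) - (\<integral>\<omega>. clamp_abs R (\<Prod>j<4::nat. G (\<lambda>i. B j i \<omega>)) \<partial>N)\<bar>
     \<le> (4 * ell * (K * (1 + 2 * ell)) ^ 4 + (K * (1 + 2 * ell)) powr w) * (b powr \<kappa> + R powr (1 - w / 4))
        * (1 + 4 * ell * (2 * m + 1))"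
proof -
  interpret N: prob_space N by fact
  have [measurable]: "G \<in> borel_measurable borel"
    by (rule borel_measurable_continuous_onI[OF holder_class_continuous[OF G \<iota> \<kappa>]])
  have [measurable]: "(\<lambda>\<omega>. G (\<lambda>i. B j i \<omega>)) \<in> borel_measurable N" for j
    by (rule measurable_compose[OF measurable_coordinatewise_then_product[OF mB]]) measurable
  define T where "T j i \<omega> = norm (A j i \<omega>) powr v + norm (B j i \<omega>) powr v
      + (norm (A j i \<omega> - B j i \<omega>) / b) powr q" for j i \<omega>
  define Y where "Y \<omega> = 1 + (\<Sum>j<4::nat. \<Sum>i<ell. T j i \<omega>)" for \<omega>
  have T0: "0 \<le> T j i \<omega>" for j i \<omega> unfolding T_def by simp
  have iT: "integrable N (T j i)" if "j < 4" "i < ell" for j i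
    unfolding T_def using iA iB iAB that by auto
  have bT: "(\<integral>\<omega>. T j i \<omega> \<partial>N) \<le> 2 * m + 1" if "j < 4" "i < ell" for j i
    unfolding T_def using bA[OF that] bB[OF that] bAB[OF that] iA[OF that] iB[OF that] iAB[OF that] by simp
  have iY: "integrable N Y" unfolding Y_def by (intro Bochner_Integration.integrable_add
      Bochner_Integration.integrable_sum iT) auto
  have "(\<integral>\<omega>. Y \<omega> \<partial>N) = 1 + (\<Sum>j<4::nat. \<Sum>i<ell. \<integral>\<omega>. T j i \<omega> \<partial>N)"
    unfolding Y_def using iT
    by (subst Bochner_Integration.integral_add)
       (auto simp: N.prob_space intro!: integral_sum2 Bochner_Integration.integrable_sum)
  also have "\<dots> \<le> 1 + (\<Sum>j<4::nat. \<Sum>i<ell. 2 * m + 1)"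
    by (intro add_mono sum_mono bT) auto
  finally have EY: "(\<integral>\<omega>. Y \<omega> \<partial>N) \<le> 1 + 4 * ell * (2 * m + 1)" by simp
  have Y1: "1 \<le> Y \<omega>" for \<omega> unfolding Y_def by (auto intro!: sum_nonneg T0)
  have Ypt: "T j i \<omega> \<le> Y \<omega>" if "j < 4" "i < ell" for j i \<omega>
  proof -
    have "T j i \<omega> \<le> (\<Sum>i<ell. T j i \<omega>)"
      using that by (intro member_le_sum) (auto simp: T0)
    also have "\<dots> \<le> (\<Sum>j<4::nat. \<Sum>i<ell. T j i \<omega>)"
      using that by (intro member_le_sum[of j "{..<4}" "\<lambda>j. \<Sum>i<ell. T j i \<omega>"]) (auto intro: sum_nonneg T0)
    finally show ?thesis by (simp add: Y_def)
  qed
  have Ys: "norm (A j i \<omega>) powr v \<le> Y \<omega>" "norm (B j i \<omega>) powr v \<le> Y \<omega>"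
      "(norm (A j i \<omega> - B j i \<omega>) / b) powr q \<le> Y \<omega>" if "j < 4" "i < ell" for j i \<omega>
  proof -
    have "0 \<le> norm (A j i \<omega>) powr v" "0 \<le> norm (B j i \<omega>) powr v"
      "0 \<le> (norm (A j i \<omega> - B j i \<omega>) / b) powr q" by auto
    with Ypt[OF that, of \<omega>] show "norm (A j i \<omega>) powr v \<le> Y \<omega>" "norm (B j i \<omega>) powr v \<le> Y \<omega>"
      "(norm (A j i \<omega> - B j i \<omega>) / b) powr q \<le> Y \<omega>" unfolding T_def by linarith+
  qed
  define C where "C = (4 * ell * (K * (1 + 2 * ell)) ^ 4 + (K * (1 + 2 * ell)) powr w) * (b powr \<kappa> + R powr (1 - w / 4))"
  have C0: "C \<ge> 0" unfolding C_def using K by (intro mult_nonneg_nonneg add_nonneg_nonneg) auto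
  let ?A = "\<lambda>\<omega>. \<Prod>j<4::nat. G (\<lambda>i. A j i \<omega>)" and ?B = "\<lambda>\<omega>. clamp_abs R (\<Prod>j<4::nat. G (\<lambda>i. B j i \<omega>))"
  have pt: "\<bar>?A \<omega> - ?B \<omega>\<bar> \<le> C * Y \<omega>" for \<omega>
    unfolding C_def by (rule holder_class_prod4_clamp[OF Y1 b R]) (auto simp: Ys)
  have int: "integrable N ?A" by (rule holder_class_prod4_integral_bound(1)[OF N mA iA bA])
  have intB: "integrable N ?B"
    by (rule N.integrable_const_bound[of _ R]) (use R in \<open>auto simp: clamp_abs_le\<close>, simp add: clamp_abs_def)
  have "\<bar>integral\<^sup>L N ?A - integral\<^sup>L N ?B\<bar> = \<bar>\<integral>\<omega>. ?A \<omega> - ?B \<omega> \<partial>N\<bar>" using int intB by simp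
  also have "\<dots> \<le> (\<integral>\<omega>. \<bar>?A \<omega> - ?B \<omega>\<bar> \<partial>N)" by (rule integral_abs_bound)
  also have "\<dots> \<le> (\<integral>\<omega>. C * Y \<omega> \<partial>N)"
    using int intB iY by (intro integral_mono pt) auto
  also have "\<dots> \<le> C * (1 + 4 * ell * (2 * m + 1))"
    using EY C0 by (simp add: mult_left_mono)
  finally show ?thesis unfolding C_def .
qed

end

section \<open>Conditional expectation approximations\<close>

lemma (in prob_space) abs_cond_exp_powr_le:
  fixes f :: "'a \<Rightarrow> real"
  assumes sH: "subalgebra M H" and f[measurable]: "f \<in> borel_measurable M"
    and int: "integrable M (\<lambda>\<omega>. (\<bar>f \<omega>\<bar> + 1) powr v)" and v: "1 \<le> v"
  shows "AE \<omega> in M. \<bar>real_cond_exp M H f \<omega>\<bar> powr v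
      \<le> real_cond_exp M H (\<lambda>\<omega>. (\<bar>f \<omega>\<bar> + 1) powr v) \<omega>"
proof -
  interpret sigma_finite_subalgebra M H by (rule subalgebra_sigma_finite[OF sH])
  have le: "\<bar>f \<omega>\<bar> + 1 \<le> (\<bar>f \<omega>\<bar> + 1) powr v" for \<omega>
    using powr_mono[OF v, of "\<bar>f \<omega>\<bar> + 1"] by simp
  have i1: "integrable M (\<lambda>\<omega>. \<bar>f \<omega>\<bar> + 1)"
    by (rule Bochner_Integration.integrable_bound[OF int]) (use le in auto)
  then have "integrable M (\<lambda>\<omega>. \<bar>f \<omega>\<bar> + 1 - 1)" by (intro Bochner_Integration.integrable_diff) auto
  then have iabs: "integrable M (\<lambda>\<omega>. \<bar>f \<omega>\<bar>)" by simp
  then have i_f: "integrable M f" by (simp add: integrable_abs_iff)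
  note J = real_cond_exp_jensens_inequality[where I="{0<..}" and q="\<lambda>x. x powr v", OF i1 _ _ int powr_convex[OF v]]
  \<comment> \<open>Adding 1 keeps the argument inside the open half line on which \<open>powr_convex\<close> gives convexity.\<close>
  have "AE \<omega> in M. real_cond_exp M H (\<lambda>\<omega>. \<bar>f \<omega>\<bar> + 1) \<omega> \<in> {0<..}"
    by (rule J(1)) auto
  moreover have "AE \<omega> in M. real_cond_exp M H (\<lambda>\<omega>. \<bar>f \<omega>\<bar> + 1) \<omega> powr v
      \<le> real_cond_exp M H (\<lambda>\<omega>. (\<bar>f \<omega>\<bar> + 1) powr v) \<omega>"
    by (rule J(2)) auto
  moreover have "AE \<omega> in M. real_cond_exp M H f \<omega> \<le> real_cond_exp M H (\<lambda>\<omega>. \<bar>f \<omega>\<bar> + 1) \<omega>"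
    by (rule real_cond_exp_mono[OF _ i_f i1]) (auto intro!: AE_I2)
  moreover have "AE \<omega> in M. real_cond_exp M H (\<lambda>\<omega>. - f \<omega>) \<omega> \<le> real_cond_exp M H (\<lambda>\<omega>. \<bar>f \<omega>\<bar> + 1) \<omega>"
    by (rule real_cond_exp_mono[OF _ _ i1]) (use i_f in \<open>auto intro!: AE_I2\<close>)
  moreover have "AE \<omega> in M. real_cond_exp M H (\<lambda>\<omega>. (-1) * f \<omega>) \<omega> = (-1) * real_cond_exp M H f \<omega>"
    by (rule real_cond_exp_cmult[OF i_f])
  ultimately show ?thesis
  proof eventually_elim
    case (elim \<omega>)
    then have "\<bar>real_cond_exp M H f \<omega>\<bar> \<le> real_cond_exp M H (\<lambda>\<omega>. \<bar>f \<omega>\<bar> + 1) \<omega>" by simp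
    then have "\<bar>real_cond_exp M H f \<omega>\<bar> powr v \<le> real_cond_exp M H (\<lambda>\<omega>. \<bar>f \<omega>\<bar> + 1) \<omega> powr v"
      using v by (intro powr_mono2) auto
    with elim(2) show ?case by linarith
  qed
qed

lemma sum_abs_powr_le:
  fixes f :: "'b \<Rightarrow> real"
  assumes "finite B" "1 \<le> v"
  shows "(\<Sum>b\<in>B. \<bar>f b\<bar>) powr v \<le> card B powr v * (\<Sum>b\<in>B. \<bar>f b\<bar> powr v)"
proof -
  define Z where "Z = (\<Sum>b\<in>B. \<bar>f b\<bar> powr v)"
  have Z: "0 \<le> Z" unfolding Z_def by (intro sum_nonneg) auto
  have "\<bar>f b\<bar> \<le> Z powr (1 / v)" if "b \<in> B" for b
  proof -
    have "\<bar>f b\<bar> powr v \<le> Z" unfolding Z_def using assms that by (intro member_le_sum) auto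
    then have "(\<bar>f b\<bar> powr v) powr (1 / v) \<le> Z powr (1 / v)" using assms by (intro powr_mono2) auto
    then show ?thesis using assms by (simp add: powr_powr)
  qed
  then have "(\<Sum>b\<in>B. \<bar>f b\<bar>) \<le> (\<Sum>b\<in>B. Z powr (1 / v))" by (intro sum_mono)
  then have "(\<Sum>b\<in>B. \<bar>f b\<bar>) powr v \<le> (card B * Z powr (1 / v)) powr v"
    using assms by (intro powr_mono2) (auto intro: sum_nonneg)
  also have "\<dots> = card B powr v * Z" using assms Z by (simp add: powr_mult powr_powr)
  finally show ?thesis unfolding Z_def .
qed

lemma (in prob_space) vcond_exp_measurable:
  "vcond_exp M H X \<in> borel_measurable H"
  unfolding vcond_exp_def by measurable

text \<open>Conditional Jensen is applied to each basis coordinate, since the vector-valued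
  conditional expectation is defined coordinatewise. The dimension factors are harmless: what
  matters is a bound that does not depend on \<open>H\<close>.\<close>

lemma (in prob_space) vcond_exp_powr_integral:
  fixes X :: "'a \<Rightarrow> 'v::euclidean_space"
  assumes sH: "subalgebra M H" and X[measurable]: "X \<in> borel_measurable M"
    and int: "integrable M (\<lambda>\<omega>. (norm (X \<omega>) + 1) powr v)" and v: "1 \<le> v"
  shows "integrable M (\<lambda>\<omega>. norm (vcond_exp M H X \<omega>) powr v)"
    and "(\<integral>\<omega>. norm (vcond_exp M H X \<omega>) powr v \<partial>M)
       \<le> DIM('v) powr v * (DIM('v) * (\<integral>\<omega>. (norm (X \<omega>) + 1) powr v \<partial>M))"
proof -
  interpret sigma_finite_subalgebra M H by (rule subalgebra_sigma_finite[OF sH])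
  define m where "m = (\<integral>\<omega>. (norm (X \<omega>) + 1) powr v \<partial>M)"
  define g where "g b \<omega> = (\<bar>X \<omega> \<bullet> b\<bar> + 1) powr v" for b \<omega>
  define h where "h b = real_cond_exp M H (g b)" for b
  have [measurable]: "g b \<in> borel_measurable M" for b unfolding g_def by measurable
  have gle: "g b \<omega> \<le> (norm (X \<omega>) + 1) powr v" if "b \<in> Basis" for b \<omega>
    unfolding g_def using v Basis_le_norm[OF that, of "X \<omega>"] by (intro powr_mono2) auto
  have ig: "integrable M (g b)" if "b \<in> Basis" for b
    by (rule Bochner_Integration.integrable_bound[OF int])
       (use gle[OF that] in \<open>auto simp: g_def\<close>)
  have ih: "integrable M (h b)" "(\<integral>\<omega>. h b \<omega> \<partial>M) \<le> m" if "b \<in> Basis" for b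
  proof -
    show "integrable M (h b)" unfolding h_def by (rule real_cond_exp_int(1)[OF ig[OF that]])
    have "(\<integral>\<omega>. h b \<omega> \<partial>M) = (\<integral>\<omega>. g b \<omega> \<partial>M)" unfolding h_def by (rule real_cond_exp_int(2)[OF ig[OF that]])
    also have "\<dots> \<le> m" unfolding m_def by (rule integral_mono[OF ig[OF that] int gle[OF that]])
    finally show "(\<integral>\<omega>. h b \<omega> \<partial>M) \<le> m" .
  qed
  have [measurable]: "vcond_exp M H X \<in> borel_measurable M"
    by (rule measurable_from_subalg[OF sH vcond_exp_measurable])
  have "AE \<omega> in M. \<forall>b\<in>Basis. \<bar>real_cond_exp M H (\<lambda>\<omega>. X \<omega> \<bullet> b) \<omega>\<bar> powr v \<le> h b \<omega>"
  proof (rule AE_finite_allI)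
    fix b :: 'v assume b: "b \<in> Basis"
    show "AE \<omega> in M. \<bar>real_cond_exp M H (\<lambda>\<omega>. X \<omega> \<bullet> b) \<omega>\<bar> powr v \<le> h b \<omega>"
      using abs_cond_exp_powr_le[OF sH _ ig[OF b, unfolded g_def] v] unfolding h_def g_def by simp
  qed simp
  then have ae: "AE \<omega> in M. norm (vcond_exp M H X \<omega>) powr v \<le> DIM('v) powr v * (\<Sum>b\<in>Basis. h b \<omega>)"
  proof eventually_elim
    case (elim \<omega>)
    have "norm (vcond_exp M H X \<omega>) \<le> (\<Sum>b\<in>Basis. norm (real_cond_exp M H (\<lambda>\<omega>. X \<omega> \<bullet> b) \<omega> *\<^sub>R b))"
      unfolding vcond_exp_def by (rule norm_sum)
    also have "\<dots> = (\<Sum>b\<in>Basis. \<bar>real_cond_exp M H (\<lambda>\<omega>. X \<omega> \<bullet> b) \<omega>\<bar>)" by simp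
    finally have "norm (vcond_exp M H X \<omega>) powr v \<le> (\<Sum>b\<in>Basis. \<bar>real_cond_exp M H (\<lambda>\<omega>. X \<omega> \<bullet> b) \<omega>\<bar>) powr v"
      using v by (intro powr_mono2) auto
    also have "\<dots> \<le> DIM('v) powr v * (\<Sum>b\<in>Basis. \<bar>real_cond_exp M H (\<lambda>\<omega>. X \<omega> \<bullet> b) \<omega>\<bar> powr v)"
      by (rule sum_abs_powr_le[OF _ v]) simp
    also have "\<dots> \<le> DIM('v) powr v * (\<Sum>b\<in>Basis. h b \<omega>)"
      using elim by (intro mult_left_mono sum_mono) auto
    finally show ?case .
  qed
  have isum: "integrable M (\<lambda>\<omega>. DIM('v) powr v * (\<Sum>b\<in>Basis. h b \<omega>))"
    by (intro integrable_mult_right Bochner_Integration.integrable_sum ih)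
  show int': "integrable M (\<lambda>\<omega>. norm (vcond_exp M H X \<omega>) powr v)"
    by (rule Bochner_Integration.integrable_bound[OF isum]) (use ae in \<open>auto elim!: eventually_mono\<close>)
  have "(\<integral>\<omega>. norm (vcond_exp M H X \<omega>) powr v \<partial>M) \<le> (\<integral>\<omega>. DIM('v) powr v * (\<Sum>b\<in>Basis. h b \<omega>) \<partial>M)"
    by (rule integral_mono_AE[OF int' isum ae])
  also have "\<dots> = DIM('v) powr v * (\<Sum>b\<in>Basis. \<integral>\<omega>. h b \<omega> \<partial>M)"
    using ih by (simp add: Bochner_Integration.integral_sum)
  also have "\<dots> \<le> DIM('v) powr v * (\<Sum>b\<in>(Basis::'v set). m)"
    by (intro mult_left_mono sum_mono ih) auto
  finally show "(\<integral>\<omega>. norm (vcond_exp M H X \<omega>) powr v \<partial>M) \<le> DIM('v) powr v * (DIM('v) * m)" by simp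
qed

lemma Lp_norm_finiteD:
  assumes fin: "Lp_norm M p X < \<infinity>" and X: "X \<in> borel_measurable M" and p: "0 < p"
  shows "integrable M (\<lambda>\<omega>. norm (X \<omega>) powr p)"
    and "(\<integral>\<omega>. norm (X \<omega>) powr p \<partial>M) = enn2real (Lp_norm M p X) powr p"
proof -
  define I where "I = (\<integral>\<^sup>+ \<omega>. ennreal (norm (X \<omega>) powr p) \<partial>M)"
  have L: "Lp_norm M p X = (if I = \<infinity> then \<infinity> else ennreal (enn2real I powr (1 / p)))"
    unfolding Lp_norm_def I_def Let_def by simp
  have I: "I \<noteq> \<infinity>" using fin L by auto
  note [measurable] = X
  show int: "integrable M (\<lambda>\<omega>. norm (X \<omega>) powr p)"
    by (rule integrableI_bounded) (use I in \<open>auto simp: I_def top.not_eq_extremum\<close>)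
  have "(\<integral>\<omega>. norm (X \<omega>) powr p \<partial>M) = enn2real I"
    unfolding I_def by (rule integral_eq_nn_integral) auto
  also have "\<dots> = enn2real (Lp_norm M p X) powr p"
    using L I p by (simp add: powr_powr)
  finally show "(\<integral>\<omega>. norm (X \<omega>) powr p \<partial>M) = enn2real (Lp_norm M p X) powr p" .
qed

text \<open>The scale \<open>b\<close> only has to dominate the coefficient and is kept positive, so
  that the division stays meaningful when the coefficient is 0.\<close>

lemma integral_scaled_powr_le_1:
  fixes B :: ennreal
  assumes le: "Lp_norm M q X \<le> B" and fin: "B < \<infinity>" and b: "enn2real B \<le> b" "0 < b"
    and X: "X \<in> borel_measurable M" and q: "1 \<le> q"
  shows "integrable M (\<lambda>\<omega>. (norm (X \<omega>) / b) powr q)"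
    and "(\<integral>\<omega>. (norm (X \<omega>) / b) powr q \<partial>M) \<le> 1"
proof -
  have fin': "Lp_norm M q X < \<infinity>" using le fin by (rule le_less_trans)
  have q0: "0 < q" using q by simp
  note D = Lp_norm_finiteD[OF fin' X q0]
  have e: "(norm (X \<omega>) / b) powr q = norm (X \<omega>) powr q / b powr q" for \<omega>
    using b by (simp add: powr_divide)
  show "integrable M (\<lambda>\<omega>. (norm (X \<omega>) / b) powr q)" unfolding e using D(1) by simp
  have "enn2real (Lp_norm M q X) \<le> b"
    by (rule order_trans[OF enn2real_mono[OF le] b(1)]) (use fin in simp)
  then have "enn2real (Lp_norm M q X) powr q \<le> b powr q" using q by (intro powr_mono2) auto
  then show "(\<integral>\<omega>. (norm (X \<omega>) / b) powr q \<partial>M) \<le> 1"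
    unfolding e using D(2) b by simp
qed

text \<open>The Hoelder bound vanishes because \<open>0 powr \<kappa> = 0\<close> in HOL.\<close>

lemma holder_class_cong:
  assumes G: "holder_class ell \<iota> \<kappa> K G" and eq: "\<And>i. i < ell \<Longrightarrow> x i = z i"
  shows "G x = G z"
proof -
  have "(\<Sum>i<ell. norm (x i - z i) powr \<kappa>) = 0"
    by (intro sum.neutral) (use eq in auto)
  then show ?thesis using holder_classD(1)[OF G, of x z] by simp
qed

lemma prod_lessThan_4:
  "(\<Prod>j<4::nat. f j) = f 0 * (f 1 * (f 2 * f 3 :: real))"
  by (simp add: eval_nat_numeral mult_ac)

text \<open>The assumption \<open>scale\<close> is the form in which the series condition is used:
  some radius between \<open>L\<close> and \<open>2 * L\<close> at which both coefficients, with
  their exponents, are at most \<open>A / L^2\<close>. The condition \<open>1 \<le> v\<close> makes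
  Jensen's inequality available.\<close>

locale mixing_process = prob_space M for M :: "'a measure" +
  fixes Fam :: "int extended \<Rightarrow> int extended \<Rightarrow> 'a measure"
    and \<xi> :: "nat \<Rightarrow> 'a \<Rightarrow> 'v::euclidean_space"
    and ell :: nat and \<iota> \<kappa> q v w A :: real
  assumes Fam_sub: "k \<le> l \<Longrightarrow> subalgebra M (Fam k l)"
    and Fam_mono: "k \<le> l \<Longrightarrow> k' \<le> k \<Longrightarrow> l \<le> l' \<Longrightarrow> sets (Fam k l) \<subseteq> sets (Fam k' l')"
    and \<xi>_meas [measurable]: "\<And>n. \<xi> n \<in> borel_measurable M"
    and stat: "\<And>n. distr M borel (\<xi> n) = distr M borel (\<xi> 0)"
    and moment0: "integrable M (\<lambda>\<omega>. norm (\<xi> 0 \<omega>) powr v)"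
    and \<iota>: "0 \<le> \<iota>" and \<kappa>: "0 < \<kappa>" and q: "1 \<le> q" and v: "1 \<le> v" and w: "4 < w"
    and exps: "\<iota> / v + \<kappa> / q < 1 / w" and A: "0 < A"
    and scale: "\<And>L. 1 \<le> L \<Longrightarrow> \<exists>r. L \<le> r \<and> r \<le> 2 * L \<and>
        phi_mix M Fam r powr (1 - 4 / w) \<le> A / (real L)\<^sup>2 \<and>
        beta_approx M Fam \<xi> q r < (\<infinity>::ennreal) \<and>
        enn2real (beta_approx M Fam \<xi> q r) powr \<kappa> \<le> A / (real L)\<^sup>2"
begin

lemma \<xi>_integral:
  fixes g :: "'v \<Rightarrow> real"
  assumes [measurable]: "g \<in> borel_measurable borel"
  shows "integrable M (\<lambda>\<omega>. g (\<xi> n \<omega>)) \<longleftrightarrow> integrable M (\<lambda>\<omega>. g (\<xi> 0 \<omega>))"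
    and "(\<integral>\<omega>. g (\<xi> n \<omega>) \<partial>M) = (\<integral>\<omega>. g (\<xi> 0 \<omega>) \<partial>M)"
  using stat[of n] integrable_distr_eq[of "\<xi> n" M borel g] integrable_distr_eq[of "\<xi> 0" M borel g]
    integral_distr[of "\<xi> n" M borel g] integral_distr[of "\<xi> 0" M borel g] by auto

text \<open>One number bounding the \<open>v\<close>-th moments of all \<xi> and of all their window
  approximations; the second summand is the bound from
  \<open>vcond_exp_powr_integral\<close>.\<close>

definition mom :: real where
  "mom = (\<integral>\<omega>. norm (\<xi> 0 \<omega>) powr v \<partial>M)
     + DIM('v) powr v * (DIM('v) * (\<integral>\<omega>. (norm (\<xi> 0 \<omega>) + 1) powr v \<partial>M))"

lemma \<xi>_moment:
  "integrable M (\<lambda>\<omega>. norm (\<xi> n \<omega>) powr v)" "(\<integral>\<omega>. norm (\<xi> n \<omega>) powr v \<partial>M) \<le> mom"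
proof -
  have m[measurable]: "(\<lambda>x::'v. norm x powr v) \<in> borel_measurable borel" by measurable
  show "integrable M (\<lambda>\<omega>. norm (\<xi> n \<omega>) powr v)" using \<xi>_integral(1)[OF m, of n] moment0 by simp
  show "(\<integral>\<omega>. norm (\<xi> n \<omega>) powr v \<partial>M) \<le> mom"
    using \<xi>_integral(2)[OF m, of n] unfolding mom_def by simp
qed

lemma \<xi>_moment_plus1:
  "integrable M (\<lambda>\<omega>. (norm (\<xi> n \<omega>) + 1) powr v)"
proof (rule Bochner_Integration.integrable_bound)
  show "integrable M (\<lambda>\<omega>. 2 powr v * (norm (\<xi> n \<omega>) powr v + 1))"
    using \<xi>_moment(1)[of n] by (intro integrable_mult_right Bochner_Integration.integrable_add) auto
  have "(norm (\<xi> n \<omega>) + 1) powr v \<le> 2 powr v * (norm (\<xi> n \<omega>) powr v + 1)" for \<omega>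
  proof -
    have "(norm (\<xi> n \<omega>) + 1) powr v \<le> (2 * max (norm (\<xi> n \<omega>)) 1) powr v"
      using v by (intro powr_mono2) auto
    also have "\<dots> = 2 powr v * max (norm (\<xi> n \<omega>)) 1 powr v" by (simp add: powr_mult)
    also have "\<dots> \<le> 2 powr v * (norm (\<xi> n \<omega>) powr v + 1)"
      by (intro mult_left_mono) (auto simp: max_def)
    finally show ?thesis .
  qed
  then show "AE \<omega> in M. norm ((norm (\<xi> n \<omega>) + 1) powr v)
      \<le> norm (2 powr v * (norm (\<xi> n \<omega>) powr v + 1))" by simp
qed measurable

definition approx :: "nat \<Rightarrow> nat \<Rightarrow> 'a \<Rightarrow> 'v" where
  "approx r k = vcond_exp M (Fam (Fin (int k - int r)) (Fin (int k + int r))) (\<xi> k)"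

lemma Fam_window_sub: "subalgebra M (Fam (Fin (int k - int r)) (Fin (int k + int r)))"
  by (rule Fam_sub) simp

lemma approx_measurable_Fam:
  assumes "a \<le> Fin (int k - int r)" "Fin (int k + int r) \<le> b"
  shows "approx r k \<in> borel_measurable (Fam a b)"
proof -
  have w: "Fin (int k - int r) \<le> Fin (int k + int r)" by simp
  have ab: "a \<le> b" using assms w by (meson order_trans)
  have "space (Fam a b) = space (Fam (Fin (int k - int r)) (Fin (int k + int r)))"
    using Fam_sub[OF ab] Fam_sub[OF w] by (simp add: subalgebra_def)
  with Fam_mono[OF w assms] have "subalgebra (Fam a b) (Fam (Fin (int k - int r)) (Fin (int k + int r)))"
    by (simp add: subalgebra_def)
  then show ?thesis
    unfolding approx_def by (rule measurable_from_subalg) (rule vcond_exp_measurable)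
qed

lemma approx_measurable [measurable]: "approx r k \<in> borel_measurable M"
  unfolding approx_def by (rule measurable_from_subalg[OF Fam_window_sub vcond_exp_measurable])

lemma approx_moment:
  "integrable M (\<lambda>\<omega>. norm (approx r k \<omega>) powr v)" "(\<integral>\<omega>. norm (approx r k \<omega>) powr v \<partial>M) \<le> mom"
proof -
  note V = vcond_exp_powr_integral[OF Fam_window_sub[of k r] \<xi>_meas[of k] \<xi>_moment_plus1[of k] v, folded approx_def]
  show "integrable M (\<lambda>\<omega>. norm (approx r k \<omega>) powr v)" by (rule V(1))
  have [measurable]: "(\<lambda>x::'v. (norm x + 1) powr v) \<in> borel_measurable borel" by measurable
  have "0 \<le> (\<integral>\<omega>. norm (\<xi> 0 \<omega>) powr v \<partial>M)" by simp
  then show "(\<integral>\<omega>. norm (approx r k \<omega>) powr v \<partial>M) \<le> mom"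
    using V(2) \<xi>_integral(2)[of "\<lambda>x. (norm x + 1) powr v" k]
    unfolding mom_def by (simp add: add_increasing)
qed

lemma approx_error:
  assumes "beta_approx M Fam \<xi> q r < (\<infinity>::ennreal)" "enn2real (beta_approx M Fam \<xi> q r) \<le> b" "0 < b"
  shows "integrable M (\<lambda>\<omega>. (norm (\<xi> k \<omega> - approx r k \<omega>) / b) powr q)"
    and "(\<integral>\<omega>. (norm (\<xi> k \<omega> - approx r k \<omega>) / b) powr q \<partial>M) \<le> 1"
proof -
  have "Lp_norm M q (\<lambda>\<omega>. \<xi> k \<omega> - approx r k \<omega>) \<le> beta_approx M Fam \<xi> q r"
    unfolding beta_approx_def approx_def by (rule SUP_upper) simp
  note * = integral_scaled_powr_le_1[OF this assms _ q]
  show "integrable M (\<lambda>\<omega>. (norm (\<xi> k \<omega> - approx r k \<omega>) / b) powr q)"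
    and "(\<integral>\<omega>. (norm (\<xi> k \<omega> - approx r k \<omega>) / b) powr q \<partial>M) \<le> 1"
    by (rule *; measurable)+
qed

definition sel :: "nat \<Rightarrow> nat \<Rightarrow> 'a \<times> 'a \<times> 'a \<Rightarrow> 'a" where
  "sel P k \<omega> = (if k < P then fst \<omega> else if k = P then fst (snd \<omega>) else snd (snd \<omega>))"

lemma sel_measurable [measurable]: "sel P k \<in> measurable (M \<Otimes>\<^sub>M (M \<Otimes>\<^sub>M M)) M"
  unfolding sel_def by measurable

text \<open>Each single time keeps its law after decoupling, so moments and approximation errors
  carry over to the product space unchanged.\<close>

lemma distr_sel: "distr (M \<Otimes>\<^sub>M (M \<Otimes>\<^sub>M M)) M (sel P k) = M"
proof -
  interpret MM: pair_prob_space M M by unfold_locales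
  interpret MMM: pair_prob_space M "M \<Otimes>\<^sub>M M" by unfold_locales
  have snd_distr: "distr (N \<Otimes>\<^sub>M N') N' snd = N'" if "prob_space N" "prob_space N'" for N :: "'c measure" and N' :: "'d measure"
  proof -
    interpret N: prob_space N by fact
    interpret N': prob_space N' by fact
    interpret P: pair_sigma_finite N' N by unfold_locales
    have "distr (N \<Otimes>\<^sub>M N') N' snd = distr (distr (N' \<Otimes>\<^sub>M N) (N \<Otimes>\<^sub>M N') (\<lambda>(x, y). (y, x))) N' snd"
      using pair_sigma_finite.distr_pair_swap[of N N'] P.pair_sigma_finite_axioms
      by (metis N.sigma_finite_measure_axioms N'.sigma_finite_measure_axioms pair_sigma_finite.intro)
    also have "\<dots> = distr (N' \<Otimes>\<^sub>M N) N' fst"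
      by (subst distr_distr) (auto simp: comp_def case_prod_beta)
    also have "\<dots> = N'" by (rule N.distr_pair_fst)
    finally show ?thesis .
  qed
  have s: "distr (M \<Otimes>\<^sub>M (M \<Otimes>\<^sub>M M)) (M \<Otimes>\<^sub>M M) snd = M \<Otimes>\<^sub>M M"
    by (rule snd_distr) unfold_locales
  consider "k < P" | "k = P" | "P < k" by linarith
  then show ?thesis
  proof cases
    case 1
    then have "sel P k = fst" by (auto simp: sel_def)
    then show ?thesis using MM.distr_pair_fst by simp
  next
    case 2
    then have e: "sel P k = fst \<circ> snd" by (auto simp: sel_def)
    have "distr (M \<Otimes>\<^sub>M (M \<Otimes>\<^sub>M M)) M (fst \<circ> snd) = distr (distr (M \<Otimes>\<^sub>M (M \<Otimes>\<^sub>M M)) (M \<Otimes>\<^sub>M M) snd) M fst"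
      by (subst distr_distr) auto
    then show ?thesis unfolding e s using distr_pair_fst by simp
  next
    case 3
    then have e: "sel P k = snd \<circ> snd" by (auto simp: sel_def)
    have "distr (M \<Otimes>\<^sub>M (M \<Otimes>\<^sub>M M)) M (snd \<circ> snd) = distr (distr (M \<Otimes>\<^sub>M (M \<Otimes>\<^sub>M M)) (M \<Otimes>\<^sub>M M) snd) M snd"
      by (subst distr_distr) auto
    also have "\<dots> = M" unfolding s by (rule snd_distr) unfold_locales
    finally show ?thesis unfolding e .
  qed
qed

lemma sel_integral:
  fixes g :: "'a \<Rightarrow> real"
  assumes g: "integrable M g"
  shows "integrable (M \<Otimes>\<^sub>M (M \<Otimes>\<^sub>M M)) (\<lambda>\<omega>. g (sel P k \<omega>))"
    and "(\<integral>\<omega>. g (sel P k \<omega>) \<partial>(M \<Otimes>\<^sub>M (M \<Otimes>\<^sub>M M))) = (\<integral>\<omega>. g \<omega> \<partial>M)"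
proof -
  have g': "g \<in> borel_measurable M" using g by simp
  show "integrable (M \<Otimes>\<^sub>M (M \<Otimes>\<^sub>M M)) (\<lambda>\<omega>. g (sel P k \<omega>))"
    using integrable_distr_eq[OF sel_measurable g', of P k] g by (simp add: distr_sel)
  show "(\<integral>\<omega>. g (sel P k \<omega>) \<partial>(M \<Otimes>\<^sub>M (M \<Otimes>\<^sub>M M))) = (\<integral>\<omega>. g \<omega> \<partial>M)"
    using integral_distr[OF sel_measurable g', of P k] by (simp add: distr_sel)
qed

section \<open>Fourfold products with one isolated time\<close>

definition centered :: "nat \<Rightarrow> ((nat \<Rightarrow> 'v) \<Rightarrow> real) \<Rightarrow> bool" where
  "centered i0 G \<longleftrightarrow> (\<forall>x. (\<integral>\<omega>. G (x(i0 := \<xi> 0 \<omega>)) \<partial>M) = 0)"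

text \<open>The tested entry always has \<open>j = 0\<close>: a product of four factors is
  symmetric, so another factor can be moved to that position first. The gap is also demanded from
  the other times of the same factor.\<close>

definition isolated :: "nat \<Rightarrow> nat \<Rightarrow> (nat \<Rightarrow> nat \<Rightarrow> nat) \<Rightarrow> bool" where
  "isolated i0 g p \<longleftrightarrow> (\<forall>j<4. \<forall>i<ell. (j, i) \<noteq> (0, i0) \<longrightarrow>
      p j i + g \<le> p 0 i0 \<or> p 0 i0 + g \<le> p j i)"

text \<open>The gap is positive, so no other time equals \<open>p 0 i0\<close>. With the first and
  third copies fixed, the second one enters only through coordinate \<open>i0\<close> of the factor
  \<open>j = 0\<close>; the remaining factors are a constant \<open>c\<close>. Stationarity moves
  the isolated time to 0, centering makes the inner integral vanish, and Fubini concludes.\<close>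

lemma decoupled_prod4_zero:
  fixes K :: real
  assumes G: "holder_class ell \<iota> \<kappa> K G" and K: "0 < K" and i0: "i0 < ell"
    and cen: "centered i0 G" and iso: "isolated i0 g p" and g: "0 < g"
  shows "(\<integral>\<omega>. (\<Prod>j<4::nat. G (\<lambda>i. \<xi> (p j i) (sel (p 0 i0) (p j i) \<omega>)))
      \<partial>(M \<Otimes>\<^sub>M (M \<Otimes>\<^sub>M M))) = 0"
proof -
  interpret MM: pair_prob_space M M by unfold_locales
  interpret MMM: pair_prob_space M "M \<Otimes>\<^sub>M M" by unfold_locales
  let ?P = "p 0 i0"
  define Z where "Z \<omega> = (\<Prod>j<4::nat. G (\<lambda>i. \<xi> (p j i) (sel ?P (p j i) \<omega>)))" for \<omega>
  have v0: "0 < v" using v by simp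
  have Gm[measurable]: "G \<in> borel_measurable borel"
    by (rule borel_measurable_continuous_onI[OF holder_class_continuous[OF G \<iota> \<kappa>]])
  have iZ: "integrable (M \<Otimes>\<^sub>M (M \<Otimes>\<^sub>M M)) Z"
    unfolding Z_def
    by (rule holder_class_prod4_integral_bound(1)[OF G K \<iota> \<kappa> q v0 w exps MMM.prob_space_axioms, where m=mom])
       (auto simp: sel_integral[OF \<xi>_moment(1)] \<xi>_moment(2))
  have inner: "(\<integral>y. Z (x, (y, z)) \<partial>M) = 0" for x z
  proof -
    define u where "u i = \<xi> (p 0 i) (if p 0 i < ?P then x else z)" for i
    define c where "c = (\<Prod>j\<in>{1..<4::nat}. G (\<lambda>i. \<xi> (p j i) (if p j i < ?P then x else z)))"
    have G0: "G (\<lambda>i. \<xi> (p 0 i) (sel ?P (p 0 i) (x, y, z))) = G (u(i0 := \<xi> ?P y))" for y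
    proof (rule holder_class_cong[OF G])
      fix i assume "i < ell"
      then show "\<xi> (p 0 i) (sel ?P (p 0 i) (x, y, z)) = (u(i0 := \<xi> ?P y)) i"
        using iso g unfolding isolated_def by (fastforce simp: sel_def u_def)
    qed
    have Gj: "G (\<lambda>i. \<xi> (p j i) (sel ?P (p j i) (x, y, z))) = G (\<lambda>i. \<xi> (p j i) (if p j i < ?P then x else z))"
      if "j \<in> {1..<4}" for j y
    proof (rule holder_class_cong[OF G])
      fix i assume "i < ell"
      then show "\<xi> (p j i) (sel ?P (p j i) (x, y, z)) = \<xi> (p j i) (if p j i < ?P then x else z)"
        using iso g that unfolding isolated_def by (fastforce simp: sel_def)
    qed
    have s4: "{..<4::nat} = insert 0 {1..<4}" by auto
    have Zc: "Z (x, (y, z)) = G (u(i0 := \<xi> ?P y)) * c" for y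
      unfolding Z_def c_def s4 by (subst prod.insert) (simp_all add: G0 Gj)
    have "(\<lambda>t. u(i0 := t)) \<in> borel_measurable borel"
      by (rule measurable_coordinatewise_then_product) (auto simp: fun_upd_def)
    then have m: "(\<lambda>t. G (u(i0 := t))) \<in> borel_measurable borel"
      by (rule measurable_compose[OF _ Gm])
    show ?thesis unfolding Zc using \<xi>_integral(2)[OF m, of ?P] cen unfolding centered_def by simp
  qed
  have "AE x in M. (\<integral>y. Z (x, y) \<partial>(M \<Otimes>\<^sub>M M)) = 0"
    using MMM.AE_integrable_fst'[OF iZ]
  proof eventually_elim
    case (elim x)
    have "(\<integral>y. Z (x, y) \<partial>(M \<Otimes>\<^sub>M M)) = (\<integral>z. (\<integral>y. Z (x, (y, z)) \<partial>M) \<partial>M)"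
      using MM.integral_snd[of "\<lambda>y z. Z (x, (y, z))"] elim by (simp add: case_prod_beta')
    then show ?case by (simp add: inner)
  qed
  then have "(\<integral>x. (\<integral>y. Z (x, y) \<partial>(M \<Otimes>\<^sub>M M)) \<partial>M) = (\<integral>x. 0 \<partial>M)"
    using MMM.integrable_fst'[OF iZ] by (intro integral_cong_AE) auto
  then show ?thesis using MMM.integral_fst'[OF iZ] unfolding Z_def by simp
qed

text \<open>Two comparisons with truncated approximations, each with the two error terms
  \<open>b powr \<kappa>\<close> and \<open>R powr (1 - w / 4)\<close>, give the factor 4; the last
  summand 4 pays for the two mixing cuts.\<close>

definition iso_const :: "real \<Rightarrow> real" where
  "iso_const K = A * (4 * ((4 * real ell * (K * (1 + 2 * real ell)) ^ 4 + (K * (1 + 2 * real ell)) powr w)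
        * (1 + 4 * real ell * (2 * mom + 1))) + 4)"

lemma isolated_prod4_bound:
  fixes K :: real
  assumes G: "holder_class ell \<iota> \<kappa> K G" and K: "0 < K" and i0: "i0 < ell"
    and cen: "centered i0 G" and iso: "isolated i0 (6 * L) p" and L: "1 \<le> L"
  shows "\<bar>\<integral>\<omega>. (\<Prod>j<4::nat. G (\<lambda>i. \<xi> (p j i) \<omega>)) \<partial>M\<bar> \<le> iso_const K / (real L)\<^sup>2"
proof -
  interpret MM: pair_prob_space M M by unfold_locales
  interpret MMM: pair_prob_space M "M \<Otimes>\<^sub>M M" by unfold_locales
  let ?N = "M \<Otimes>\<^sub>M (M \<Otimes>\<^sub>M M)"
  define P where "P = p 0 i0"
  obtain r where r: "L \<le> r" "r \<le> 2 * L" and \<phi>: "phi_mix M Fam r powr (1 - 4 / w) \<le> A / (real L)\<^sup>2"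
    and fin: "beta_approx M Fam \<xi> q r < (\<infinity>::ennreal)"
    and \<beta>: "enn2real (beta_approx M Fam \<xi> q r) powr \<kappa> \<le> A / (real L)\<^sup>2"
    using scale[OF L] by blast
  define e where "e = A / (real L)\<^sup>2"
  have e: "0 < e" unfolding e_def using A L by simp
  define t where "t = phi_mix M Fam r"
  \<comment> \<open>Chosen so that \<open>b powr \<kappa>\<close> is exactly \<open>A / L^2\<close>;
    it dominates the approximation coefficient and, unlike it, is certainly positive.\<close>
  define b where "b = e powr (1 / \<kappa>)"
  \<comment> \<open>This level balances the mixing error \<open>R * t\<close> against the truncation error \<open>R powr (1 - w / 4)\<close>.\<close>
  define R where "R = e powr (- 4 / (w - 4))"
  have b: "0 < b" and R: "0 < R" unfolding b_def R_def using e by auto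
  have b\<kappa>: "b powr \<kappa> = e" unfolding b_def using e \<kappa> by (simp add: powr_powr)
  have "enn2real (beta_approx M Fam \<xi> q r) = (enn2real (beta_approx M Fam \<xi> q r) powr \<kappa>) powr (1 / \<kappa>)"
    using \<kappa> by (simp add: powr_powr)
  also have "\<dots> \<le> b" unfolding b_def using \<beta> \<kappa> by (intro powr_mono2) (auto simp: e_def)
  finally have \<beta>b: "enn2real (beta_approx M Fam \<xi> q r) \<le> b" .
  have Rw: "R powr (1 - w / 4) = e"
  proof -
    have "- 4 / (w - 4) * (1 - w / 4) = 1" using w by (simp add: field_simps)
    then show ?thesis unfolding R_def powr_powr using e by simp
  qed
  \<comment> \<open>Between two times a window of radius \<open>r\<close> on each side and a mixing
    gap of length \<open>r\<close> must fit. This takes \<open>3 * r\<close>, and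
    \<open>r \<le> 2 * L\<close> explains the isolation distance \<open>6 * L\<close>.\<close>
  define k1 where "k1 = int P - 2 * int r"
  define k2 where "k2 = int P + int r"
  let ?G = "\<lambda>k. Fam Minf (Fin k)" and ?H = "\<lambda>k. Fam (Fin (k + int r)) Pinf"
  have sub: "subalgebra M (?G k)" "subalgebra M (?H k)" for k by (rule Fam_sub; simp)+
  have dep: "phi_dep M (?G k) (?H k) t" for k
    unfolding t_def by (rule phi_dep_phi_mix[OF Fam_sub])
  have t0: "0 \<le> t" by (rule phi_dep_nonneg[OF dep sub])
  \<comment> \<open>The exponent \<open>w / (w - 4)\<close> inverts \<open>1 - 4 / w\<close>;
    together with the exponent \<open>- 4 / (w - 4)\<close> of \<open>R\<close> it adds up to
    1.\<close>
  have "t = (t powr (1 - 4 / w)) powr (w / (w - 4))"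
    using t0 w by (simp add: powr_powr field_simps)
  also have "\<dots> \<le> e powr (w / (w - 4))" using \<phi> w by (intro powr_mono2) (auto simp: t_def e_def)
  finally have "R * t \<le> R * e powr (w / (w - 4))" using R by (intro mult_left_mono) auto
  also have "\<dots> = e powr 1"
  proof -
    have "- 4 / (w - 4) + w / (w - 4) = 1"
      unfolding add_divide_distrib[symmetric] using w by simp
    then show ?thesis unfolding R_def powr_add[symmetric] by simp
  qed
  finally have Rt: "R * t \<le> e" using e by simp
  define Q where "Q = {p j i | j i. j < 4 \<and> i < ell}"
  \<comment> \<open>Times that do not occur are set to 0, because windows around times close to
    \<open>P\<close> would fit on neither side of a cut.\<close>
  define Y where "Y k = (if k \<in> Q then approx r k else (\<lambda>_. 0))" for k
  have Qiso: "k + 6 * L \<le> P \<or> k = P \<or> P + 6 * L \<le> k" if "k \<in> Q" for k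
    using that iso unfolding Q_def isolated_def P_def by blast
  have pQ: "p j i \<in> Q" if "j < 4" "i < ell" for j i using that unfolding Q_def by blast
  define \<Psi> where "\<Psi> x = clamp_abs R (\<Prod>j<4::nat. G (\<lambda>i. x (p j i)))" for x
  have c\<Psi>: "continuous_on UNIV \<Psi>"
    unfolding \<Psi>_def
    by (intro continuous_intros continuous_on_compose2[OF holder_class_continuous[OF G \<iota> \<kappa>]]
          continuous_on_coordinatewise_then_product) auto
  have "\<bar>(\<integral>\<omega>. \<Psi> (\<lambda>k. Y k \<omega>) \<partial>M)
    - (\<integral>\<omega>. \<Psi> (\<lambda>k. Y k (if k < P then fst \<omega> else if k = P then fst (snd \<omega>) else snd (snd \<omega>))) \<partial>?N)\<bar> \<le> 4 * R * t"
  proof (rule phi_dep_isolated[OF dep sub dep sub _ _ _ _ c\<Psi>])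
    show "Y k \<in> borel_measurable (?G k1)" if "k < P" for k
    proof (cases "k \<in> Q")
      case True
      with Qiso[OF True] that r have "int k + int r \<le> k1" unfolding k1_def by linarith
      then show ?thesis unfolding Y_def using True by (auto intro: approx_measurable_Fam)
    qed (simp add: Y_def)
    show "Y k \<in> borel_measurable (?H k1)" if "P \<le> k" for k
      unfolding Y_def using that by (auto intro: approx_measurable_Fam simp: k1_def)
    show "Y k \<in> borel_measurable (?G k2)" if "k \<le> P" for k
      unfolding Y_def using that by (auto intro: approx_measurable_Fam simp: k2_def)
    show "Y k \<in> borel_measurable (?H k2)" if "P < k" for k
    proof (cases "k \<in> Q")
      case True
      with Qiso[OF True] that r have "k2 + int r \<le> int k - int r" unfolding k2_def by linarith
      then show ?thesis unfolding Y_def using True by (auto intro: approx_measurable_Fam)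
    qed (simp add: Y_def)
    show "\<bar>\<Psi> x\<bar> \<le> R" for x unfolding \<Psi>_def using R by (intro clamp_abs_le) auto
  qed
  moreover have "\<Psi> (\<lambda>k. Y k \<omega>) = clamp_abs R (\<Prod>j<4::nat. G (\<lambda>i. approx r (p j i) \<omega>))" for \<omega>
    unfolding \<Psi>_def
    by (intro arg_cong[of _ _ "clamp_abs R"] prod.cong refl holder_class_cong[OF G]) (auto simp: Y_def pQ)
  moreover have "\<Psi> (\<lambda>k. Y k (if k < P then fst \<omega> else if k = P then fst (snd \<omega>) else snd (snd \<omega>)))
     = clamp_abs R (\<Prod>j<4::nat. G (\<lambda>i. approx r (p j i) (sel P (p j i) \<omega>)))" for \<omega>
    unfolding \<Psi>_def
    by (intro arg_cong[of _ _ "clamp_abs R"] prod.cong refl holder_class_cong[OF G]) (auto simp: Y_def pQ sel_def)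
  ultimately have 1: "\<bar>(\<integral>\<omega>. clamp_abs R (\<Prod>j<4::nat. G (\<lambda>i. approx r (p j i) \<omega>)) \<partial>M)
    - (\<integral>\<omega>. clamp_abs R (\<Prod>j<4::nat. G (\<lambda>i. approx r (p j i) (sel P (p j i) \<omega>))) \<partial>?N)\<bar> \<le> 4 * (R * t)"
    by simp
  define D where "D = (4 * ell * (K * (1 + 2 * ell)) ^ 4 + (K * (1 + 2 * ell)) powr w) * (b powr \<kappa> + R powr (1 - w / 4))
        * (1 + 4 * ell * (2 * mom + 1))"
  have v0: "0 < v" using v by simp
  have 2: "\<bar>(\<integral>\<omega>. (\<Prod>j<4::nat. G (\<lambda>i. \<xi> (p j i) \<omega>)) \<partial>M)
     - (\<integral>\<omega>. clamp_abs R (\<Prod>j<4::nat. G (\<lambda>i. approx r (p j i) \<omega>)) \<partial>M)\<bar> \<le> D"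
    unfolding D_def
    by (rule holder_class_prod4_integral_clamp[OF G K \<iota> \<kappa> q v0 w exps prob_space_axioms b R])
       (auto intro: \<xi>_moment approx_moment approx_error[OF fin \<beta>b b])
  have 3: "\<bar>(\<integral>\<omega>. (\<Prod>j<4::nat. G (\<lambda>i. \<xi> (p j i) (sel P (p j i) \<omega>))) \<partial>?N)
     - (\<integral>\<omega>. clamp_abs R (\<Prod>j<4::nat. G (\<lambda>i. approx r (p j i) (sel P (p j i) \<omega>))) \<partial>?N)\<bar> \<le> D"
    unfolding D_def
    by (rule holder_class_prod4_integral_clamp[OF G K \<iota> \<kappa> q v0 w exps MMM.prob_space_axioms b R])
       (auto simp: sel_integral[OF \<xi>_moment(1)] sel_integral[OF approx_moment(1)]
          sel_integral[OF approx_error(1)[OF fin \<beta>b b]] \<xi>_moment approx_moment approx_error[OF fin \<beta>b b])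
  have 4: "(\<integral>\<omega>. (\<Prod>j<4::nat. G (\<lambda>i. \<xi> (p j i) (sel P (p j i) \<omega>))) \<partial>?N) = 0"
    unfolding P_def by (rule decoupled_prod4_zero[OF G K i0 cen iso]) (use L in auto)
  have "\<bar>\<integral>\<omega>. (\<Prod>j<4::nat. G (\<lambda>i. \<xi> (p j i) \<omega>)) \<partial>M\<bar> \<le> 2 * D + 4 * (R * t)"
    using 1 2 3 4 by linarith
  also have "\<dots> \<le> 2 * D + 4 * e" using Rt by simp
  also have "\<dots> = iso_const K / (real L)\<^sup>2"
    unfolding D_def b\<kappa> Rw iso_const_def e_def by (simp add: algebra_simps add_divide_distrib)
  finally show ?thesis .
qed

lemma prod4_bound:
  fixes K :: real
  assumes G: "holder_class ell \<iota> \<kappa> K G" and K: "0 < K"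
  shows "integrable M (\<lambda>\<omega>. \<Prod>j<4::nat. G (\<lambda>i. \<xi> (p j i) \<omega>))"
    and "\<bar>\<integral>\<omega>. (\<Prod>j<4::nat. G (\<lambda>i. \<xi> (p j i) \<omega>)) \<partial>M\<bar> \<le> (K * (1 + 2 * ell)) ^ 4 * (1 + 4 * ell * mom)"
proof -
  have v0: "0 < v" using v by simp
  note * = holder_class_prod4_integral_bound[OF G K \<iota> \<kappa> q v0 w exps prob_space_axioms, where m=mom and A="\<lambda>j i. \<xi> (p j i)"]
  show "integrable M (\<lambda>\<omega>. \<Prod>j<4::nat. G (\<lambda>i. \<xi> (p j i) \<omega>))"
    by (rule *(1)) (auto intro: \<xi>_moment)
  show "\<bar>\<integral>\<omega>. (\<Prod>j<4::nat. G (\<lambda>i. \<xi> (p j i) \<omega>)) \<partial>M\<bar> \<le> (K * (1 + 2 * ell)) ^ 4 * (1 + 4 * ell * mom)"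
    by (rule *(2)) (auto intro: \<xi>_moment)
qed

end

section \<open>Counting near-collisions of polynomial times\<close>

text \<open>Coefficients are nonnegative, so every monomial is monotone in \<open>n\<close>, and the
  one with \<open>a > 0\<close> is strictly so; \<open>1 \<le> N\<close> keeps its factor
  \<open>N ^ b\<close> positive.\<close>

lemma bipoly_eval_strict_mono:
  assumes fin: "finite (bipoly_supp c)" and ab: "(a, b) \<in> bipoly_supp c" "0 < a"
    and N: "1 \<le> N" and n: "n < n'"
  shows "bipoly_eval c n N < bipoly_eval c n' N"
  unfolding bipoly_eval_def
proof (rule sum_strict_mono_ex1[OF fin])
  show "\<forall>x\<in>bipoly_supp c. (case x of (a, b) \<Rightarrow> c a b * n ^ a * N ^ b) \<le> (case x of (a, b) \<Rightarrow> c a b * n' ^ a * N ^ b)"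
    using n by (auto intro!: mult_mono power_mono)
  have "n ^ a < n' ^ a" using ab n by (intro power_strict_mono) auto
  moreover have "0 < c a b * N ^ b" using ab(1) N by (auto simp: bipoly_supp_def)
  ultimately have "c a b * n ^ a * N ^ b < c a b * n' ^ a * N ^ b" by simp
  then show "\<exists>x\<in>bipoly_supp c. (case x of (a, b) \<Rightarrow> c a b * n ^ a * N ^ b) < (case x of (a, b) \<Rightarrow> c a b * n' ^ a * N ^ b)"
    using ab(1) by (intro bexI[of _ "(a, b)"]) auto
qed

lemma card_bipoly_near_point:
  assumes fin: "finite (bipoly_supp c)" and ab: "(a, b) \<in> bipoly_supp c" "0 < a" and N: "1 \<le> N"
  shows "card {n \<in> {1..N}. \<bar>int (bipoly_eval c n N) - m\<bar> < int l} \<le> 2 * l"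
proof -
  let ?S = "{n \<in> {1..N}. \<bar>int (bipoly_eval c n N) - m\<bar> < int l}"
  have "strict_mono (\<lambda>n. bipoly_eval c n N)"
    by (rule strict_monoI) (rule bipoly_eval_strict_mono[OF fin ab N])
  then have "inj (\<lambda>n. int (bipoly_eval c n N))"
    by (intro injI) (auto dest: strict_mono_eq)
  then have "card ?S \<le> card {m - int l<..<m + int l}"
    by (intro card_inj_on_le[of "\<lambda>n. int (bipoly_eval c n N)"]) (auto intro: inj_on_subset)
  also have "\<dots> \<le> 2 * l" by simp
  finally show ?thesis .
qed

text \<open>Reads the difference as a polynomial in \<open>n\<close> whose coefficients are integer
  polynomials in \<open>N\<close>, so that the two ways of being nonconstant can be told
  apart.\<close>

lemma bipoly_diff_as_poly:
  assumes "finite (bipoly_supp c)" "finite (bipoly_supp d)"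
  obtains D :: nat and P :: "nat \<Rightarrow> int poly" where
    "\<And>n N. int (bipoly_eval c n N) - int (bipoly_eval d n N) = (\<Sum>a\<le>D. poly (P a) (int N) * int n ^ a)"
proof -
  define S where "S = bipoly_supp c \<union> bipoly_supp d"
  define D where "D = Max (insert 0 (fst ` S \<union> snd ` S))"
  have fS: "finite S" unfolding S_def using assms by simp
  have D: "a \<le> D" "b \<le> D" if "(a, b) \<in> S" for a b
  proof -
    have "a \<in> fst ` S" "b \<in> snd ` S" using that by force+
    then show "a \<le> D" "b \<le> D" unfolding D_def using fS by (auto intro!: Max_ge)
  qed
  have ev: "int (bipoly_eval c n N) = (\<Sum>a\<le>D. \<Sum>b\<le>D. int (c a b) * int n ^ a * int N ^ b)"
    if "bipoly_supp c \<subseteq> S" for c n N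
  proof -
    have "int (bipoly_eval c n N) = (\<Sum>(a, b)\<in>bipoly_supp c. int (c a b) * int n ^ a * int N ^ b)"
      unfolding bipoly_eval_def by (simp add: case_prod_beta)
    also have "\<dots> = (\<Sum>(a, b)\<in>{..D} \<times> {..D}. int (c a b) * int n ^ a * int N ^ b)"
    proof (rule sum.mono_neutral_left)
      show "bipoly_supp c \<subseteq> {..D} \<times> {..D}" using that D by auto
    qed (auto simp: bipoly_supp_def)
    also have "\<dots> = (\<Sum>a\<le>D. \<Sum>b\<le>D. int (c a b) * int n ^ a * int N ^ b)"
      by (simp add: sum.cartesian_product)
    finally show ?thesis .
  qed
  define P :: "nat \<Rightarrow> int poly" where "P a = (\<Sum>b\<le>D. monom (int (c a b) - int (d a b)) b)" for a
  have "int (bipoly_eval c n N) - int (bipoly_eval d n N) = (\<Sum>a\<le>D. poly (P a) (int N) * int n ^ a)" for n N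
    unfolding ev[of c, unfolded S_def, OF Un_upper1] ev[of d, unfolded S_def, OF Un_upper2] P_def
    by (simp only: poly_sum poly_monom sum_distrib_right sum_subtractf[symmetric])
       (simp add: algebra_simps)
  then show ?thesis by (rule that)
qed

lemma eventually_poly_int_nonzero:
  fixes p :: "int poly"
  assumes "p \<noteq> 0"
  obtains N0 :: nat where "\<And>N. N0 \<le> N \<Longrightarrow> poly p (int N) \<noteq> 0"
proof -
  have "finite {x. poly p x = 0}" by (rule poly_roots_finite[OF assms])
  then have "finite {N. poly p (int N) = 0}"
    using finite_vimageI[of "{x. poly p x = 0}" int] by (simp add: vimage_def)
  then obtain k where "{N. poly p (int N) = 0} \<subseteq> {..<k}" using finite_nat_iff_bounded by blast
  then show ?thesis by (intro that[of k]) auto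
qed

text \<open>If a positive power of \<open>n\<close> has a nonzero coefficient polynomial, then for
  large \<open>N\<close> the difference is a nonconstant polynomial in \<open>n\<close> and takes
  each of the fewer than \<open>2 * l\<close> admissible values at most \<open>D\<close> times.
  Otherwise the difference depends on \<open>N\<close> alone and grows at least like
  \<open>N\<close>; being smaller than \<open>l\<close> then forces \<open>N\<close> to be at most
  \<open>l\<close> plus a constant, and counting all \<open>n\<close> suffices.\<close>

lemma card_bipoly_near_collision:
  assumes fin: "finite (bipoly_supp c)" "finite (bipoly_supp d)"
    and nc: "\<not> (\<exists>C::int. \<forall>n N. int (bipoly_eval c n N) - int (bipoly_eval d n N) = C)"
  shows "\<exists>C N0. \<forall>N\<ge>N0. \<forall>l\<ge>1.
    card {n \<in> {1..N}. \<bar>int (bipoly_eval c n N) - int (bipoly_eval d n N)\<bar> < int l} \<le> C * l"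
proof -
  obtain D and P :: "nat \<Rightarrow> int poly" where
    P: "\<And>n N. int (bipoly_eval c n N) - int (bipoly_eval d n N) = (\<Sum>a\<le>D. poly (P a) (int N) * int n ^ a)"
    by (rule bipoly_diff_as_poly[OF fin]) (rule that)
  show ?thesis
  proof (cases "\<exists>a. 1 \<le> a \<and> a \<le> D \<and> P a \<noteq> 0")
    case True
    then obtain a where a: "1 \<le> a" "a \<le> D" "P a \<noteq> 0" by blast
    obtain N0 where N0: "\<And>N. N0 \<le> N \<Longrightarrow> poly (P a) (int N) \<noteq> 0"
      using eventually_poly_int_nonzero[OF a(3)] by blast
    have "card {n \<in> {1..N}. \<bar>int (bipoly_eval c n N) - int (bipoly_eval d n N)\<bar> < int l} \<le> (2 * D) * l"
      if N: "N0 \<le> N" for N l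
    proof -
      \<comment> \<open>For fixed \<open>N\<close>, the roots of \<open>Q m\<close> are the
        \<open>n\<close> at which the difference equals \<open>m\<close>.\<close>
      define Q where "Q m = (\<Sum>a\<le>D. monom (poly (P a) (int N)) a) - [:m:]" for m
      have cQ: "coeff (Q m) k = (if k \<le> D then poly (P k) (int N) else 0) - coeff [:m:] k" for m k
        unfolding Q_def by (simp add: coeff_sum)
      have "coeff (Q m) a \<noteq> 0" for m
        using a N0[OF N] by (cases a) (auto simp: cQ)
      then have Q0: "Q m \<noteq> 0" for m by (metis coeff_0)
      have dQ: "degree (Q m) \<le> D" for m
        by (rule degree_le) (use a in \<open>auto simp: cQ coeff_pCons split: nat.split\<close>)
      have cr: "card {n. poly (Q m) (int n) = 0} \<le> D" "finite {n. poly (Q m) (int n) = 0}" for m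
      proof -
        have f: "finite {x. poly (Q m) x = 0}" by (rule poly_roots_finite[OF Q0])
        have "card {n. poly (Q m) (int n) = 0} \<le> card {x. poly (Q m) x = 0}"
          using f by (intro card_inj_on_le[of int]) auto
        also have "\<dots> \<le> degree (Q m)" by (rule card_poly_roots_bound[OF Q0])
        finally show "card {n. poly (Q m) (int n) = 0} \<le> D" using dQ[of m] by linarith
        show "finite {n. poly (Q m) (int n) = 0}"
          using finite_vimageI[OF f, of int] by (simp add: vimage_def)
      qed
      have "{n \<in> {1..N}. \<bar>int (bipoly_eval c n N) - int (bipoly_eval d n N)\<bar> < int l}
         \<subseteq> (\<Union>m\<in>{- int l<..<int l}. {n. poly (Q m) (int n) = 0})"
        unfolding P by (auto simp: Q_def poly_sum poly_monom)
      then have "card {n \<in> {1..N}. \<bar>int (bipoly_eval c n N) - int (bipoly_eval d n N)\<bar> < int l}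
         \<le> card (\<Union>m\<in>{- int l<..<int l}. {n. poly (Q m) (int n) = 0})"
        by (intro card_mono) (auto simp: cr)
      also have "\<dots> \<le> (\<Sum>m\<in>{- int l<..<int l}. card {n. poly (Q m) (int n) = 0})"
        by (rule card_UN_le) simp
      also have "\<dots> \<le> (\<Sum>m\<in>{- int l<..<int l}. D)" by (intro sum_mono cr)
      also have "\<dots> = D * nat (2 * int l - 1)" by simp
      also have "\<dots> \<le> D * (2 * l)" by (intro mult_left_mono) auto
      finally have "card {n \<in> {1..N}. \<bar>int (bipoly_eval c n N) - int (bipoly_eval d n N)\<bar> < int l} \<le> D * (2 * l)" .
      also have "\<dots> = (2 * D) * l" by simp
      finally show ?thesis .
    qed
    then show ?thesis by blast
  next
    case False
    have P0: "int (bipoly_eval c n N) - int (bipoly_eval d n N) = poly (P 0) (int N)" for n N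
    proof -
      have "(\<Sum>a\<le>D. poly (P a) (int N) * int n ^ a) = (\<Sum>a\<in>{0}. poly (P a) (int N) * int n ^ a)"
        by (rule sum.mono_neutral_right) (use False in \<open>auto simp: Suc_le_eq\<close>)
      then show ?thesis by (simp add: P)
    qed
    \<comment> \<open>Splitting off the constant term writes the difference as
      \<open>a0 + N * s(N)\<close>; nonconstancy means \<open>s \<noteq> 0\<close>, and an integer
      value of \<open>s\<close> other than 0 has modulus at least 1.\<close>
    obtain a0 s where s: "P 0 = pCons a0 s" by (cases "P 0")
    have "s \<noteq> 0" using nc P0 s by auto
    then obtain N0 where N0: "\<And>N. N0 \<le> N \<Longrightarrow> poly s (int N) \<noteq> 0"
      using eventually_poly_int_nonzero by blast
    have "card {n \<in> {1..N}. \<bar>int (bipoly_eval c n N) - int (bipoly_eval d n N)\<bar> < int l} \<le> (1 + nat \<bar>a0\<bar>) * l"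
      if N: "N0 \<le> N" and l: "1 \<le> l" for N l
    proof (cases "\<bar>poly (P 0) (int N)\<bar> < int l")
      case True
      have "1 \<le> \<bar>poly s (int N)\<bar>" using N0[OF N] by linarith
      then have "int N * 1 \<le> int N * \<bar>poly s (int N)\<bar>" by (intro mult_left_mono) auto
      also have "\<dots> = \<bar>int N * poly s (int N)\<bar>" by (simp add: abs_mult)
      also have "\<dots> \<le> \<bar>poly (P 0) (int N)\<bar> + \<bar>a0\<bar>" by (simp add: s)
      finally have "int N \<le> int l + \<bar>a0\<bar>" using True by linarith
      then have "N \<le> l + nat \<bar>a0\<bar>" by linarith
      also have "\<dots> \<le> (1 + nat \<bar>a0\<bar>) * l" using l by (simp add: algebra_simps)
      finally have "card {1..N} \<le> (1 + nat \<bar>a0\<bar>) * l" by simp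
      moreover have "card {n \<in> {1..N}. \<bar>int (bipoly_eval c n N) - int (bipoly_eval d n N)\<bar> < int l} \<le> card {1..N}"
        by (intro card_mono) auto
      ultimately show ?thesis by linarith
    next
      case False
      then show ?thesis by (simp add: P0)
    qed
    then show ?thesis by blast
  qed
qed

text \<open>Links of three of the four entries already determine two entries up to \<open>d\<close>
  choices each, leaving two free ones. The constant is 3 for the set that the last entry may come
  from, times 3 for the entry to which \<open>n0\<close> is linked.\<close>

lemma card_linked_quadruples:
  fixes S :: "nat \<Rightarrow> nat set"
  assumes V: "finite V" and S: "\<And>x. x \<in> V \<Longrightarrow> S x \<subseteq> V" "\<And>x. x \<in> V \<Longrightarrow> card (S x) \<le> d"
  shows "card {(n0, n1, n2, n3). n0 \<in> V \<and> n1 \<in> V \<and> n2 \<in> V \<and> n3 \<in> V \<and>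
      n0 \<in> S n1 \<union> S n2 \<union> S n3 \<and> n1 \<in> S n0 \<union> S n2 \<union> S n3 \<and> n2 \<in> S n0 \<union> S n1 \<union> S n3}
    \<le> 9 * (card V)\<^sup>2 * d\<^sup>2" (is "card ?W \<le> _")
proof -
  \<comment> \<open>Here \<open>x\<close> and \<open>y\<close> are free, \<open>a\<close> is linked
    to \<open>x\<close>, and \<open>b\<close> to any of the other three.\<close>
  define U where "U = (SIGMA x:V. SIGMA y:V. SIGMA a:S x. S a \<union> S x \<union> S y)"
  have finS: "finite (S x)" if "x \<in> V" for x using S(1)[OF that] V by (rule finite_subset)
  have finU: "finite U" unfolding U_def
    using S(1) finS V by (intro finite_SigmaI finite_UnI) auto
  have "card (S a \<union> S x \<union> S y) \<le> 3 * d" if "x \<in> V" "y \<in> V" "a \<in> S x" for x y a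
  proof -
    have "a \<in> V" using S(1) that by auto
    then show ?thesis
      using card_Un_le[of "S a \<union> S x" "S y"] card_Un_le[of "S a" "S x"] S(2)[of a] S(2)[of x] S(2)[of y] that
      by linarith
  qed
  then have c1: "card (SIGMA a:S x. S a \<union> S x \<union> S y) \<le> d * (3 * d)" if "x \<in> V" "y \<in> V" for x y
  proof -
    have "card (SIGMA a:S x. S a \<union> S x \<union> S y) = (\<Sum>a\<in>S x. card (S a \<union> S x \<union> S y))"
      using that S(1) finS by (intro card_SigmaI ballI finite_UnI) auto
    also have "\<dots> \<le> card (S x) * (3 * d)"
      using that \<open>\<And>x y a. _ \<Longrightarrow> _ \<Longrightarrow> _ \<Longrightarrow> card (S a \<union> S x \<union> S y) \<le> 3 * d\<close>
      by (intro order_trans[OF sum_bounded_above[where K="3*d"]]) auto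
    also have "\<dots> \<le> d * (3 * d)" using S(2)[OF that(1)] by (intro mult_right_mono) auto
    finally show ?thesis .
  qed
  have fin3: "finite (SIGMA a:S x. S a \<union> S x \<union> S y)" if "x \<in> V" "y \<in> V" for x y
    using that S(1) finS by (intro finite_SigmaI finite_UnI) auto
  have "card U = (\<Sum>x\<in>V. \<Sum>y\<in>V. card (SIGMA a:S x. S a \<union> S x \<union> S y))"
    unfolding U_def using V fin3 by (subst card_SigmaI) (auto intro!: sum.cong card_SigmaI)
  also have "\<dots> \<le> (\<Sum>x\<in>V. \<Sum>y\<in>V. d * (3 * d))" by (intro sum_mono c1)
  also have "\<dots> = 3 * (card V)\<^sup>2 * d\<^sup>2" by (simp add: power2_eq_square)
  finally have cU: "card U \<le> 3 * (card V)\<^sup>2 * d\<^sup>2" .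
  \<comment> \<open>If \<open>n0\<close> is linked to \<open>y\<close>, pick an index other than 0 and that of \<open>y\<close>: given the remaining two entries,
    first \<open>n0\<close> and then the picked entry have few choices.\<close>
  let ?f1 = "\<lambda>(x, y, a, b). (a, x, b, y)" and ?f2 = "\<lambda>(x, y, a, b). (a, b, x, y)"
    and ?f3 = "\<lambda>(x, y, a, b). (a, b, y, x)"
  have "?W \<subseteq> ?f1 ` U \<union> ?f2 ` U \<union> ?f3 ` U"
  proof (clarify)
    fix n0 n1 n2 n3
    assume V4: "n0 \<in> V" "n1 \<in> V" "n2 \<in> V" "n3 \<in> V"
      and l0: "n0 \<in> S n1 \<union> S n2 \<union> S n3" and l1: "n1 \<in> S n0 \<union> S n2 \<union> S n3"
      and l2: "n2 \<in> S n0 \<union> S n1 \<union> S n3"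
      and no: "(n0, n1, n2, n3) \<notin> ?f3 ` U" "(n0, n1, n2, n3) \<notin> ?f2 ` U"
    consider "n0 \<in> S n1" | "n0 \<in> S n2" | "n0 \<in> S n3" using l0 by blast
    then show "(n0, n1, n2, n3) \<in> ?f1 ` U"
    proof cases
      case 1
      then have "(n1, n3, n0, n2) \<in> U" unfolding U_def using V4 l2 by auto
      then show ?thesis by force
    next
      case 2
      then have "(n2, n3, n0, n1) \<in> U" unfolding U_def using V4 l1 by auto
      then show ?thesis using no by force
    next
      case 3
      then have "(n3, n2, n0, n1) \<in> U" unfolding U_def using V4 l1 by auto
      then show ?thesis using no by force
    qed
  qed
  then have "card ?W \<le> card (?f1 ` U \<union> ?f2 ` U \<union> ?f3 ` U)"
    using finU by (intro card_mono) auto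
  also have "\<dots> \<le> card (?f1 ` U) + card (?f2 ` U) + card (?f3 ` U)"
    by (intro order_trans[OF card_Un_le] add_mono card_Un_le) auto
  also have "\<dots> \<le> card U + card U + card U" by (intro add_mono card_image_le finU)
  also have "\<dots> \<le> 9 * (card V)\<^sup>2 * d\<^sup>2" using cU by simp
  finally show ?thesis .
qed

section \<open>The fourth moment of a centered sum\<close>

text \<open>Summable fourth moments make the series of fourth powers finite almost everywhere, by
  exchanging sum and integral, and the terms of a convergent series tend to 0. The shift by
  \<open>N0\<close> discards the indices without a bound.\<close>

lemma (in prob_space) AE_tendsto_0_of_moment4:
  fixes X :: "nat \<Rightarrow> 'a \<Rightarrow> real"
  assumes int: "\<And>N. N0 \<le> N \<Longrightarrow> integrable M (\<lambda>\<omega>. X N \<omega> ^ 4)"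
    and bd: "\<And>N. N0 \<le> N \<Longrightarrow> (\<integral>\<omega>. X N \<omega> ^ 4 \<partial>M) \<le> B * real N powr s" and s: "s < - 1" and B: "0 \<le> B"
  shows "AE \<omega> in M. (\<lambda>N. X N \<omega>) \<longlonglongrightarrow> 0"
proof -
  have "(\<integral>\<^sup>+\<omega>. (\<Sum>N. ennreal (X (N + N0) \<omega> ^ 4)) \<partial>M) = (\<Sum>N. \<integral>\<^sup>+\<omega>. ennreal (X (N + N0) \<omega> ^ 4) \<partial>M)"
    by (rule nn_integral_suminf) (use int in auto)
  also have "\<dots> \<le> (\<Sum>N. ennreal (B * real (N + N0) powr s))"
  proof (rule suminf_le)
    show "(\<integral>\<^sup>+\<omega>. ennreal (X (N + N0) \<omega> ^ 4) \<partial>M) \<le> ennreal (B * real (N + N0) powr s)" for N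
      using int[of "N + N0"] bd[of "N + N0"] by (subst nn_integral_eq_integral) (auto intro: ennreal_leI)
  qed auto
  also have "\<dots> < \<top>"
  proof -
    have "summable (\<lambda>N. real N powr s)" using s by (simp add: summable_real_powr_iff)
    then have "summable (\<lambda>N. B * real (N + N0) powr s)"
      by (intro summable_mult summable_ignore_initial_segment)
    then show ?thesis using B by (subst suminf_ennreal2) (auto simp: ennreal_less_top)
  qed
  finally have fin: "(\<integral>\<^sup>+\<omega>. (\<Sum>N. ennreal (X (N + N0) \<omega> ^ 4)) \<partial>M) \<noteq> \<infinity>" by simp
  have meas: "(\<lambda>\<omega>. \<Sum>N. ennreal (X (N + N0) \<omega> ^ 4)) \<in> borel_measurable M"
    using int by (intro borel_measurable_suminf_order measurable_compose[OF _ measurable_ennreal]) auto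
  have "AE \<omega> in M. (\<Sum>N. ennreal (X (N + N0) \<omega> ^ 4)) \<noteq> \<infinity>"
    by (rule nn_integral_noteq_infinite[OF meas fin])
  then show ?thesis
  proof eventually_elim
    case (elim \<omega>)
    have "summable (\<lambda>N. X (N + N0) \<omega> ^ 4)"
      by (rule summable_suminf_not_top) (use elim in auto)
    then have "(\<lambda>N. X (N + N0) \<omega> ^ 4) \<longlonglongrightarrow> 0" by (rule summable_LIMSEQ_zero)
    then have "(\<lambda>N. X (N + N0) \<omega>) \<longlonglongrightarrow> 0" by (simp add: power_tendsto_0_iff)
    then show ?case by (rule LIMSEQ_offset)
  qed
qed

lemma sum_power4:
  fixes a :: "'b \<Rightarrow> real"
  shows "(\<Sum>n\<in>V. a n) ^ 4 = (\<Sum>(n0, n1, n2, n3)\<in>V \<times> V \<times> V \<times> V. a n0 * (a n1 * (a n2 * a n3)))"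
proof -
  have two: "(\<Sum>n\<in>V. a n) * (\<Sum>y\<in>W. g y) = (\<Sum>(x, y)\<in>V \<times> W. a x * g y)" for W and g :: "'c \<Rightarrow> real"
    by (simp add: sum_product sum.cartesian_product)
  have "(\<Sum>n\<in>V. a n) ^ 4 = (\<Sum>n\<in>V. a n) * ((\<Sum>n\<in>V. a n) * ((\<Sum>n\<in>V. a n) * (\<Sum>n\<in>V. a n)))"
    by (simp add: eval_nat_numeral)
  also have "\<dots> = (\<Sum>(n0, n1, n2, n3)\<in>V \<times> V \<times> V \<times> V. a n0 * (a n1 * (a n2 * a n3)))"
    unfolding two by (simp add: case_prod_beta)
  finally show ?thesis .
qed

lemma nat_ceiling_bounds:
  fixes x :: real
  assumes "1 \<le> x"
  shows "1 \<le> nat \<lceil>x\<rceil>" "x \<le> real (nat \<lceil>x\<rceil>)" "real (nat \<lceil>x\<rceil>) \<le> 2 * x"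
  using assms by linarith+

locale polynomial_array = mixing_process M Fam \<xi> ell \<iota> \<kappa> q v w A
  for M :: "'a measure" and Fam and \<xi> :: "nat \<Rightarrow> 'a \<Rightarrow> 'v::euclidean_space"
    and ell and \<iota> \<kappa> q v w A :: real +
  fixes c :: "nat \<Rightarrow> nat \<Rightarrow> nat \<Rightarrow> nat"
  assumes poly_fin: "\<And>i. i < ell \<Longrightarrow> finite (bipoly_supp (c i))"
    and poly_n: "\<And>i. i < ell \<Longrightarrow> \<exists>a b. (a, b) \<in> bipoly_supp (c i) \<and> a > 0"
    and poly_diff: "\<And>i j. i < ell \<Longrightarrow> j < ell \<Longrightarrow> i \<noteq> j \<Longrightarrow>
        \<not> (\<exists>C::int. \<forall>n N. int (bipoly_eval (c i) n N) - int (bipoly_eval (c j) n N) = C)"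
begin

text \<open>The first alternative does not involve \<open>x\<close>. It records collisions among the
  times of \<open>n\<close> itself and is included in every such set, so that avoiding the sets of
  three other indices is exactly what isolation of the \<open>i0\<close> time requires.\<close>

definition near :: "nat \<Rightarrow> nat \<Rightarrow> nat \<Rightarrow> nat \<Rightarrow> nat set" where
  "near i0 N l x = {n \<in> {1..N}.
     (\<exists>i<ell. i \<noteq> i0 \<and> \<bar>int (bipoly_eval (c i0) n N) - int (bipoly_eval (c i) n N)\<bar> < int l) \<or>
     (\<exists>i<ell. \<bar>int (bipoly_eval (c i0) n N) - int (bipoly_eval (c i) x N)\<bar> < int l)}"

lemma card_near:
  assumes i0: "i0 < ell"
  shows "\<exists>D N0. 1 \<le> N0 \<and> (\<forall>N\<ge>N0. \<forall>l\<ge>1. \<forall>x. card (near i0 N l x) \<le> D * l)"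
proof -
  let ?B = "\<lambda>i N l. {n \<in> {1..N}. \<bar>int (bipoly_eval (c i0) n N) - int (bipoly_eval (c i) n N)\<bar> < int l}"
  let ?E = "\<lambda>i N l x. {n \<in> {1..N}. \<bar>int (bipoly_eval (c i0) n N) - int (bipoly_eval (c i) x N)\<bar> < int l}"
  have "\<forall>i\<in>{..<ell} - {i0}. \<exists>C N0. \<forall>N\<ge>N0. \<forall>l\<ge>1. card (?B i N l) \<le> C * l"
    using i0 by (intro ballI card_bipoly_near_collision poly_fin poly_diff) auto
  from bchoice[OF this] obtain C where
    "\<forall>i\<in>{..<ell} - {i0}. \<exists>N0. \<forall>N\<ge>N0. \<forall>l\<ge>1. card (?B i N l) \<le> C i * l" by (elim exE)
  from bchoice[OF this] obtain N1 where
    "\<forall>i\<in>{..<ell} - {i0}. \<forall>N\<ge>N1 i. \<forall>l\<ge>1. card (?B i N l) \<le> C i * l" by (elim exE)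
  then have CN: "card (?B i N l) \<le> C i * l" if "i \<in> {..<ell} - {i0}" "N1 i \<le> N" "1 \<le> l" for i N l
    using that by simp
  define D where "D = (\<Sum>i\<in>{..<ell} - {i0}. C i) + 2 * ell"
  \<comment> \<open>The sum serves as a common upper bound of the finitely many thresholds.\<close>
  define N0 where "N0 = 1 + (\<Sum>i\<in>{..<ell} - {i0}. N1 i)"
  have "card (near i0 N l x) \<le> D * l" if N: "N0 \<le> N" and l: "1 \<le> l" for N l x
  proof -
    have "near i0 N l x \<subseteq> (\<Union>i\<in>{..<ell} - {i0}. ?B i N l) \<union> (\<Union>i<ell. ?E i N l x)"
      unfolding near_def by auto
    then have "card (near i0 N l x) \<le> card ((\<Union>i\<in>{..<ell} - {i0}. ?B i N l) \<union> (\<Union>i<ell. ?E i N l x))"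
      by (intro card_mono) auto
    also have "\<dots> \<le> card (\<Union>i\<in>{..<ell} - {i0}. ?B i N l) + card (\<Union>i<ell. ?E i N l x)"
      by (rule card_Un_le)
    also have "\<dots> \<le> (\<Sum>i\<in>{..<ell} - {i0}. card (?B i N l)) + (\<Sum>i<ell. card (?E i N l x))"
      by (intro add_mono card_UN_le) auto
    also have "\<dots> \<le> (\<Sum>i\<in>{..<ell} - {i0}. C i * l) + (\<Sum>i<ell. 2 * l)"
    proof (intro add_mono sum_mono)
      fix i assume i: "i \<in> {..<ell} - {i0}"
      have "N1 i \<le> (\<Sum>i\<in>{..<ell} - {i0}. N1 i)" using i by (intro member_le_sum) auto
      then show "card (?B i N l) \<le> C i * l" using N l i by (intro CN) (auto simp: N0_def)
    next
      fix i
      obtain a b where ab: "(a, b) \<in> bipoly_supp (c i0)" "0 < a" using poly_n[OF i0] by blast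
      have "1 \<le> N" using N by (simp add: N0_def)
      then show "card (?E i N l x) \<le> 2 * l"
        by (rule card_bipoly_near_point[OF poly_fin[OF i0] ab])
    qed
    also have "\<dots> = D * l" by (simp add: D_def sum_distrib_right add_mult_distrib)
    finally show ?thesis .
  qed
  moreover have "1 \<le> N0" by (simp add: N0_def)
  ultimately show ?thesis by blast
qed

section \<open>Summation over quadruples of indices\<close>

definition summand :: "((nat \<Rightarrow> 'v) \<Rightarrow> real) \<Rightarrow> nat \<Rightarrow> nat \<Rightarrow> 'a \<Rightarrow> real" where
  "summand G N n \<omega> = G (\<lambda>i. \<xi> (bipoly_eval (c i) n N) \<omega>)"

lemma summand_prod4:
  "(\<Prod>j<4::nat. G (\<lambda>i. \<xi> (bipoly_eval (c i) ([n0, n1, n2, n3] ! j) N) \<omega>))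
    = summand G N n0 \<omega> * (summand G N n1 \<omega> * (summand G N n2 \<omega> * summand G N n3 \<omega>))"
  by (simp add: prod_lessThan_4 summand_def)

lemma summand_prod4_bound:
  fixes K :: real
  assumes G: "holder_class ell \<iota> \<kappa> K G" and K: "0 < K"
  shows "integrable M (\<lambda>\<omega>. summand G N n0 \<omega> * (summand G N n1 \<omega> * (summand G N n2 \<omega> * summand G N n3 \<omega>)))"
    and "\<bar>\<integral>\<omega>. summand G N n0 \<omega> * (summand G N n1 \<omega> * (summand G N n2 \<omega> * summand G N n3 \<omega>)) \<partial>M\<bar>
      \<le> (K * (1 + 2 * ell)) ^ 4 * (1 + 4 * ell * mom)"
  using prod4_bound[OF G K, of "\<lambda>j i. bipoly_eval (c i) ([n0, n1, n2, n3] ! j) N"]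
  unfolding summand_prod4 by auto

lemma summand_prod4_far:
  fixes K :: real
  assumes G: "holder_class ell \<iota> \<kappa> K G" and K: "0 < K" and i0: "i0 < ell" and cen: "centered i0 G"
    and L: "1 \<le> L" and n0: "n0 \<in> {1..N}"
    and far: "n0 \<notin> near i0 N (6 * L) n1 \<union> near i0 N (6 * L) n2 \<union> near i0 N (6 * L) n3"
  shows "\<bar>\<integral>\<omega>. summand G N n0 \<omega> * (summand G N n1 \<omega> * (summand G N n2 \<omega> * summand G N n3 \<omega>)) \<partial>M\<bar>
      \<le> iso_const K / (real L)\<^sup>2"
proof -
  have dist: "y + 6 * L \<le> x \<or> x + 6 * L \<le> y" if "\<not> \<bar>int x - int y\<bar> < int (6 * L)" for x y :: nat
    using that by linarith
  have "isolated i0 (6 * L) (\<lambda>j i. bipoly_eval (c i) ([n0, n1, n2, n3] ! j) N)"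
    unfolding isolated_def
  proof (intro allI impI)
    fix j i :: nat assume j: "j < 4" and i: "i < ell" and ne: "(j, i) \<noteq> (0, i0)"
    have "\<not> \<bar>int (bipoly_eval (c i0) n0 N) - int (bipoly_eval (c i) ([n0, n1, n2, n3] ! j) N)\<bar> < int (6 * L)"
    proof (cases "j = 0")
      case True
      then show ?thesis using far n0 i ne unfolding near_def by auto
    next
      case False
      then have "j = 1 \<or> j = 2 \<or> j = 3" using j by linarith
      then show ?thesis using far n0 i unfolding near_def by auto
    qed
    from dist[OF this]
    show "bipoly_eval (c i) ([n0, n1, n2, n3] ! j) N + 6 * L \<le> bipoly_eval (c i0) ([n0, n1, n2, n3] ! 0) N \<or>
       bipoly_eval (c i0) ([n0, n1, n2, n3] ! 0) N + 6 * L \<le> bipoly_eval (c i) ([n0, n1, n2, n3] ! j) N"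
      by simp
  qed
  from isolated_prod4_bound[OF G K i0 cen this L] show ?thesis unfolding summand_prod4 .
qed

text \<open>With \<open>y = N powr (1/8)\<close> and scales \<open>L1\<close>, \<open>L2\<close> of
  order \<open>y ^ 2\<close>, \<open>y ^ 5\<close>, the contributions are: linked at
  \<open>L1\<close>, \<open>N^2 * L1^2\<close>, of order \<open>y ^ 20\<close>; linked only at
  \<open>L2\<close>, \<open>N^2 * L2^2 / L1^2\<close>, of order \<open>y ^ 22\<close>; the rest,
  \<open>N^4 / L2^2\<close>, again \<open>y ^ 22\<close>. Division by \<open>N^4 = y ^ 32\<close>
  leaves \<open>y\<close> to the power -10.\<close>

lemma moment4_bound:
  fixes K :: real
  assumes G: "holder_class ell \<iota> \<kappa> K G" and K: "0 < K" and i0: "i0 < ell" and cen: "centered i0 G"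
  shows "\<exists>B N0. 0 \<le> B \<and> (\<forall>N\<ge>N0. integrable M (\<lambda>\<omega>. ((\<Sum>n=1..N. summand G N n \<omega>) / real N) ^ 4) \<and>
      (\<integral>\<omega>. ((\<Sum>n=1..N. summand G N n \<omega>) / real N) ^ 4 \<partial>M) \<le> B * real N powr (- 5 / 4))"
proof -
  obtain D N0 where N0: "1 \<le> N0" and D: "\<And>N l x. N0 \<le> N \<Longrightarrow> 1 \<le> l \<Longrightarrow> card (near i0 N l x) \<le> D * l"
    using card_near[OF i0] by blast
  define c0 where "c0 = (K * (1 + 2 * ell)) ^ 4 * (1 + 4 * ell * mom)"
  define c1 where "c1 = iso_const K"
  have mom0: "0 \<le> mom" unfolding mom_def by simp
  have c0: "0 \<le> c0" unfolding c0_def using K mom0 by simp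
  have c1: "0 \<le> c1" unfolding c1_def iso_const_def using K mom0 A by simp
  \<comment> \<open>The number 1296 is \<open>9 * 6^2 * 4\<close>: the count of linked quadruples,
    the isolation distance \<open>6 * L\<close>, and the squared loss 2 from rounding the scales
    up.\<close>
  define B where "B = c0 * (1296 * (real D)\<^sup>2) + c1 * (1296 * (real D)\<^sup>2) + c1"
  have B: "0 \<le> B" unfolding B_def using c0 c1 by simp
  have "integrable M (\<lambda>\<omega>. ((\<Sum>n=1..N. summand G N n \<omega>) / real N) ^ 4) \<and>
      (\<integral>\<omega>. ((\<Sum>n=1..N. summand G N n \<omega>) / real N) ^ 4 \<partial>M) \<le> B * real N powr (- 5 / 4)" if N: "N0 \<le> N" for N
  proof -
    define V where "V = {1..N}"
    have N1: "1 \<le> N" using N N0 by simp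
    \<comment> \<open>The eighth root makes all exponents below integers.\<close>
    define y where "y = real N powr (1 / 8)"
    have y1: "1 \<le> y" unfolding y_def using N1 by (intro ge_one_powr_ge_zero) auto
    have yp: "y ^ k = real N powr (k / 8)" for k :: nat
      unfolding y_def using N1 by (subst powr_realpow[symmetric]) (auto simp: powr_powr)
    have y8: "y ^ 8 = real N" using yp[of 8] N1 by simp
    \<comment> \<open>Two scales, of order \<open>N powr (1/4)\<close> and \<open>N powr (5/8)\<close>: a single one only yields \<open>N ^ 3\<close>, which after
      division by \<open>N ^ 4\<close> is not summable.\<close>
    define L1 where "L1 = nat \<lceil>y ^ 2\<rceil>"
    define L2 where "L2 = nat \<lceil>y ^ 5\<rceil>"
    have L1: "1 \<le> L1" "y ^ 2 \<le> real L1" "real L1 \<le> 2 * y ^ 2"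
      unfolding L1_def using y1 by (intro nat_ceiling_bounds; simp)+
    have L2: "1 \<le> L2" "y ^ 5 \<le> real L2" "real L2 \<le> 2 * y ^ 5"
      unfolding L2_def using y1 by (intro nat_ceiling_bounds; simp)+
    define W where "W l = {(n0, n1, n2, n3). n0 \<in> V \<and> n1 \<in> V \<and> n2 \<in> V \<and> n3 \<in> V \<and>
      n0 \<in> near i0 N l n1 \<union> near i0 N l n2 \<union> near i0 N l n3 \<and>
      n1 \<in> near i0 N l n0 \<union> near i0 N l n2 \<union> near i0 N l n3 \<and>
      n2 \<in> near i0 N l n0 \<union> near i0 N l n1 \<union> near i0 N l n3}" for l
    have WV: "W l \<subseteq> V \<times> V \<times> V \<times> V" for l unfolding W_def by auto
    have finV: "finite (V \<times> V \<times> V \<times> V)" unfolding V_def by simp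
    have cW: "real (card (W (6 * L))) \<le> 324 * (real D)\<^sup>2 * y ^ 16 * (real L)\<^sup>2" if "1 \<le> L" for L
    proof -
      have "card (W (6 * L)) \<le> 9 * (card V)\<^sup>2 * (D * (6 * L))\<^sup>2"
        unfolding W_def
      proof (rule card_linked_quadruples)
        show "card (near i0 N (6 * L) x) \<le> D * (6 * L)" for x by (rule D[OF N]) (use that in simp)
      qed (auto simp: V_def near_def)
      then have "real (card (W (6 * L))) \<le> real (9 * (card V)\<^sup>2 * (D * (6 * L))\<^sup>2)"
        by (simp only: of_nat_le_iff)
      also have "\<dots> = 324 * (real D)\<^sup>2 * (real N)\<^sup>2 * (real L)\<^sup>2" by (simp add: V_def power_mult_distrib)
      also have "(real N)\<^sup>2 = y ^ 16" unfolding y8[symmetric] power_mult[symmetric] by simp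
      finally show ?thesis .
    qed
    define e where "e t = (case t of (n0, n1, n2, n3) \<Rightarrow>
       (\<integral>\<omega>. summand G N n0 \<omega> * (summand G N n1 \<omega> * (summand G N n2 \<omega> * summand G N n3 \<omega>)) \<partial>M))" for t
    have e0: "\<bar>e t\<bar> \<le> c0" for t
      using summand_prod4_bound(2)[OF G K] by (cases t) (simp add: e_def c0_def)
    have e1: "\<bar>e t\<bar> \<le> c1 / (real L)\<^sup>2" if t: "t \<in> V \<times> V \<times> V \<times> V" "t \<notin> W (6 * L)" and L: "1 \<le> L" for t L
    proof -
      obtain n0 n1 n2 n3 where tt: "t = (n0, n1, n2, n3)" by (cases t)
      have nV: "n0 \<in> {1..N}" "n1 \<in> {1..N}" "n2 \<in> {1..N}" "n3 \<in> {1..N}" using t tt by (auto simp: V_def)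
      let ?l = "6 * L"
      note far = summand_prod4_far[OF G K i0 cen L, folded c1_def]
      consider "n0 \<notin> near i0 N ?l n1 \<union> near i0 N ?l n2 \<union> near i0 N ?l n3"
        | "n1 \<notin> near i0 N ?l n0 \<union> near i0 N ?l n2 \<union> near i0 N ?l n3"
        | "n2 \<notin> near i0 N ?l n0 \<union> near i0 N ?l n1 \<union> near i0 N ?l n3"
        using t tt unfolding W_def by blast
      then show ?thesis
      proof cases
        case 1
        then show ?thesis using far[OF nV(1)] by (simp add: e_def tt)
      next
        case 2
        \<comment> \<open>By symmetry of the product the isolated index is moved to the first
          position.\<close>
        have "e t = (\<integral>\<omega>. summand G N n1 \<omega> * (summand G N n0 \<omega> * (summand G N n2 \<omega> * summand G N n3 \<omega>)) \<partial>M)"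
          by (simp add: e_def tt mult_ac)
        then show ?thesis using far[OF nV(2) 2] by simp
      next
        case 3
        have "e t = (\<integral>\<omega>. summand G N n2 \<omega> * (summand G N n0 \<omega> * (summand G N n1 \<omega> * summand G N n3 \<omega>)) \<partial>M)"
          by (simp add: e_def tt mult_ac)
        then show ?thesis using far[OF nV(3) 3] by simp
      qed
    qed
    \<comment> \<open>Each quadruple gets the bound of the largest scale at which it is not linked:
      \<open>c0\<close> if at neither, otherwise \<open>c1\<close> over the square of that
      scale.\<close>
    have ept: "\<bar>e t\<bar> \<le> c0 * indicator (W (6 * L1)) t + c1 / (real L1)\<^sup>2 * indicator (W (6 * L2)) t + c1 / (real L2)\<^sup>2"
      if t: "t \<in> V \<times> V \<times> V \<times> V" for t
    proof -
      have p: "0 \<le> c1 / (real L1)\<^sup>2" "0 \<le> c1 / (real L2)\<^sup>2" using c1 by auto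
      consider "t \<in> W (6 * L1)" | "t \<notin> W (6 * L1)" "t \<in> W (6 * L2)" | "t \<notin> W (6 * L2)" by blast
      then show ?thesis
      proof cases
        case 1
        have "0 \<le> c1 / (real L1)\<^sup>2 * indicator (W (6 * L2)) t"
          using p by (intro mult_nonneg_nonneg) auto
        then show ?thesis using 1 e0[of t] p by simp
      next
        case 2
        then show ?thesis using e1[OF t _ L1(1)] p by simp
      next
        case 3
        have "0 \<le> c1 / (real L1)\<^sup>2 * indicator (W (6 * L2)) t" "0 \<le> c0 * indicator (W (6 * L1)) t"
          using p c0 by (intro mult_nonneg_nonneg; simp)+
        then show ?thesis using e1[OF t 3 L2(1)] by linarith
      qed
    qed
    define T where "T \<omega> = (\<Sum>n=1..N. summand G N n \<omega>)" for \<omega>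
    have T4: "T \<omega> ^ 4 = (\<Sum>(n0, n1, n2, n3)\<in>V \<times> V \<times> V \<times> V.
        summand G N n0 \<omega> * (summand G N n1 \<omega> * (summand G N n2 \<omega> * summand G N n3 \<omega>)))" for \<omega>
      unfolding T_def V_def by (rule sum_power4)
    have iT: "integrable M (\<lambda>\<omega>. T \<omega> ^ 4)"
      unfolding T4 case_prod_beta
      by (intro Bochner_Integration.integrable_sum summand_prod4_bound(1)[OF G K])
    have "(\<integral>\<omega>. T \<omega> ^ 4 \<partial>M) = (\<Sum>t\<in>V \<times> V \<times> V \<times> V. e t)"
      unfolding T4 case_prod_beta e_def
      by (intro Bochner_Integration.integral_sum summand_prod4_bound(1)[OF G K])
    also have "\<dots> \<le> (\<Sum>t\<in>V \<times> V \<times> V \<times> V. c0 * indicator (W (6 * L1)) t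
        + c1 / (real L1)\<^sup>2 * indicator (W (6 * L2)) t + c1 / (real L2)\<^sup>2)"
      by (intro sum_mono order_trans[OF abs_ge_self ept])
    also have "\<dots> = c0 * real (card (W (6 * L1))) + c1 / (real L1)\<^sup>2 * real (card (W (6 * L2)))
        + real (card (V \<times> V \<times> V \<times> V)) * (c1 / (real L2)\<^sup>2)"
    proof -
      have "(\<Sum>t\<in>V \<times> V \<times> V \<times> V. indicator (W l) t) = real (card (W l))" for l
        using WV[of l] finV by (simp add: Int_absorb1 indicator_def sum.If_cases)
      then show ?thesis
        unfolding sum.distrib sum_distrib_left[symmetric] by (simp del: card_cartesian_product)
    qed
    also have "real (card (V \<times> V \<times> V \<times> V)) = y ^ 32"
    proof -
      have "real (card (V \<times> V \<times> V \<times> V)) = real N ^ 4" by (simp add: V_def eval_nat_numeral)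
      also have "\<dots> = y ^ 32" unfolding y8[symmetric] power_mult[symmetric] by simp
      finally show ?thesis .
    qed
    also have "c0 * real (card (W (6 * L1))) \<le> c0 * (1296 * (real D)\<^sup>2) * y ^ 22"
    proof -
      have "(real L1)\<^sup>2 \<le> (2 * y ^ 2)\<^sup>2" using L1 by (intro power_mono) auto
      also have "\<dots> = 4 * y ^ 4" by (simp add: power_mult_distrib power_mult[symmetric])
      finally have l: "(real L1)\<^sup>2 \<le> 4 * y ^ 4" .
      have "real (card (W (6 * L1))) \<le> 324 * (real D)\<^sup>2 * y ^ 16 * (4 * y ^ 4)"
        using cW[OF L1(1)] l y1 by (elim order_trans) (intro mult_left_mono, auto)
      also have "\<dots> = 1296 * (real D)\<^sup>2 * y ^ 20" by (simp add: power_add[symmetric])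
      also have "\<dots> \<le> 1296 * (real D)\<^sup>2 * y ^ 22" using y1 by (intro mult_left_mono power_increasing) auto
      finally show ?thesis using c0 by (simp add: mult_left_mono mult.assoc)
    qed
    also have "c1 / (real L1)\<^sup>2 * real (card (W (6 * L2))) \<le> c1 * (1296 * (real D)\<^sup>2) * y ^ 22"
    proof -
      have "(real L2)\<^sup>2 \<le> (2 * y ^ 5)\<^sup>2" using L2 by (intro power_mono) auto
      also have "\<dots> = 4 * y ^ 10" by (simp add: power_mult_distrib power_mult[symmetric])
      finally have l: "(real L2)\<^sup>2 \<le> 4 * y ^ 10" .
      have "(y ^ 2)\<^sup>2 \<le> (real L1)\<^sup>2" using L1 y1 by (intro power_mono) auto
      then have l1: "y ^ 4 \<le> (real L1)\<^sup>2" by (simp add: power_mult[symmetric])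
      have "real (card (W (6 * L2))) \<le> 324 * (real D)\<^sup>2 * y ^ 16 * (4 * y ^ 10)"
        using cW[OF L2(1)] l y1 by (elim order_trans) (intro mult_left_mono, auto)
      also have "\<dots> = 1296 * (real D)\<^sup>2 * y ^ 22 * y ^ 4" by (simp add: power_add[symmetric])
      finally have "c1 / (real L1)\<^sup>2 * real (card (W (6 * L2))) \<le> c1 / y ^ 4 * (1296 * (real D)\<^sup>2 * y ^ 22 * y ^ 4)"
        using c1 l1 y1 L1(1) by (intro mult_mono divide_left_mono mult_pos_pos) auto
      also have "\<dots> = c1 * (1296 * (real D)\<^sup>2) * y ^ 22" using y1 by simp
      finally show ?thesis .
    qed
    also have "y ^ 32 * (c1 / (real L2)\<^sup>2) \<le> c1 * y ^ 22"
    proof -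
      have "(y ^ 5)\<^sup>2 \<le> (real L2)\<^sup>2" using L2 y1 by (intro power_mono) auto
      then have l2: "y ^ 10 \<le> (real L2)\<^sup>2" by (simp add: power_mult[symmetric])
      have "y ^ 32 * (c1 / (real L2)\<^sup>2) \<le> y ^ 32 * (c1 / y ^ 10)"
        using c1 l2 y1 L2(1) by (intro mult_left_mono divide_left_mono mult_pos_pos) auto
      also have "\<dots> = c1 * y ^ 22"
      proof -
        have "y ^ 32 = y ^ 22 * y ^ 10" by (simp add: power_add[symmetric])
        moreover have "a * x * (c1 / x) = c1 * a" if "x \<noteq> 0" for a x :: real using that by simp
        from this[of "y ^ 10" "y ^ 22"] have "y ^ 22 * y ^ 10 * (c1 / y ^ 10) = c1 * y ^ 22" using y1 by auto
        ultimately show ?thesis by (simp only:)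
      qed
      finally show ?thesis .
    qed
    finally have fin: "(\<integral>\<omega>. T \<omega> ^ 4 \<partial>M) \<le> B * y ^ 22" by (simp add: B_def algebra_simps)
    have "(\<integral>\<omega>. (T \<omega> / real N) ^ 4 \<partial>M) = (\<integral>\<omega>. T \<omega> ^ 4 \<partial>M) / real N ^ 4" by (simp add: power_divide)
    also have "\<dots> \<le> B * y ^ 22 / real N ^ 4" using fin by (intro divide_right_mono) auto
    also have "\<dots> = B * (real N powr (22 / 8) / real N powr 4)" using N1 yp[of 22] by simp
    also have "\<dots> = B * real N powr (- 5 / 4)" unfolding powr_diff[symmetric] by simp
    finally have "(\<integral>\<omega>. (T \<omega> / real N) ^ 4 \<partial>M) \<le> B * real N powr (- 5 / 4)" .
    moreover have "integrable M (\<lambda>\<omega>. (T \<omega> / real N) ^ 4)" using iT by (simp add: power_divide)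
    ultimately show ?thesis unfolding T_def by blast
  qed
  with B show ?thesis by blast
qed

lemma centered_average_tendsto_0:
  fixes K :: real
  assumes G: "holder_class ell \<iota> \<kappa> K G" and K: "0 < K" and i0: "i0 < ell" and cen: "centered i0 G"
  shows "AE \<omega> in M. (\<lambda>N. (\<Sum>n=1..N. summand G N n \<omega>) / real N) \<longlonglongrightarrow> 0"
proof -
  obtain B N0 where B: "0 \<le> B" "\<And>N. N0 \<le> N \<Longrightarrow> integrable M (\<lambda>\<omega>. ((\<Sum>n=1..N. summand G N n \<omega>) / real N) ^ 4)"
    "\<And>N. N0 \<le> N \<Longrightarrow> (\<integral>\<omega>. ((\<Sum>n=1..N. summand G N n \<omega>) / real N) ^ 4 \<partial>M) \<le> B * real N powr (- 5 / 4)"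
    using moment4_bound[OF assms] by metis
  show ?thesis
    by (rule AE_tendsto_0_of_moment4[OF B(2,3) _ B(1)]) auto
qed

end

section \<open>Integrating out one coordinate at a time\<close>

lemma holder_class_diff:
  assumes "holder_class ell \<iota> \<kappa> K G" "holder_class ell \<iota> \<kappa> K' G'"
  shows "holder_class ell \<iota> \<kappa> (K + K') (\<lambda>x. G x - G' x)"
  unfolding holder_class_def
proof (intro conjI allI)
  fix x z :: "nat \<Rightarrow> 'a"
  show "\<bar>(G x - G' x) - (G z - G' z)\<bar> \<le> (K + K') * (1 + (\<Sum>i<ell. npow (norm (x i)) \<iota> + npow (norm (z i)) \<iota>))
      * (\<Sum>i<ell. norm (x i - z i) powr \<kappa>)"
    using holder_classD(1)[OF assms(1), of x z] holder_classD(1)[OF assms(2), of x z]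
    unfolding distrib_right[of K K'] distrib_right[of "K * _"] by linarith
  show "\<bar>G x - G' x\<bar> \<le> (K + K') * (1 + (\<Sum>i<ell. npow (norm (x i)) \<iota>))"
    using holder_classD(2)[OF assms(1), of x] holder_classD(2)[OF assms(2), of x]
    unfolding distrib_right[of K K'] by linarith
qed

lemma npow_sum_update_le:
  fixes x :: "nat \<Rightarrow> 'v::real_normed_vector"
  shows "(\<Sum>i<ell. npow (norm ((x(k := t)) i)) \<iota>) \<le> (\<Sum>i<ell. npow (norm (x i)) \<iota>) + npow (norm t) \<iota>"
proof -
  have "(\<Sum>i<ell. npow (norm ((x(k := t)) i)) \<iota>)
      \<le> (\<Sum>i<ell. npow (norm (x i)) \<iota> + (if i = k then npow (norm t) \<iota> else 0))"
    by (intro sum_mono) auto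
  also have "\<dots> \<le> (\<Sum>i<ell. npow (norm (x i)) \<iota>) + npow (norm t) \<iota>"
    by (simp add: sum.distrib)
  finally show ?thesis .
qed

context polynomial_array
begin

text \<open>The value no longer depends on coordinate \<open>k\<close> but remains a function of the
  whole sequence, so the class is preserved and the operation can be iterated.\<close>

definition int_out :: "nat \<Rightarrow> ((nat \<Rightarrow> 'v) \<Rightarrow> real) \<Rightarrow> (nat \<Rightarrow> 'v) \<Rightarrow> real" where
  "int_out k G x = (\<integral>\<omega>. G (x(k := \<xi> 0 \<omega>)) \<partial>M)"

definition npow_mom :: real where
  "npow_mom = (\<integral>\<omega>. npow (norm (\<xi> 0 \<omega>)) \<iota> \<partial>M)"

lemma npow_mom_nonneg: "0 \<le> npow_mom"
  unfolding npow_mom_def by simp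

lemma npow_measurable [measurable]: "(\<lambda>x. npow (norm (x :: 'v)) \<iota>) \<in> borel_measurable borel"
  unfolding npow_def by measurable

lemma npow_integrable: "integrable M (\<lambda>\<omega>. npow (norm (\<xi> 0 \<omega>)) \<iota>)"
proof (rule Bochner_Integration.integrable_bound)
  show "integrable M (\<lambda>\<omega>. 1 + norm (\<xi> 0 \<omega>) powr v)" using moment0 by simp
  have "\<iota> / v \<le> 1 / w" using exps \<kappa> q by (smt (verit) divide_nonneg_pos)
  also have "\<dots> \<le> 1" using w by simp
  finally have iv: "\<iota> / v \<le> 1" .
  have "npow (norm (\<xi> 0 \<omega>)) \<iota> \<le> 1 + norm (\<xi> 0 \<omega>) powr v" for \<omega>
  proof -
    have "npow (norm (\<xi> 0 \<omega>)) \<iota> \<le> (1 + norm (\<xi> 0 \<omega>) powr v) powr (\<iota> / v)"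
      using v \<iota> by (intro npow_le_powr) auto
    also have "\<dots> \<le> (1 + norm (\<xi> 0 \<omega>) powr v) powr 1" using iv by (intro powr_mono) auto
    finally show ?thesis by simp
  qed
  then show "AE \<omega> in M. norm (npow (norm (\<xi> 0 \<omega>)) \<iota>) \<le> norm (1 + norm (\<xi> 0 \<omega>) powr v)" by simp
qed measurable

lemma holder_class_measurable:
  fixes G :: "(nat \<Rightarrow> 'v) \<Rightarrow> real"
  assumes "holder_class ell \<iota> \<kappa> K G"
  shows "G \<in> borel_measurable borel"
  by (rule borel_measurable_continuous_onI[OF holder_class_continuous[OF assms \<iota> \<kappa>]])

lemma holder_class_section_integrable:
  fixes K :: real
  assumes G: "holder_class ell \<iota> \<kappa> K G" and K: "0 < K"
  shows "integrable M (\<lambda>\<omega>. G (x(k := \<xi> 0 \<omega>)))"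
    and "\<bar>G (x(k := t))\<bar> \<le> K * (1 + (\<Sum>i<ell. npow (norm (x i)) \<iota>) + npow (norm t) \<iota>)"
proof -
  have bd: "\<bar>G (x(k := t))\<bar> \<le> K * (1 + (\<Sum>i<ell. npow (norm (x i)) \<iota>) + npow (norm t) \<iota>)" for t
  proof -
    have "\<bar>G (x(k := t))\<bar> \<le> K * (1 + (\<Sum>i<ell. npow (norm ((x(k := t)) i)) \<iota>))"
      by (rule holder_classD(2)[OF G])
    also have "\<dots> \<le> K * (1 + (\<Sum>i<ell. npow (norm (x i)) \<iota>) + npow (norm t) \<iota>)"
      using npow_sum_update_le[of x k t \<iota> ell] K by (intro mult_left_mono) auto
    finally show ?thesis .
  qed
  then show "\<bar>G (x(k := t))\<bar> \<le> K * (1 + (\<Sum>i<ell. npow (norm (x i)) \<iota>) + npow (norm t) \<iota>)" .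
  have "(\<lambda>\<omega>. x(k := \<xi> 0 \<omega>)) \<in> borel_measurable M"
    by (rule measurable_coordinatewise_then_product) (auto simp: fun_upd_def)
  then have m: "(\<lambda>\<omega>. G (x(k := \<xi> 0 \<omega>))) \<in> borel_measurable M"
    by (rule measurable_compose[OF _ holder_class_measurable[OF G]])
  show "integrable M (\<lambda>\<omega>. G (x(k := \<xi> 0 \<omega>)))"
  proof (rule Bochner_Integration.integrable_bound[OF _ m])
    show "integrable M (\<lambda>\<omega>. K * (1 + (\<Sum>i<ell. npow (norm (x i)) \<iota>) + npow (norm (\<xi> 0 \<omega>)) \<iota>))"
      using npow_integrable by (intro integrable_mult_right Bochner_Integration.integrable_add) auto
    show "AE \<omega> in M. norm (G (x(k := \<xi> 0 \<omega>)))
        \<le> norm (K * (1 + (\<Sum>i<ell. npow (norm (x i)) \<iota>) + npow (norm (\<xi> 0 \<omega>)) \<iota>))"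
      using bd by (auto intro: order_trans[OF _ abs_ge_self])
  qed
qed

text \<open>Both points receive the same value \<open>t\<close> at \<open>k\<close>, so their
  distance does not grow, while each of the two growth sums gains at most
  \<open>npow (norm t) \<iota>\<close>. This is the origin of the factor
  \<open>1 + 2 * npow_mom\<close>.\<close>

lemma holder_class_int_out:
  fixes K :: real
  assumes G: "holder_class ell \<iota> \<kappa> K G" and K: "0 < K"
  shows "holder_class ell \<iota> \<kappa> (K * (1 + 2 * npow_mom)) (int_out k G)"
  unfolding holder_class_def
proof (intro conjI allI)
  fix x z :: "nat \<Rightarrow> 'v"
  note i = holder_class_section_integrable(1)[OF G K]
  define S where "S = (\<Sum>i<ell. npow (norm (x i)) \<iota>)"
  define S' where "S' = (\<Sum>i<ell. npow (norm (z i)) \<iota>)"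
  define E where "E = (\<Sum>i<ell. norm (x i - z i) powr \<kappa>)"
  have S: "0 \<le> S" "0 \<le> S'" "0 \<le> E" unfolding S_def S'_def E_def by (auto intro: sum_nonneg)
  have SS: "(\<Sum>i<ell. npow (norm (x i)) \<iota> + npow (norm (z i)) \<iota>) = S + S'" by (simp add: S_def S'_def sum.distrib)
  have "\<bar>int_out k G x\<bar> \<le> (\<integral>\<omega>. \<bar>G (x(k := \<xi> 0 \<omega>))\<bar> \<partial>M)"
    unfolding int_out_def by (rule integral_abs_bound)
  also have "\<dots> \<le> (\<integral>\<omega>. K * (1 + S + npow (norm (\<xi> 0 \<omega>)) \<iota>) \<partial>M)"
    unfolding S_def using i npow_integrable
    by (intro integral_mono holder_class_section_integrable(2)[OF G K]) auto
  also have "\<dots> = K * (1 + S + npow_mom)"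
    using npow_integrable by (simp add: npow_mom_def prob_space)
  also have "\<dots> \<le> K * ((1 + 2 * npow_mom) * (1 + S))"
    using K S npow_mom_nonneg mult_nonneg_nonneg[OF npow_mom_nonneg S(1)]
    by (intro mult_left_mono) (auto simp: algebra_simps)
  finally show "\<bar>int_out k G x\<bar> \<le> K * (1 + 2 * npow_mom) * (1 + (\<Sum>i<ell. npow (norm (x i)) \<iota>))"
    by (simp add: S_def mult.assoc)
  have pt: "\<bar>G (x(k := t)) - G (z(k := t))\<bar> \<le> K * (1 + S + S' + 2 * npow (norm t) \<iota>) * E" for t
  proof -
    have "\<bar>G (x(k := t)) - G (z(k := t))\<bar> \<le> K * (1 + (\<Sum>i<ell. npow (norm ((x(k := t)) i)) \<iota> + npow (norm ((z(k := t)) i)) \<iota>))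
        * (\<Sum>i<ell. norm ((x(k := t)) i - (z(k := t)) i) powr \<kappa>)"
      by (rule holder_classD(1)[OF G])
    also have "\<dots> \<le> K * (1 + S + S' + 2 * npow (norm t) \<iota>) * E"
    proof (intro mult_mono mult_left_mono)
      show "1 + (\<Sum>i<ell. npow (norm ((x(k := t)) i)) \<iota> + npow (norm ((z(k := t)) i)) \<iota>)
          \<le> 1 + S + S' + 2 * npow (norm t) \<iota>"
        using npow_sum_update_le[of x k t \<iota> ell] npow_sum_update_le[of z k t \<iota> ell]
        unfolding S_def S'_def sum.distrib by linarith
      show "(\<Sum>i<ell. norm ((x(k := t)) i - (z(k := t)) i) powr \<kappa>) \<le> E"
        unfolding E_def by (intro sum_mono) auto
    qed (use K S in \<open>auto intro!: add_nonneg_nonneg sum_nonneg\<close>)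
    finally show ?thesis .
  qed
  have "\<bar>int_out k G x - int_out k G z\<bar> = \<bar>\<integral>\<omega>. G (x(k := \<xi> 0 \<omega>)) - G (z(k := \<xi> 0 \<omega>)) \<partial>M\<bar>"
    unfolding int_out_def using i by simp
  also have "\<dots> \<le> (\<integral>\<omega>. \<bar>G (x(k := \<xi> 0 \<omega>)) - G (z(k := \<xi> 0 \<omega>))\<bar> \<partial>M)"
    by (rule integral_abs_bound)
  also have "\<dots> \<le> (\<integral>\<omega>. K * (1 + S + S' + 2 * npow (norm (\<xi> 0 \<omega>)) \<iota>) * E \<partial>M)"
    using i npow_integrable by (intro integral_mono pt) auto
  also have "\<dots> = K * (1 + S + S' + 2 * npow_mom) * E"
    using npow_integrable by (simp add: npow_mom_def prob_space)
  also have "\<dots> \<le> K * ((1 + 2 * npow_mom) * (1 + (S + S'))) * E"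
    using K S npow_mom_nonneg mult_nonneg_nonneg[OF npow_mom_nonneg S(1)] mult_nonneg_nonneg[OF npow_mom_nonneg S(2)]
    by (intro mult_right_mono mult_left_mono) (auto simp: algebra_simps)
  finally show "\<bar>int_out k G x - int_out k G z\<bar> \<le> K * (1 + 2 * npow_mom)
      * (1 + (\<Sum>i<ell. npow (norm (x i)) \<iota> + npow (norm (z i)) \<iota>)) * (\<Sum>i<ell. norm (x i - z i) powr \<kappa>)"
    unfolding SS E_def[symmetric] by (simp add: mult.assoc)
qed

section \<open>The product law and the induction over coordinates\<close>

definition law :: "'v measure" where "law = distr M borel (\<xi> 0)"

lemma sets_law [measurable_cong, simp]: "sets law = sets borel" and space_law [simp]: "space law = UNIV"
  by (simp_all add: law_def)

lemma prob_space_law: "prob_space law"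
  unfolding law_def by (rule prob_space_distr) simp

lemma holder_class_PiM:
  fixes K :: real
  assumes G: "holder_class ell \<iota> \<kappa> K G" and K: "0 < K"
  shows "integrable (PiM {..<ell} (\<lambda>_. law)) G"
proof -
  interpret L: prob_space law by (rule prob_space_law)
  interpret P: product_prob_space "\<lambda>_. law" "{..<ell}" by unfold_locales
  let ?P = "PiM {..<ell} (\<lambda>_. law)"
  \<comment> \<open>Points of the finite product are \<open>undefined\<close> from
    \<open>ell\<close> on. Replacing these entries by 0 gives a measurable map into the space of all
    sequences, and \<open>G\<close> does not see the change.\<close>
  have "(\<lambda>x i. if i < ell then x i else 0) \<in> borel_measurable ?P"
  proof (rule measurable_coordinatewise_then_product)
    show "(\<lambda>x. if i < ell then x i else 0) \<in> borel_measurable ?P" for i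
    proof (cases "i < ell")
      case True
      then have "(\<lambda>x. x i) \<in> measurable ?P law" by (intro measurable_component_singleton) auto
      then show ?thesis using True by (simp cong: measurable_cong_sets)
    qed simp
  qed
  then have "(\<lambda>x. G (\<lambda>i. if i < ell then x i else 0)) \<in> borel_measurable ?P"
    by (rule measurable_compose[OF _ holder_class_measurable[OF G]])
  moreover have "G (\<lambda>i. if i < ell then x i else 0) = G x" for x
    by (rule holder_class_cong[OF G]) simp
  ultimately have m: "G \<in> borel_measurable ?P" by simp
  have "integrable law (\<lambda>t. npow (norm t) \<iota>)"
    unfolding law_def using npow_integrable by (subst integrable_distr_eq) auto
  then have int: "integrable ?P (\<lambda>x. npow (norm (x i)) \<iota>)" if "i < ell" for i
    using P.PiM_component[of i] that integrable_distr_eq[of "\<lambda>x. x i" ?P law "\<lambda>t. npow (norm t) \<iota>"] by simp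
  show ?thesis
  proof (rule Bochner_Integration.integrable_bound[OF _ m])
    show "integrable ?P (\<lambda>x. K * (1 + (\<Sum>i<ell. npow (norm (x i)) \<iota>)))"
      using int by (intro integrable_mult_right Bochner_Integration.integrable_add
          Bochner_Integration.integrable_sum) auto
    show "AE x in ?P. norm (G x) \<le> norm (K * (1 + (\<Sum>i<ell. npow (norm (x i)) \<iota>)))"
      using holder_classD(2)[OF G] by (auto intro: order_trans[OF _ abs_ge_self])
  qed
qed

lemma int_out_update: "int_out k G (x(k := t)) = int_out k G x"
  unfolding int_out_def by simp

text \<open>By Fubini with coordinate \<open>k\<close> innermost, the integral of any
  \<open>H\<close> in the class is that of \<open>int_out k H\<close> over the other coordinates.
  Since \<open>int_out k\<close> is idempotent, \<open>G\<close> and \<open>int_out k G\<close> give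
  the same value.\<close>

lemma integral_PiM_int_out:
  fixes K :: real
  assumes G: "holder_class ell \<iota> \<kappa> K G" and K: "0 < K" and k: "k < ell"
  shows "(\<integral>x. int_out k G x \<partial>PiM {..<ell} (\<lambda>_. law)) = (\<integral>x. G x \<partial>PiM {..<ell} (\<lambda>_. law))"
proof -
  interpret L: prob_space law by (rule prob_space_law)
  interpret P: product_sigma_finite "\<lambda>_. law" by unfold_locales
  have ins: "{..<ell} = insert k ({..<ell} - {k})" using k by auto
  have K': "0 < K * (1 + 2 * npow_mom)" using K npow_mom_nonneg by (intro mult_pos_pos) auto
  have sec: "(\<integral>t. H (x(k := t)) \<partial>law) = int_out k H x" if H: "holder_class ell \<iota> \<kappa> K'' H" for H K'' x
  proof -
    have "(\<lambda>t. x(k := t)) \<in> borel_measurable borel"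
      by (rule measurable_coordinatewise_then_product) (auto simp: fun_upd_def)
    then have "(\<lambda>t. H (x(k := t))) \<in> borel_measurable borel"
      by (rule measurable_compose[OF _ holder_class_measurable[OF H]])
    then show ?thesis unfolding law_def int_out_def by (subst integral_distr) auto
  qed
  have "(\<integral>x. H x \<partial>PiM {..<ell} (\<lambda>_. law)) = (\<integral>x. int_out k H x \<partial>PiM ({..<ell} - {k}) (\<lambda>_. law))"
    if H: "holder_class ell \<iota> \<kappa> K'' H" "0 < K''" for H and K'' :: real
    using P.product_integral_insert[of "{..<ell} - {k}" k H] holder_class_PiM[OF H] ins sec[OF H(1)]
    by simp
  from this[OF G K] this[OF holder_class_int_out[OF G K] K']
  moreover have "int_out k (int_out k G) = int_out k G"
    unfolding int_out_def[of k "int_out k G"] int_out_update by (simp add: prob_space)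
  ultimately show ?thesis by simp
qed

text \<open>Induction on the number \<open>k\<close> of leading coordinates on which
  \<open>G\<close> depends. Integrating out the last of them leaves a function of fewer coordinates
  with the same mean, and the difference is centered in that coordinate, so its averages tend to 0.
  For \<open>k = 0\<close> the function is constant.\<close>

lemma average_tendsto:
  fixes K :: real
  assumes "k \<le> ell" "holder_class ell \<iota> \<kappa> K G" "0 < K"
    and "\<And>x z. (\<And>i. i < k \<Longrightarrow> x i = z i) \<Longrightarrow> G x = G z"
  shows "AE \<omega> in M. (\<lambda>N. (\<Sum>n=1..N. summand G N n \<omega>) / real N)
      \<longlonglongrightarrow> (\<integral>x. G x \<partial>PiM {..<ell} (\<lambda>_. law))"
  using assms
proof (induction k arbitrary: G K)
  case 0
  interpret L: prob_space law by (rule prob_space_law)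
  interpret P: product_prob_space "\<lambda>_. law" "{..<ell}" by unfold_locales
  obtain C where C: "\<And>x. G x = C" using 0(4) by (metis not_less_zero)
  have "\<forall>\<^sub>F N in sequentially. (\<Sum>n=1..N. summand G N n \<omega>) / real N = C" for \<omega>
    using eventually_gt_at_top[of 0] by eventually_elim (simp add: summand_def C)
  then have "(\<lambda>N. (\<Sum>n=1..N. summand G N n \<omega>) / real N) \<longlonglongrightarrow> C" for \<omega>
    by (rule tendsto_eventually)
  moreover have "(\<integral>x. G x \<partial>PiM {..<ell} (\<lambda>_. law)) = C" by (simp add: C P.P.prob_space)
  ultimately show ?case by simp
next
  case (Suc k)
  define I where "I = int_out k G"
  have k: "k < ell" using Suc.prems(1) by simp
  note G = Suc.prems(2) and K = Suc.prems(3)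
  have K': "0 < K * (1 + 2 * npow_mom)" using K npow_mom_nonneg by (intro mult_pos_pos) auto
  have clI: "holder_class ell \<iota> \<kappa> (K * (1 + 2 * npow_mom)) I"
    unfolding I_def by (rule holder_class_int_out[OF G K])
  have dep: "I x = I z" if "\<And>i. i < k \<Longrightarrow> x i = z i" for x z
    unfolding I_def int_out_def
    by (intro Bochner_Integration.integral_cong refl Suc.prems(4)) (use that in \<open>auto simp: less_Suc_eq\<close>)
  have 1: "AE \<omega> in M. (\<lambda>N. (\<Sum>n=1..N. summand I N n \<omega>) / real N)
      \<longlonglongrightarrow> (\<integral>x. I x \<partial>PiM {..<ell} (\<lambda>_. law))"
    by (rule Suc.IH[OF _ clI K' dep]) (use k in auto)
  define H where "H x = G x - I x" for x
  have clH: "holder_class ell \<iota> \<kappa> (K + K * (1 + 2 * npow_mom)) H"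
    unfolding H_def by (rule holder_class_diff[OF G clI])
  have "centered k H"
    unfolding centered_def H_def I_def int_out_update
  proof
    fix x
    have "(\<integral>\<omega>. G (x(k := \<xi> 0 \<omega>)) - int_out k G x \<partial>M)
        = (\<integral>\<omega>. G (x(k := \<xi> 0 \<omega>)) \<partial>M) - (\<integral>\<omega>. int_out k G x \<partial>M)"
      by (rule Bochner_Integration.integral_diff[OF holder_class_section_integrable(1)[OF G K]]) simp
    then show "(\<integral>\<omega>. G (x(k := \<xi> 0 \<omega>)) - int_out k G x \<partial>M) = 0"
      by (simp add: int_out_def[symmetric] prob_space)
  qed
  then have 2: "AE \<omega> in M. (\<lambda>N. (\<Sum>n=1..N. summand H N n \<omega>) / real N) \<longlonglongrightarrow> 0"
    using K K' by (intro centered_average_tendsto_0[OF clH _ k]) auto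
  have split: "(\<Sum>n=1..N. summand G N n \<omega>) / real N
     = (\<Sum>n=1..N. summand H N n \<omega>) / real N + (\<Sum>n=1..N. summand I N n \<omega>) / real N" for N \<omega>
    by (simp add: add_divide_distrib[symmetric] sum.distrib[symmetric] summand_def H_def)
  have eq: "(\<integral>x. I x \<partial>PiM {..<ell} (\<lambda>_. law)) = (\<integral>x. G x \<partial>PiM {..<ell} (\<lambda>_. law))"
    unfolding I_def by (rule integral_PiM_int_out[OF G K k])
  from 1 2 show ?case
  proof eventually_elim
    case (elim \<omega>)
    show ?case unfolding split using tendsto_add[OF elim(2) elim(1)[unfolded eq]] by simp
  qed
qed

end

section \<open>The theorem\<close>

text \<open>The coefficients \<open>beta_approx\<close> need not be monotone, so decay is only available along a suitable index in
  each dyadic block.\<close>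

lemma summable_small_term:
  fixes a :: "nat \<Rightarrow> real"
  assumes sum: "summable (\<lambda>l. real l * a l)" and a: "\<And>l. 0 \<le> a l" and L: "1 \<le> L"
  shows "\<exists>r. L \<le> r \<and> r \<le> 2 * L \<and> a r \<le> ((\<Sum>l. real l * a l) + 1) / (real L)\<^sup>2"
proof (rule ccontr)
  define T where "T = (\<Sum>l. real l * a l)"
  have T: "0 \<le> T" unfolding T_def using a by (intro suminf_nonneg sum) auto
  assume "\<not> ?thesis"
  then have big: "(T + 1) / (real L)\<^sup>2 < a r" if "L \<le> r" "r \<le> 2 * L" for r
    using that unfolding T_def by (meson not_le)
  \<comment> \<open>If the claim failed, the \<open>L + 1\<close> terms of the block from
    \<open>L\<close> to \<open>2 * L\<close> would each be at least \<open>(T + 1) / L\<close>, and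
    together exceed the total \<open>T\<close>.\<close>
  have "(T + 1) \<le> real (Suc L) * ((T + 1) / real L)"
    using L T by (simp add: field_simps)
  also have "\<dots> = (\<Sum>l\<in>{L..2 * L}. (T + 1) / real L)" using L by (simp add: Suc_diff_le)
  also have "\<dots> \<le> (\<Sum>l\<in>{L..2 * L}. real l * a l)"
  proof (rule sum_mono)
    fix l assume l: "l \<in> {L..2 * L}"
    have "(T + 1) / real L = real L * ((T + 1) / (real L)\<^sup>2)" using L by (simp add: power2_eq_square)
    also have "\<dots> \<le> real l * a l" using l T big[of l] by (intro mult_mono) auto
    finally show "(T + 1) / real L \<le> real l * a l" .
  qed
  also have "\<dots> \<le> T" unfolding T_def using a by (intro sum_le_suminf sum) auto
  finally show False by simp
qed


theorem mainTheorem1: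
  fixes M :: "'a measure"
    and Fam :: "int extended \<Rightarrow> int extended \<Rightarrow> 'a measure"
    and \<xi> :: "nat \<Rightarrow> 'a \<Rightarrow> 'v::euclidean_space"
    and \<mu> :: "'v measure"
    and F :: "(nat \<Rightarrow> 'v) \<Rightarrow> real"
    and ell :: nat
    and K \<iota> \<kappa> w q :: real
    and c :: "nat \<Rightarrow> nat \<Rightarrow> nat \<Rightarrow> nat"
  assumes prob: "prob_space M"
    and Fam_sub: "\<And>k l. k \<le> l \<Longrightarrow> subalgebra M (Fam k l)"
    and Fam_mono: "\<And>k l k' l'. k \<le> l \<Longrightarrow> k' \<le> k \<Longrightarrow> l \<le> l' \<Longrightarrow> sets (Fam k l) \<subseteq> sets (Fam k' l')"
    and \<xi>_meas: "\<And>n. \<xi> n \<in> borel_measurable M"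
    and stat1: "\<And>n. distr M borel (\<xi> n) = \<mu>"
    and stat2: "\<And>n m n' m'. int m - int n = int m' - int n' \<Longrightarrow>
        distr M borel (\<lambda>\<omega>. (\<xi> n \<omega>, \<xi> m \<omega>)) = distr M borel (\<lambda>\<omega>. (\<xi> n' \<omega>, \<xi> m' \<omega>))"
    and K_pos: "K > 0" and \<iota>_nonneg: "\<iota> \<ge> 0" and \<kappa>_pos: "0 < \<kappa>" and \<kappa>_le: "\<kappa> \<le> 1"
    and F_hoelder: "\<And>x z. x \<in> extensional {..<ell} \<Longrightarrow> z \<in> extensional {..<ell} \<Longrightarrow>
        \<bar>F x - F z\<bar> \<le> K * (1 + (\<Sum>i<ell. npow (norm (x i)) \<iota> + npow (norm (z i)) \<iota>))
                          * (\<Sum>i<ell. norm (x i - z i) powr \<kappa>)"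
    and F_growth: "\<And>x. x \<in> extensional {..<ell} \<Longrightarrow>
        \<bar>F x\<bar> \<le> K * (1 + (\<Sum>i<ell. npow (norm (x i)) \<iota>))"
    and w_gt: "w > 4" and q_ge: "q \<ge> 1"
    and moments: "\<exists>v>0. 1 / w > \<iota> / v + \<kappa> / q \<and>
        Lp_norm M v (\<xi> 0) < \<infinity> \<and> Lp_norm M w (\<xi> 0) < \<infinity> \<and> Lp_norm M q (\<xi> 0) < \<infinity>"
    and poly_fin: "\<And>i. i < ell \<Longrightarrow> finite (bipoly_supp (c i))"
    and poly_n: "\<And>i. i < ell \<Longrightarrow> \<exists>a b. (a, b) \<in> bipoly_supp (c i) \<and> a > 0"
    and poly_deg: "\<And>i. Suc i < ell \<Longrightarrow> bipoly_deg (c i) \<le> bipoly_deg (c (Suc i))"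
    and poly_diff: "\<And>i j. i < ell \<Longrightarrow> j < ell \<Longrightarrow> i \<noteq> j \<Longrightarrow>
        \<not> (\<exists>C::int. \<forall>n N. int (bipoly_eval (c i) n N) - int (bipoly_eval (c j) n N) = C)"
    and poly_lin: "\<And>i. i < ell \<Longrightarrow> bipoly_deg (c i) = 1 \<Longrightarrow>
        \<exists>a b::int. \<forall>n N. int (bipoly_eval (c i) n N) = a * int n + b * int N"
    and beta_fin: "\<And>l. l \<ge> 1 \<Longrightarrow> beta_approx M Fam \<xi> q l < \<infinity>"
    and series: "summable (\<lambda>l. real l * (phi_mix M Fam l powr (1 - 4 / w)
                                   + enn2real (beta_approx M Fam \<xi> q l) powr \<kappa>))"
  shows "AE \<omega> in M. (\<lambda>N. (\<Sum>n=1..N. F (restrict (\<lambda>i. \<xi> (bipoly_eval (c i) n N) \<omega>) {..<ell})) / real N)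
            \<longlonglongrightarrow> (\<integral>x. F x \<partial>(PiM {..<ell} (\<lambda>_. \<mu>)))"
proof -
  interpret prob_space M by (rule prob)
  from moments obtain v0 where v0: "0 < v0" "\<iota> / v0 + \<kappa> / q < 1 / w"
    and fin_v0: "Lp_norm M v0 (\<xi> 0) < (\<infinity>::ennreal)" and fin_w: "Lp_norm M w (\<xi> 0) < (\<infinity>::ennreal)" by auto
  \<comment> \<open>Raising the moment exponent to at least \<open>w\<close> ensures
    \<open>1 \<le> v\<close>, keeps the moment finite because both candidates are covered, and can
    only lower \<iota> \<open>/ v\<close>.\<close>
  define v where "v = max v0 w"
  have v: "1 \<le> v" using w_gt by (simp add: v_def)
  have "\<iota> / v \<le> \<iota> / v0" using v0 \<iota>_nonneg by (intro divide_left_mono) (auto simp: v_def)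
  then have exps: "\<iota> / v + \<kappa> / q < 1 / w" using v0 by linarith
  have "Lp_norm M v (\<xi> 0) < (\<infinity>::ennreal)" using fin_v0 fin_w by (simp add: v_def max_def)
  then have mom: "integrable M (\<lambda>\<omega>. norm (\<xi> 0 \<omega>) powr v)"
    by (rule Lp_norm_finiteD(1)) (use \<xi>_meas v in auto)
  define a where "a l = phi_mix M Fam l powr (1 - 4 / w) + enn2real (beta_approx M Fam \<xi> q l) powr \<kappa>" for l
  \<comment> \<open>The added 1 matches \<open>summable_small_term\<close> and makes
    \<open>A\<close> positive even if all coefficients vanish.\<close>
  define A where "A = (\<Sum>l. real l * a l) + 1"
  have a0: "0 \<le> a l" for l unfolding a_def by simp
  have sum_a: "summable (\<lambda>l. real l * a l)" using series by (simp add: a_def)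
  have A: "0 < A" using suminf_nonneg[OF sum_a] a0 by (simp add: A_def add_nonneg_pos)
  have scale: "\<exists>r. L \<le> r \<and> r \<le> 2 * L \<and>
        phi_mix M Fam r powr (1 - 4 / w) \<le> A / (real L)\<^sup>2 \<and>
        beta_approx M Fam \<xi> q r < (\<infinity>::ennreal) \<and>
        enn2real (beta_approx M Fam \<xi> q r) powr \<kappa> \<le> A / (real L)\<^sup>2" if L: "1 \<le> L" for L
  proof -
    obtain r where r: "L \<le> r" "r \<le> 2 * L" "a r \<le> A / (real L)\<^sup>2"
      using summable_small_term[OF sum_a a0 L] unfolding A_def by blast
    have "0 \<le> phi_mix M Fam r powr (1 - 4 / w)" "0 \<le> enn2real (beta_approx M Fam \<xi> q r) powr \<kappa>" by auto
    then have "phi_mix M Fam r powr (1 - 4 / w) \<le> A / (real L)\<^sup>2"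
      "enn2real (beta_approx M Fam \<xi> q r) powr \<kappa> \<le> A / (real L)\<^sup>2"
      using r(3) unfolding a_def by linarith+
    then show ?thesis using r beta_fin[of r] L by (intro exI[of _ r]) auto
  qed
  interpret polynomial_array M Fam \<xi> ell \<iota> \<kappa> q v w A c
    by unfold_locales
       (fact Fam_sub Fam_mono \<xi>_meas mom \<iota>_nonneg \<kappa>_pos q_ge v w_gt exps A scale poly_fin poly_n poly_diff
        | simp add: stat1)+
  have law: "law = \<mu>" by (simp add: law_def stat1)
  \<comment> \<open>Extends \<open>F\<close> from functions extensional on \<open>{..<ell}\<close>
    to all sequences, as \<open>holder_class\<close> requires; on the space of the product measure
    the two agree.\<close>
  define G where "G x = F (restrict x {..<ell})" for x
  have G: "holder_class ell \<iota> \<kappa> K G"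
    unfolding holder_class_def
  proof (intro conjI allI)
    fix x z :: "nat \<Rightarrow> 'v"
    show "\<bar>G x - G z\<bar> \<le> K * (1 + (\<Sum>i<ell. npow (norm (x i)) \<iota> + npow (norm (z i)) \<iota>))
                          * (\<Sum>i<ell. norm (x i - z i) powr \<kappa>)"
      using F_hoelder[of "restrict x {..<ell}" "restrict z {..<ell}"] by (simp add: G_def)
    show "\<bar>G x\<bar> \<le> K * (1 + (\<Sum>i<ell. npow (norm (x i)) \<iota>))"
      using F_growth[of "restrict x {..<ell}"] by (simp add: G_def)
  qed
  have "(\<integral>x. G x \<partial>PiM {..<ell} (\<lambda>_. \<mu>)) = (\<integral>x. F x \<partial>PiM {..<ell} (\<lambda>_. \<mu>))"
    unfolding G_def
    by (intro Bochner_Integration.integral_cong refl arg_cong[of _ _ F])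
       (auto simp: space_PiM PiE_def extensional_restrict)
  then show ?thesis
    using average_tendsto[OF order_refl G K_pos holder_class_cong[OF G]]
    unfolding law summand_def G_def by simp
qed

end
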